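(* Let $X$ be a conservative CBI-process with functional characteristics $(F,R)$, where $F$ has parameters $(b,m)$ and $R$ has parameters $(\alpha,\beta,\mu)$. Suppose that $X$ is non-degenerate (i.e. degenerate neither of the first nor of the second kind) and converges to a limit distribution $L$. Then $$\mathrm{supp}\,L=[b/\lambda_0,\infty),$$ where $\lambda_0\in(0,\infty]$ is the effective drift of $\widehat X^R=-X^R$ (and $b/\infty=0$). In particular, $\mathrm{supp}\,L=[0,\infty)$ if and only if $b=0$ or the paths of $X^R$ have infinite variation.
   Context: A conservative CBI-process (continuous-state branching process with immigration) is a stochastically continuous Markov process $X=(X_t)_{t\ge0}$ with state space $[0,\infty)$ such that $-\log\mathbb{E}^x[e^{-uX_t}]=\phi(t,u)+x\psi(t,u)$ for all $t,u,x\ge 0$ and some functions $\phi,\psi$. By Kawazu–Watanabe, the derivatives $F(u)=\partial_t\phi(t,u)|_{t=0}$, $R(u)=\partial_t\psi(t,u)|_{t=0}$ exist and have the form $$F(u)=bu-\int_{(0,\infty)}(e^{-u\xi}-1)\,m(\mathrm{d}\xi),\qquad R(u)=-\alpha u^2+\beta u-\int_{(0,\infty)}\left(e^{-u\xi}-1+u\xi\mathbf 1_{(0,1]}(\xi)\right)\mu(\mathrm{d}\xi),$$ with $\alpha,b\ge0$, $\beta\in\mathbb{R}$, $m,\mu$ Lévy measures on $(0,\infty)$, $\int(\xi\wedge1)\,m(\mathrm{d}\xi)<\infty$, $\int(\xi^2\wedge 1)\,\mu(\mathrm{d}\xi)<\infty$, and $\int_{0+}\frac{\mathrm{d}s}{\max(R(s),0)}=\infty$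 (the integral over an arbitrarily small right neighbourhood of $0$). Moreover $\partial_t\phi=F(\psi)$, $\phi(0,u)=0$, $\partial_t\psi=R(\psi)$, $\psi(0,u)=u$. Conversely, any such pair $(F,R)$ determines a unique conservative CBI-process. $(F,R)$ are its functional characteristics. $X^R$ denotes the Lévy process without negative jumps with $\mathbb{E}[e^{-uX^R_t}]=e^{-tR(u)}$. A probability measure $L$ on $[0,\infty)$ is the limit distribution of $X$ if $X_t\to L$ in distribution as $t\to\infty$ under $\mathbb{P}^x$ for every $x\ge0$. If $L$ exists then $R'_+(0)\le0$, $R\not\equiv0$, $R(u)<0$ for all $u>0$, and $-\log\int e^{-ux}L(\mathrm{d}x)=-\int_0^uF(s)/R(s)\,\mathrm{d}s$ for $u\ge0$. Effective drift: $\lambda_0=\int_{(0,1]}\xi\,\mu(\mathrm{d}\xi)-\beta$ if $X^R$ has paths of bounded variation (i.e. $\alpha=0$ and $\int_{(0,1]}\xi\mu(\mathrm{d}\xi)<\infty$), and $\lambda_0=+\infty$ otherwise; $\lambda_0>0$ whenever $L$ exists. $X$ is degenerate of the first kind if it is deterministic for all starting values $X_0=x\in[0,\infty)$ (equivalently $F(u)=bu$ and $R(u)=\beta u$); it is degenerate of the second kind if it is deterministic when started at $X_0=0$ (the second but not the first kind occurs iff $F\equiv0$ and $X^R$ is not deterministic). *)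

theory Defs
  imports "HOL-Probability.Probability"
begin

section \<open>Continuous-state branching processes with immigration\<close>

definition natural_filtration :: "'w measure \<Rightarrow> (real \<Rightarrow> 'w \<Rightarrow> real) \<Rightarrow> real \<Rightarrow> 'w measure" where
  "natural_filtration M X t =
     sigma (space M) {X r -` B \<inter> space M | r B. 0 \<le> r \<and> r \<le> t \<and> B \<in> sets borel}"

text \<open>A time-homogeneous Markov process with state space \<open>[0, \<infinity>)\<close>: one measurable space that
  carries the process \<open>X\<close> and a probability measure \<open>P x\<close> for every starting value \<open>x \<ge> 0\<close>.
  Times and states are real numbers; nothing is required at negative times or states.\<close>

locale markov_process =
  fixes P :: "real \<Rightarrow> 'w measure" and X :: "real \<Rightarrow> 'w \<Rightarrow> real"
  assumes prob_space_P: "0 \<le> x \<Longrightarrow> prob_space (P x)"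
    and sets_P: "0 \<le> x \<Longrightarrow> sets (P x) = sets (P 0)"
    and measurable_X: "0 \<le> t \<Longrightarrow> X t \<in> borel_measurable (P 0)"
    and nonneg_X: "0 \<le> t \<Longrightarrow> \<omega> \<in> space (P 0) \<Longrightarrow> 0 \<le> X t \<omega>"
    and start_X: "0 \<le> x \<Longrightarrow> AE \<omega> in P x. X 0 \<omega> = x"
    and measurable_transition: "0 \<le> t \<Longrightarrow> A \<in> sets borel \<Longrightarrow>
      (\<lambda>x. measure (distr (P x) borel (X t)) A) \<in> borel_measurable (restrict_space borel {0..})"
    and markov_property: "0 \<le> x \<Longrightarrow> 0 \<le> s \<Longrightarrow> 0 \<le> t \<Longrightarrow> A \<in> sets borel \<Longrightarrow>
      AE \<omega> in P x. real_cond_exp (P x) (natural_filtration (P x) X s)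
          (\<lambda>\<omega>'. indicator A (X (s + t) \<omega>')) \<omega>
        = measure (distr (P (X s \<omega>)) borel (X t)) A"

definition stochastically_continuous ::
    "(real \<Rightarrow> 'w measure) \<Rightarrow> (real \<Rightarrow> 'w \<Rightarrow> real) \<Rightarrow> bool" where
  "stochastically_continuous P X \<longleftrightarrow> (\<forall>x\<ge>0. \<forall>t\<ge>0. \<forall>\<epsilon>>0.
     ((\<lambda>s. measure (P x) {\<omega> \<in> space (P x). \<epsilon> \<le> \<bar>X s \<omega> - X t \<omega>\<bar>}) \<longlongrightarrow> 0) (at t within {0..}))"

definition affine_exponents ::
    "(real \<Rightarrow> 'w measure) \<Rightarrow> (real \<Rightarrow> 'w \<Rightarrow> real) \<Rightarrow>
     (real \<Rightarrow> real \<Rightarrow> real) \<Rightarrow> (real \<Rightarrow> real \<Rightarrow> real) \<Rightarrow> bool" where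
  "affine_exponents P X \<phi> \<psi> \<longleftrightarrow> (\<forall>t\<ge>0. \<forall>u\<ge>0. \<forall>x\<ge>0.
     - ln (\<integral>\<omega>. exp (- u * X t \<omega>) \<partial>P x) = \<phi> t u + x * \<psi> t u)"

text \<open>Conservativeness is the requirement that \<open>X\<close> lives in \<open>[0, \<infinity>)\<close> without a cemetery state
  under the probability measures \<open>P x\<close>.\<close>

definition conservative_CBI ::
    "(real \<Rightarrow> 'w measure) \<Rightarrow> (real \<Rightarrow> 'w \<Rightarrow> real) \<Rightarrow> bool" where
  "conservative_CBI P X \<longleftrightarrow> markov_process P X \<and> stochastically_continuous P X \<and>
     (\<exists>\<phi> \<psi>. affine_exponents P X \<phi> \<psi>)"

text \<open>The derivative at time \<open>0\<close> is one-sided. Only the values of \<open>F\<close> and \<open>R\<close> on \<open>[0, \<infinity>)\<close>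
  are meaningful.\<close>

definition functional_characteristics ::
    "(real \<Rightarrow> 'w measure) \<Rightarrow> (real \<Rightarrow> 'w \<Rightarrow> real) \<Rightarrow> (real \<Rightarrow> real) \<Rightarrow> (real \<Rightarrow> real) \<Rightarrow> bool" where
  "functional_characteristics P X F R \<longleftrightarrow> (\<exists>\<phi> \<psi>. affine_exponents P X \<phi> \<psi> \<and>
     (\<forall>u\<ge>0. ((\<lambda>t. \<phi> t u) has_real_derivative F u) (at 0 within {0..}) \<and>
            ((\<lambda>t. \<psi> t u) has_real_derivative R u) (at 0 within {0..})))"

definition immigration_parameters :: "(real \<Rightarrow> real) \<Rightarrow> real \<Rightarrow> real measure \<Rightarrow> bool" where
  "immigration_parameters F b m \<longleftrightarrow>
     0 \<le> b \<and> sets m = sets borel \<and> emeasure m {..0} = 0 \<and>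
     (\<integral>\<^sup>+\<xi>\<in>{0<..}. ennreal (min \<xi> 1) \<partial>m) < \<infinity> \<and>
     (\<forall>u\<ge>0. F u = b * u - (LINT \<xi>:{0<..}|m. exp (- u * \<xi>) - 1))"

text \<open>In the last condition \<open>1 / 0 = \<infinity>\<close> in \<^typ>\<open>ennreal\<close>, so it holds whenever
  \<open>R \<le> 0\<close> near \<open>0\<close>.\<close>

definition branching_parameters ::
    "(real \<Rightarrow> real) \<Rightarrow> real \<Rightarrow> real \<Rightarrow> real measure \<Rightarrow> bool" where
  "branching_parameters R \<alpha> \<beta> \<mu> \<longleftrightarrow>
     0 \<le> \<alpha> \<and> sets \<mu> = sets borel \<and> emeasure \<mu> {..0} = 0 \<and>
     (\<integral>\<^sup>+\<xi>\<in>{0<..}. ennreal (min (\<xi>\<^sup>2) 1) \<partial>\<mu>) < \<infinity> \<and>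
     (\<forall>u\<ge>0. R u = - \<alpha> * u\<^sup>2 + \<beta> * u
        - (LINT \<xi>:{0<..}|\<mu>. exp (- u * \<xi>) - 1 + u * \<xi> * indicator {0<..1} \<xi>)) \<and>
     (\<forall>\<epsilon>>0. (\<integral>\<^sup>+s\<in>{0<..<\<epsilon>}. 1 / ennreal (max (R s) 0) \<partial>lborel) = \<infinity>)"

text \<open>The first case is that of paths of bounded variation of the associated Levy process.\<close>

definition effective_drift :: "real \<Rightarrow> real \<Rightarrow> real measure \<Rightarrow> ereal" where
  "effective_drift \<alpha> \<beta> \<mu> =
     (if \<alpha> = 0 \<and> (\<integral>\<^sup>+\<xi>\<in>{0<..1}. ennreal \<xi> \<partial>\<mu>) < \<infinity>
      then ereal ((LINT \<xi>:{0<..1}|\<mu>. \<xi>) - \<beta>) else \<infinity>)"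

definition deterministic_from ::
    "(real \<Rightarrow> 'w measure) \<Rightarrow> (real \<Rightarrow> 'w \<Rightarrow> real) \<Rightarrow> real \<Rightarrow> bool" where
  "deterministic_from P X x \<longleftrightarrow> (\<exists>f. \<forall>t\<ge>0. AE \<omega> in P x. X t \<omega> = f t)"

definition degenerate_first_kind ::
    "(real \<Rightarrow> 'w measure) \<Rightarrow> (real \<Rightarrow> 'w \<Rightarrow> real) \<Rightarrow> bool" where
  "degenerate_first_kind P X \<longleftrightarrow> (\<forall>x\<ge>0. deterministic_from P X x)"

definition degenerate_second_kind ::
    "(real \<Rightarrow> 'w measure) \<Rightarrow> (real \<Rightarrow> 'w \<Rightarrow> real) \<Rightarrow> bool" where
  "degenerate_second_kind P X \<longleftrightarrow> deterministic_from P X 0"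

text \<open>Convergence in distribution as \<open>t \<rightarrow> \<infinity>\<close> is expressed along all sequences of times
  tending to infinity, because \<^const>\<open>weak_conv_m\<close> is about sequences.\<close>

definition limit_distribution ::
    "(real \<Rightarrow> 'w measure) \<Rightarrow> (real \<Rightarrow> 'w \<Rightarrow> real) \<Rightarrow> real measure \<Rightarrow> bool" where
  "limit_distribution P X L \<longleftrightarrow>
     prob_space L \<and> sets L = sets borel \<and> emeasure L {..<0} = 0 \<and>
     (\<forall>x\<ge>0. \<forall>s. (\<forall>n. 0 \<le> s n) \<and> filterlim s at_top sequentially \<longrightarrow>
        weak_conv_m (\<lambda>n. distr (P x) borel (X (s n))) L)"

definition measure_support :: "'a::topological_space measure \<Rightarrow> 'a set" where
  "measure_support M = {x. \<forall>U. open U \<and> x \<in> U \<longrightarrow> 0 < emeasure M U}"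

section \<open>Levy processes and variation of paths\<close>

locale levy_process = prob_space N
  for N :: "'v measure" and Y :: "real \<Rightarrow> 'v \<Rightarrow> real" +
  assumes measurable_Y: "0 \<le> t \<Longrightarrow> Y t \<in> borel_measurable N"
    and start_Y: "AE \<omega> in N. Y 0 \<omega> = 0"
    and stationary_increments: "0 \<le> s \<Longrightarrow> 0 \<le> t \<Longrightarrow>
      distr N borel (\<lambda>\<omega>. Y (s + t) \<omega> - Y s \<omega>) = distr N borel (Y t)"
    and independent_increments: "mono \<tau> \<Longrightarrow> 0 \<le> \<tau> 0 \<Longrightarrow>
      indep_vars (\<lambda>_. borel) (\<lambda>i \<omega>. Y (\<tau> (Suc i)) \<omega> - Y (\<tau> i) \<omega>) {..<n::nat}"
    and cadlag: "AE \<omega> in N. (\<forall>t\<ge>0. continuous (at_right t) (\<lambda>s. Y s \<omega>)) \<and>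
      (\<forall>t>0. \<exists>l. ((\<lambda>s. Y s \<omega>) \<longlongrightarrow> l) (at_left t))"

text \<open>\<open>Y\<close> is the process usually denoted \<open>X\<^sup>R\<close>: no negative jumps, and Laplace exponent \<open>R\<close>
  in the convention \<open>E exp(-u Y_t) = exp(-t R(u))\<close>.\<close>

definition levy_process_of ::
    "(real \<Rightarrow> real) \<Rightarrow> 'v measure \<Rightarrow> (real \<Rightarrow> 'v \<Rightarrow> real) \<Rightarrow> bool" where
  "levy_process_of R N Y \<longleftrightarrow> levy_process N Y \<and>
     (AE \<omega> in N. \<forall>t>0. \<forall>l. ((\<lambda>s. Y s \<omega>) \<longlongrightarrow> l) (at_left t) \<longrightarrow> l \<le> Y t \<omega>) \<and>
     (\<forall>t\<ge>0. \<forall>u\<ge>0. has_bochner_integral N (\<lambda>\<omega>. exp (- u * Y t \<omega>)) (exp (- t * R u)))"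

definition bounded_variation_on :: "real \<Rightarrow> real \<Rightarrow> (real \<Rightarrow> real) \<Rightarrow> bool" where
  "bounded_variation_on a c f \<longleftrightarrow> (\<exists>K. \<forall>n. \<forall>\<tau>::nat \<Rightarrow> real.
     mono \<tau> \<and> range \<tau> \<subseteq> {a..c} \<longrightarrow> (\<Sum>i<n. \<bar>f (\<tau> (Suc i)) - f (\<tau> i)\<bar>) \<le> K)"

text \<open>For a Levy process either almost all paths have bounded variation on every compact time
  interval, or almost all paths have infinite variation on every nontrivial one.\<close>

definition infinite_variation_paths :: "'v measure \<Rightarrow> (real \<Rightarrow> 'v \<Rightarrow> real) \<Rightarrow> bool" where
  "infinite_variation_paths N Y \<longleftrightarrow>
     (AE \<omega> in N. \<forall>T>0. \<not> bounded_variation_on 0 T (\<lambda>t. Y t \<omega>))"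

end

theory Submission
  imports Defs "HOL-Real_Asymp.Real_Asymp"
begin

text \<open>Stationarity of \<open>L\<close> under the semigroup, differentiated at time \<open>0\<close>, is the generator equation
  \<open>- R u * E (X exp (- u X)) = F u * E (exp (- u X))\<close> for \<open>X\<close> with law \<open>L\<close>. Since \<open>F > 0\<close> off the origin unless
  \<open>X\<close> is degenerate of the second kind, it forces \<open>R < 0\<close>, and it says that the mean of \<open>L\<close> tilted
  by \<open>exp (- u x)\<close> is \<open>F u / - R u\<close>. As \<open>u \<rightarrow> \<infinity>\<close> the tilted mean converges to the left end point of
  the support, while \<open>F u / u \<rightarrow> b\<close> and \<open>- R u / u \<rightarrow> \<lambda>\<^sub>0\<close>; hence this end point is \<open>b / \<lambda>\<^sub>0\<close>.

  Divided by \<open>u\<^sup>2\<close> the equation becomes an identity \<open>\<alpha> x L(dx) + g(x) dx = k(x) dx\<close> of positive measures,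
  where \<open>g\<close> is a convolution of \<open>x L(dx)\<close> with the decreasing integrated double tail of \<open>\<mu>\<close> and \<open>k\<close> is a
  convolution of \<open>L\<close> with the increasing integrated tail of \<open>m\<close>. On a gap of the support \<open>g = k\<close>, but
  there \<open>g\<close> decreases, \<open>k\<close> increases, and one of them does so strictly next to a jump of size below
  the gap; so the support has no gaps.

  The variation of a Levy path is finite exactly if \<open>\<lambda>\<^sub>0 < \<infinity>\<close>: if so, \<open>Y t + \<lambda>\<^sub>0 t\<close> is nondecreasing;
  if not, \<open>E (1 - exp (- \<bar>Y t\<bar>)) / t\<close> is unbounded as \<open>t \<rightarrow> 0\<close>, since a bound would make
  \<open>- R u / u\<close> bounded.\<close>

section \<open>Laplace transforms of measures on the half-line\<close>

text \<open>Division by \<open>u\<^sup>2\<close> is what turns the generator equation into one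
  between measures: \<open>(exp (- u * \<xi>) - 1 + u * \<xi>) / u\<^sup>2\<close> and
  \<open>(1 - exp (- u * \<xi>)) / u\<^sup>2\<close> are the transforms, in z > 0, of the positive
  part of \<xi> - z and of \<open>min \<xi> z\<close>, one falling and one rising in z. For
  \<open>R\<close> this needs compensation of all jumps, not only of those up to 1; the large jumps
  have a finite mean because R < 0. Strictness on a gap meets two obstacles. If the gap starts at 0,
  the weight x in x L(dx) makes g vanish there, and k must be shown positive instead. If there are
  no jumps at all, neither side is strict, and the Gamma limits get a kernel of their own. In time
  only right derivatives are at hand, since \<open>F\<close> and \<open>R\<close> are derivatives at
  time 0 that the semiflow carries to later times. For infinite variation the difficulty is exp(- u
  Y) at very negative Y, which 1 - exp(- \<bar>Y\<bar>) does not control; a second exponent v,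
  growing like \<open>1 / sqrt t\<close>, takes over there.\<close>

lemma integrable_continuous_AE_unit:
  fixes f :: "real \<Rightarrow> real"
  assumes "finite_measure M" "sets M = sets borel" "AE x in M. x \<in> {0..1}" "continuous_on UNIV f"
  shows "integrable M f"
proof -
  interpret finite_measure M by fact
  have "bounded (f ` {0..1})"
    by (intro compact_imp_bounded compact_continuous_image continuous_on_subset[OF assms(4)]) auto
  then obtain B where B: "\<And>x. x \<in> {0..1} \<Longrightarrow> norm (f x) \<le> B"
    unfolding bounded_iff by blast
  have "f \<in> borel_measurable borel"
    using assms(4) by (rule borel_measurable_continuous_onI)
  then have "f \<in> borel_measurable M"
    using assms(2) measurable_cong_sets by blast
  then show ?thesis
    using assms(3) B by (intro integrable_const_bound[where B=B]) auto
qed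

lemma integral_diff_bound_unit:
  fixes f g :: "real \<Rightarrow> real"
  assumes "finite_measure M" "sets M = sets borel" "AE x in M. x \<in> {0..1}"
    and "continuous_on UNIV f" "continuous_on UNIV g" and "\<And>x. x \<in> {0..1} \<Longrightarrow> \<bar>f x - g x\<bar> \<le> e"
  shows "\<bar>integral\<^sup>L M f - integral\<^sup>L M g\<bar> \<le> e * measure M (space M)"
proof -
  interpret finite_measure M by fact
  note int = integrable_continuous_AE_unit[OF assms(1-3)]
  have "\<bar>integral\<^sup>L M f - integral\<^sup>L M g\<bar> = \<bar>\<integral>x. f x - g x \<partial>M\<bar>"
    using int assms(4,5) by simp
  also have "\<dots> \<le> (\<integral>x. \<bar>f x - g x\<bar> \<partial>M)"
    by (rule integral_abs_bound)
  also have "\<dots> \<le> (\<integral>x. e \<partial>M)"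
  proof (rule integral_mono_AE)
    show "integrable M (\<lambda>x. \<bar>f x - g x\<bar>)"
      by (intro integrable_abs Bochner_Integration.integrable_diff int assms)
    show "AE x in M. \<bar>f x - g x\<bar> \<le> e"
      using assms(3) by eventually_elim (use assms(6) in auto)
  qed simp
  finally show ?thesis by (simp add: mult.commute)
qed

text \<open>Weierstrass approximation extends the equality of integrals from polynomials to
  continuous functions; ramps rising from 0 to 1 just right of \<open>a\<close> then converge to the
  indicator of \<open>{a<..}\<close>, and these half-lines determine a finite measure.\<close>

lemma moments_determine_measure:
  fixes M N :: "real measure"
  assumes M: "finite_measure M" "sets M = sets borel" "AE x in M. x \<in> {0..1}"
    and N: "finite_measure N" "sets N = sets borel" "AE x in N. x \<in> {0..1}"
    and moments: "\<And>n. (\<integral>x. x ^ n \<partial>M) = (\<integral>x. x ^ n \<partial>N)"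
  shows "M = N"
proof -
  interpret M: finite_measure M by fact
  interpret N: finite_measure N by fact
  have poly: "integral\<^sup>L M g = integral\<^sup>L N g" if "real_polynomial_function g" for g :: "real \<Rightarrow> real"
  proof -
    obtain a n where g: "g = (\<lambda>x. \<Sum>i\<le>n. a i * x ^ i)"
      using \<open>real_polynomial_function g\<close> unfolding real_polynomial_function_iff_sum by blast
    have int: "integrable M (\<lambda>x. a i * x ^ i)" "integrable N (\<lambda>x. a i * x ^ i)" for i
      by (auto intro!: integrable_continuous_AE_unit M N continuous_intros)
    then show ?thesis
      unfolding g by (simp add: Bochner_Integration.integral_sum moments)
  qed
  have cont: "integral\<^sup>L M f = integral\<^sup>L N f" if f: "continuous_on UNIV f" for f :: "real \<Rightarrow> real"
  proof (rule ccontr)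
    \<comment> \<open>The summand 1 keeps \<open>C\<close> positive and makes the final estimate
      strict.\<close>
    define C where "C = measure M (space M) + measure N (space N) + 1"
    assume "integral\<^sup>L M f \<noteq> integral\<^sup>L N f"
    then have d: "\<bar>integral\<^sup>L M f - integral\<^sup>L N f\<bar> > 0" by simp
    have C: "C > 0" unfolding C_def by (simp add: add_nonneg_pos)
    define e where "e = \<bar>integral\<^sup>L M f - integral\<^sup>L N f\<bar> / C"
    have e: "e > 0" using d C by (simp add: e_def)
    obtain g where g: "real_polynomial_function g" "\<And>x. x \<in> {0..1} \<Longrightarrow> \<bar>f x - g x\<bar> < e"
      using Stone_Weierstrass_real_polynomial_function[OF compact_Icc continuous_on_subset[OF f subset_UNIV] e]
      by metis
    have "continuous_on UNIV g"
      using g(1) by (simp add: continuous_on_polymonial_function real_polynomial_function_eq)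
    then have "\<bar>integral\<^sup>L M f - integral\<^sup>L M g\<bar> \<le> e * measure M (space M)"
      "\<bar>integral\<^sup>L N f - integral\<^sup>L N g\<bar> \<le> e * measure N (space N)"
      by (auto intro!: integral_diff_bound_unit M N f less_imp_le[OF g(2)])
    then have "\<bar>integral\<^sup>L M f - integral\<^sup>L N f\<bar> \<le> e * measure M (space M) + e * measure N (space N)"
      using poly[OF g(1)] by linarith
    also have "\<dots> < e * C" using e by (simp add: C_def algebra_simps)
    also have "\<dots> = \<bar>integral\<^sup>L M f - integral\<^sup>L N f\<bar>" using C by (simp add: e_def)
    finally show False by simp
  qed
  show ?thesis
  proof (rule measure_eqI_lessThan)
    fix a :: real
    show "emeasure M {a<..} < \<infinity>" by (simp add: M.emeasure_finite less_top[symmetric])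
    define f where "f n x = min 1 (max 0 (real n * (x - a)))" for n x
    have lim: "(\<lambda>n. f n x) \<longlonglongrightarrow> indicator {a<..} x" for x
    proof (cases "a < x")
      case True
      obtain k where k: "1 < real k * (x - a)"
        using True reals_Archimedean3[of "x - a"] by auto
      have "eventually (\<lambda>n. f n x = 1) sequentially"
        using eventually_ge_at_top[of k]
      proof eventually_elim
        case (elim n)
        then have "real k * (x - a) \<le> real n * (x - a)" using True by (intro mult_right_mono) auto
        then show ?case using k by (simp add: f_def)
      qed
      then show ?thesis using True by (simp add: tendsto_eventually)
    next
      case False
      then have "f n x = 0" for n by (simp add: f_def mult_nonneg_nonpos)
      then show ?thesis using False by simp
    qed
    have fcont: "continuous_on UNIV (f n)" for n
      unfolding f_def by (intro continuous_intros)
    have fm: "f n \<in> borel_measurable borel" for n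
      using fcont by (rule borel_measurable_continuous_onI)
    have lim_int: "(\<lambda>n. integral\<^sup>L Q (f n)) \<longlonglongrightarrow> measure Q {a<..}"
      if Q: "finite_measure Q" "sets Q = sets borel" for Q
    proof -
      interpret Q: finite_measure Q by fact
      have "(\<lambda>n. integral\<^sup>L Q (f n)) \<longlonglongrightarrow> integral\<^sup>L Q (indicator {a<..})"
      proof (rule integral_dominated_convergence[where w="\<lambda>_. 1"])
        show "f n \<in> borel_measurable Q" for n
          using fm Q(2) measurable_cong_sets by blast
        show "(indicator {a<..} :: real \<Rightarrow> real) \<in> borel_measurable Q"
          by (auto simp: measurable_cong_sets[OF Q(2) refl])
        show "AE x in Q. (\<lambda>n. f n x) \<longlonglongrightarrow> indicator {a<..} x"
          using lim by simp
        show "AE x in Q. norm (f n x) \<le> 1" for n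
          by (simp add: f_def)
      qed simp
      then show ?thesis by (simp add: Q(2))
    qed
    have "measure M {a<..} = measure N {a<..}"
      using lim_int[OF M(1,2)] lim_int[OF N(1,2)] cont[OF fcont] LIMSEQ_unique by auto
    then show "emeasure M {a<..} = emeasure N {a<..}"
      by (simp add: M.emeasure_eq_measure N.emeasure_eq_measure)
  qed (use M N in auto)
qed

text \<open>The substitution \<open>y = exp (- x)\<close> turns values of the Laplace transform at positive integers
  into moments on \<open>[0, 1]\<close>.\<close>

lemma laplace_transform_unique:
  fixes M N :: "real measure"
  assumes [measurable_cong]: "sets M = sets borel" "sets N = sets borel"
    and supp: "emeasure M {..<0} = 0" "emeasure N {..<0} = 0"
    and finite: "\<And>u. 0 < u \<Longrightarrow> (\<integral>\<^sup>+x. exp (- u * x) \<partial>M) < \<infinity>"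
    and eq: "\<And>u. 0 < u \<Longrightarrow> (\<integral>\<^sup>+x. exp (- u * x) \<partial>M) = (\<integral>\<^sup>+x. exp (- u * x) \<partial>N)"
  shows "M = N"
proof -
  \<comment> \<open>The tilt by \<open>exp (- x)\<close> makes the image finite even if
    \<open>Q\<close> is not. It also shifts the index: moment n of \<open>T Q\<close> is the
    transform of \<open>Q\<close> at n + 1.\<close>
  define T where "T Q = distr (density Q (\<lambda>x. ennreal (exp (- x)))) borel (\<lambda>x. exp (- x))"
    for Q :: "real measure"
  have T: "finite_measure (T Q) \<and> sets (T Q) = sets borel \<and> (AE x in T Q. x \<in> {0..1}) \<and>
      (\<forall>n. (\<integral>x. x ^ n \<partial>T Q) = enn2real (\<integral>\<^sup>+x. exp (- (real n + 1) * x) \<partial>Q)) \<and>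
      density (distr (T Q) borel (\<lambda>y. - ln y)) (\<lambda>x. ennreal (exp x)) = Q"
    if [measurable_cong]: "sets Q = sets borel" and Q0: "emeasure Q {..<0} = 0"
      and fin: "\<And>u. 0 < u \<Longrightarrow> (\<integral>\<^sup>+x. exp (- u * x) \<partial>Q) < \<infinity>" for Q
  proof (intro conjI allI)
    have nn: "AE x in Q. 0 \<le> x"
      by (rule AE_I[of _ _ "{..<0}"]) (use Q0 in \<open>auto simp: that(1)\<close>)
    have "emeasure (T Q) (space (T Q)) = (\<integral>\<^sup>+x. exp (- 1 * x) \<partial>Q)"
      unfolding T_def
      by (simp add: emeasure_distr emeasure_density sets_eq_imp_space_eq[OF that(1)])
    then show "finite_measure (T Q)"
      using fin[of 1] by (intro finite_measureI) auto
    show "sets (T Q) = sets borel" by (simp add: T_def)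
    have "AE x in density Q (\<lambda>x. ennreal (exp (- x))). exp (- x) \<in> {0..1}"
      by (subst AE_density) (use nn in auto)
    then show "AE x in T Q. x \<in> {0..1}"
      unfolding T_def by (subst AE_distr_iff) auto
    show "(\<integral>x. x ^ n \<partial>T Q) = enn2real (\<integral>\<^sup>+x. exp (- (real n + 1) * x) \<partial>Q)" for n
    proof -
      have "(\<integral>x. x ^ n \<partial>T Q) = (\<integral>x. exp (- x) ^ n \<partial>density Q (\<lambda>x. ennreal (exp (- x))))"
        unfolding T_def by (subst integral_distr) auto
      also have "\<dots> = (\<integral>x. exp (- x) * exp (- x) ^ n \<partial>Q)"
        by (subst integral_real_density) auto
      also have "\<dots> = (\<integral>x. exp (- (real n + 1) * x) \<partial>Q)"
        by (intro Bochner_Integration.integral_cong)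
           (auto simp: exp_of_nat_mult[symmetric] exp_add[symmetric] algebra_simps)
      also have "\<dots> = enn2real (\<integral>\<^sup>+x. exp (- (real n + 1) * x) \<partial>Q)"
        by (rule integral_eq_nn_integral) auto
      finally show ?thesis .
    qed
    \<comment> \<open>Undoing the substitution and then the tilt recovers \<open>Q\<close>, so
      \<open>T\<close> is injective on these measures.\<close>
    have "distr (T Q) borel (\<lambda>y. - ln y) = distr (density Q (\<lambda>x. ennreal (exp (- x)))) borel (\<lambda>x. x)"
      unfolding T_def by (subst distr_distr) (auto simp: comp_def)
    also have "\<dots> = density Q (\<lambda>x. ennreal (exp (- x)))"
      by (rule distr_id2) (simp add: that(1))
    finally show "density (distr (T Q) borel (\<lambda>y. - ln y)) (\<lambda>x. ennreal (exp x)) = Q"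
      by (simp add: density_density_eq ennreal_mult[symmetric] exp_add[symmetric] density_1)
  qed
  have finN: "0 < u \<Longrightarrow> (\<integral>\<^sup>+x. exp (- u * x) \<partial>N) < \<infinity>" for u
    using finite eq by simp
  have TM: "finite_measure (T M)" "sets (T M) = sets borel" "AE x in T M. x \<in> {0..1}"
    "\<And>n. (\<integral>x. x ^ n \<partial>T M) = enn2real (\<integral>\<^sup>+x. exp (- (real n + 1) * x) \<partial>M)"
    "density (distr (T M) borel (\<lambda>y. - ln y)) (\<lambda>x. ennreal (exp x)) = M"
    using T[OF assms(1) supp(1) finite] by blast+
  have TN: "finite_measure (T N)" "sets (T N) = sets borel" "AE x in T N. x \<in> {0..1}"
    "\<And>n. (\<integral>x. x ^ n \<partial>T N) = enn2real (\<integral>\<^sup>+x. exp (- (real n + 1) * x) \<partial>N)"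
    "density (distr (T N) borel (\<lambda>y. - ln y)) (\<lambda>x. ennreal (exp x)) = N"
    using T[OF assms(2) supp(2) finN] by blast+
  have "T M = T N"
  proof (rule moments_determine_measure[OF TM(1-3) TN(1-3)])
    show "(\<integral>x. x ^ n \<partial>T M) = (\<integral>x. x ^ n \<partial>T N)" for n
      using eq[of "real n + 1"] by (subst TM(4), subst TN(4)) (simp add: add_pos_nonneg)
  qed
  then have "density (distr (T M) borel (\<lambda>y. - ln y)) (\<lambda>x. ennreal (exp x)) =
      density (distr (T N) borel (\<lambda>y. - ln y)) (\<lambda>x. ennreal (exp x))"
    by (rule arg_cong)
  then show "M = N" unfolding TM(5) TN(5) .
qed

section \<open>Convolutions and explicit transforms\<close>

text \<open>Tonelli and the translation x = y + z. The weight \<open>c\<close> lets one statement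
  serve both \<open>L\<close> and the measure y L(dy).\<close>

lemma laplace_transform_convolution:
  fixes L :: "real measure" and c v :: "real \<Rightarrow> ennreal"
  assumes [measurable_cong]: "sets L = sets borel" and "sigma_finite_measure L"
    and [measurable]: "c \<in> borel_measurable borel" "v \<in> borel_measurable borel"
  shows "(\<integral>\<^sup>+x. (\<integral>\<^sup>+y. c y * v (x - y) \<partial>L) * exp (- u * x) \<partial>lborel) =
    (\<integral>\<^sup>+y. c y * exp (- u * y) \<partial>L) * (\<integral>\<^sup>+z. v z * exp (- u * z) \<partial>lborel)"
proof -
  interpret L: sigma_finite_measure L by fact
  interpret pair_sigma_finite L lborel ..
  have "(\<integral>\<^sup>+x. (\<integral>\<^sup>+y. c y * v (x - y) \<partial>L) * exp (- u * x) \<partial>lborel) =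
      (\<integral>\<^sup>+x. (\<integral>\<^sup>+y. c y * v (x - y) * exp (- u * x) \<partial>L) \<partial>lborel)"
    by (simp add: nn_integral_multc)
  also have "\<dots> = (\<integral>\<^sup>+y. (\<integral>\<^sup>+x. c y * v (x - y) * exp (- u * x) \<partial>lborel) \<partial>L)"
    by (rule Fubini') measurable
  also have "\<dots> = (\<integral>\<^sup>+y. c y * exp (- u * y) * (\<integral>\<^sup>+z. v z * exp (- u * z) \<partial>lborel) \<partial>L)"
  proof (rule nn_integral_cong)
    fix y
    have "(\<integral>\<^sup>+x. c y * v (x - y) * exp (- u * x) \<partial>lborel) =
        (\<integral>\<^sup>+z. c y * v z * exp (- u * (y + z)) \<partial>lborel)"
      by (subst nn_integral_real_affine[where c=1 and t=y]) auto
    also have "\<dots> = (\<integral>\<^sup>+z. (c y * exp (- u * y)) * (v z * exp (- u * z)) \<partial>lborel)"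
      by (intro nn_integral_cong)
         (simp add: distrib_left exp_add exp_diff exp_minus divide_inverse right_diff_distrib ennreal_mult mult_ac)
    also have "\<dots> = c y * exp (- u * y) * (\<integral>\<^sup>+z. v z * exp (- u * z) \<partial>lborel)"
      by (rule nn_integral_cmult) auto
    finally show "(\<integral>\<^sup>+x. c y * v (x - y) * exp (- u * x) \<partial>lborel) =
      c y * exp (- u * y) * (\<integral>\<^sup>+z. v z * exp (- u * z) \<partial>lborel)" .
  qed
  also have "\<dots> = (\<integral>\<^sup>+y. c y * exp (- u * y) \<partial>L) * (\<integral>\<^sup>+z. v z * exp (- u * z) \<partial>lborel)"
    by (rule nn_integral_multc) auto
  finally show ?thesis .
qed

lemma laplace_transform_exponential:
  fixes u :: real
  assumes "0 < u"
  shows "(\<integral>\<^sup>+z. indicator {0<..} z * ennreal (exp (- u * z)) \<partial>lborel) = ennreal (1 / u)"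
proof -
  have "(\<integral>\<^sup>+z. indicator {0<..} z * ennreal (exp (- u * z)) \<partial>lborel) =
      (\<integral>\<^sup>+z. ennreal (exp (- u * z)) * indicator {0..} z \<partial>lborel)"
    by (rule nn_integral_cong_AE, use AE_lborel_singleton[of 0] in eventually_elim)
       (auto split: split_indicator)
  also have "\<dots> = ennreal (0 - (- exp (- u * 0) / u))"
  proof (rule nn_integral_FTC_atLeast)
    show "((\<lambda>x. - exp (- u * x) / u) \<longlongrightarrow> 0) at_top" using assms by real_asymp
  qed (use assms in \<open>auto intro!: derivative_eq_intros\<close>)
  finally show ?thesis by simp
qed

text \<open>\<open>ennreal\<close> sends negative numbers to 0, so
  \<open>ennreal (\<xi> - z)\<close> is a positive part. The right-hand side is the fully
  compensated integrand of \<open>- R\<close>, divided by \<open>u\<^sup>2\<close>.\<close>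

lemma laplace_transform_pos_part:
  fixes u \<xi> :: real
  assumes "0 < u" "0 \<le> \<xi>"
  shows "(\<integral>\<^sup>+z. ennreal (\<xi> - z) * indicator {0<..} z * ennreal (exp (- u * z)) \<partial>lborel) =
    ennreal ((exp (- u * \<xi>) - 1 + u * \<xi>) / u\<^sup>2)"
proof -
  have "(\<integral>\<^sup>+z. ennreal (\<xi> - z) * indicator {0<..} z * ennreal (exp (- u * z)) \<partial>lborel) =
      (\<integral>\<^sup>+z. ennreal ((\<xi> - z) * exp (- u * z)) * indicator {0..\<xi>} z \<partial>lborel)"
    by (rule nn_integral_cong_AE, use AE_lborel_singleton[of 0] in eventually_elim)
       (auto split: split_indicator simp: ennreal_mult' ennreal_neg)
  also have "\<dots> = ennreal ((\<lambda>z. (1 / u\<^sup>2 - (\<xi> - z) / u) * exp (- u * z)) \<xi> -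
      (\<lambda>z. (1 / u\<^sup>2 - (\<xi> - z) / u) * exp (- u * z)) 0)"
  proof (rule nn_integral_FTC_Icc)
    fix x :: real
    show "((\<lambda>z. (1 / u\<^sup>2 - (\<xi> - z) / u) * exp (- u * z)) has_real_derivative (\<xi> - x) * exp (- u * x)) (at x)"
      using assms by (auto intro!: derivative_eq_intros simp: field_simps power2_eq_square)
  qed (use assms in auto)
  also have "\<dots> = ennreal ((exp (- u * \<xi>) - 1 + u * \<xi>) / u\<^sup>2)"
    using assms by (intro arg_cong[where f=ennreal]) (simp add: field_simps power2_eq_square)
  finally show ?thesis .
qed

text \<open>\<open>min \<xi> z\<close> is the integral over (0, z) of the tail of a unit mass at
  \<xi>. The tail has transform \<open>(1 - exp (- u * \<xi>)) / u\<close>, and integration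
  contributes another factor 1 / u.\<close>

lemma laplace_transform_min:
  fixes u \<xi> :: real
  assumes "0 < u" "0 \<le> \<xi>"
  shows "(\<integral>\<^sup>+z. ennreal (min \<xi> z) * indicator {0<..} z * ennreal (exp (- u * z)) \<partial>lborel) =
    ennreal ((1 - exp (- u * \<xi>)) / u\<^sup>2)"
proof -
  have "(\<integral>\<^sup>+z. ennreal (min \<xi> z) * indicator {0<..} z * ennreal (exp (- u * z)) \<partial>lborel) =
      (\<integral>\<^sup>+z. ennreal (z * exp (- u * z)) * indicator {0..\<xi>} z +
        ennreal (\<xi> * exp (- u * z)) * indicator {\<xi>..} z \<partial>lborel)"
    by (rule nn_integral_cong_AE,
        use AE_lborel_singleton[of 0] AE_lborel_singleton[of \<xi>] in eventually_elim)
       (use assms(2) in \<open>auto split: split_indicator simp: ennreal_mult' min_def\<close>)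
  also have "\<dots> = (\<integral>\<^sup>+z. ennreal (z * exp (- u * z)) * indicator {0..\<xi>} z \<partial>lborel) +
      (\<integral>\<^sup>+z. ennreal (\<xi> * exp (- u * z)) * indicator {\<xi>..} z \<partial>lborel)"
    by (rule nn_integral_add) auto
  also have "(\<integral>\<^sup>+z. ennreal (z * exp (- u * z)) * indicator {0..\<xi>} z \<partial>lborel) =
      ennreal ((\<lambda>z. - (z / u + 1 / u\<^sup>2) * exp (- u * z)) \<xi> - (\<lambda>z. - (z / u + 1 / u\<^sup>2) * exp (- u * z)) 0)"
  proof (rule nn_integral_FTC_Icc)
    fix x :: real
    show "((\<lambda>z. - (z / u + 1 / u\<^sup>2) * exp (- u * z)) has_real_derivative x * exp (- u * x)) (at x)"
      using assms by (auto intro!: derivative_eq_intros simp: field_simps power2_eq_square)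
  qed (use assms in auto)
  also have "(\<integral>\<^sup>+z. ennreal (\<xi> * exp (- u * z)) * indicator {\<xi>..} z \<partial>lborel) =
      ennreal (0 - (- (\<xi> / u) * exp (- u * \<xi>)))"
  proof (rule nn_integral_FTC_atLeast[where F="\<lambda>x. - (\<xi> / u) * exp (- u * x)"])
    show "((\<lambda>x. - (\<xi> / u) * exp (- u * x)) \<longlongrightarrow> 0) at_top" using assms by real_asymp
  qed (use assms in \<open>auto intro!: derivative_eq_intros\<close>)
  also have "ennreal (- (\<xi> / u + 1 / u\<^sup>2) * exp (- u * \<xi>) - - (0 / u + 1 / u\<^sup>2) * exp (- u * 0)) +
      ennreal (0 - - (\<xi> / u) * exp (- u * \<xi>)) = ennreal ((1 - exp (- u * \<xi>)) / u\<^sup>2)"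
  proof -
    \<comment> \<open>Merging the two \<open>ennreal\<close> terms requires each to be nonnegative;
      for the first this is 1 + w \<le> exp w at w = u \<xi>.\<close>
    have "(1 + u * \<xi>) * exp (- u * \<xi>) \<le> exp (u * \<xi>) * exp (- u * \<xi>)"
      by (intro mult_right_mono exp_ge_add_one_self) auto
    then have "0 \<le> (1 - (1 + u * \<xi>) * exp (- u * \<xi>)) / u\<^sup>2"
      by (intro divide_nonneg_nonneg) (auto simp: exp_add[symmetric])
    moreover have "- (\<xi> / u + 1 / u\<^sup>2) * exp (- u * \<xi>) - - (0 / u + 1 / u\<^sup>2) * exp (- u * 0) =
        (1 - (1 + u * \<xi>) * exp (- u * \<xi>)) / u\<^sup>2"
      using assms by (simp add: field_simps power2_eq_square)
    moreover have "0 \<le> 0 - - (\<xi> / u) * exp (- u * \<xi>)"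
      using assms by simp
    moreover have "(1 - (1 + u * \<xi>) * exp (- u * \<xi>)) / u\<^sup>2 + (0 - - (\<xi> / u) * exp (- u * \<xi>)) =
        (1 - exp (- u * \<xi>)) / u\<^sup>2"
      using assms by (simp add: field_simps power2_eq_square)
    ultimately show ?thesis by (metis ennreal_plus)
  qed
  finally show ?thesis .
qed

section \<open>Jump measures and Laplace exponents\<close>

lemma one_minus_exp_le_min:
  fixes u \<xi> :: real
  assumes "0 \<le> u" "0 \<le> \<xi>"
  shows "1 - exp (- u * \<xi>) \<le> max 1 u * min \<xi> 1"
proof (cases "\<xi> \<le> 1")
  case True
  have "1 - exp (- u * \<xi>) \<le> u * \<xi>" using exp_ge_add_one_self[of "- u * \<xi>"] by simp
  also have "\<dots> \<le> max 1 u * \<xi>" using assms by (intro mult_right_mono) auto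
  finally show ?thesis using True by simp
next
  case False
  have "1 - exp (- u * \<xi>) \<le> 1" by simp
  also have "\<dots> \<le> max 1 u" by simp
  finally show ?thesis using False by (simp add: min_def)
qed

lemma exp_minus_taylor2:
  fixes x :: real
  assumes "0 \<le> x"
  shows "0 \<le> exp (- x) - 1 + x" "exp (- x) - 1 + x \<le> x\<^sup>2 / 2"
proof -
  show "0 \<le> exp (- x) - 1 + x" using exp_ge_add_one_self[of "- x"] by simp
  have "(\<lambda>x. x\<^sup>2 / 2 - (exp (- x) - 1 + x)) 0 \<le> (\<lambda>x. x\<^sup>2 / 2 - (exp (- x) - 1 + x)) x"
  proof (rule DERIV_nonneg_imp_nondecreasing[OF assms])
    fix y :: real
    have "((\<lambda>x. x\<^sup>2 / 2 - (exp (- x) - 1 + x)) has_real_derivative y + exp (- y) - 1) (at y)"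
      by (auto intro!: derivative_eq_intros)
    moreover have "0 \<le> y + exp (- y) - 1" using exp_ge_add_one_self[of "- y"] by simp
    ultimately show "\<exists>z. ((\<lambda>x. x\<^sup>2 / 2 - (exp (- x) - 1 + x)) has_real_derivative z) (at y) \<and> 0 \<le> z"
      by blast
  qed
  then show "exp (- x) - 1 + x \<le> x\<^sup>2 / 2" by simp
qed

text \<open>The exponent \<open>p\<close> is 1 for the jumps of the immigration and 2 for those of
  the branching, so that both share the results below.\<close>

locale positive_jump_measure =
  fixes \<nu> :: "real measure" and p :: nat
  assumes sets_nu [measurable_cong]: "sets \<nu> = sets borel"
    and nonpos_null: "emeasure \<nu> {..0} = 0"
    and jump_integral_finite: "(\<integral>\<^sup>+\<xi>\<in>{0<..}. ennreal (min (\<xi> ^ p) 1) \<partial>\<nu>) < \<infinity>"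
begin

lemma AE_pos: "AE \<xi> in \<nu>. 0 < \<xi>"
  by (rule AE_I[of _ _ "{..0}"]) (use nonpos_null in \<open>auto simp: sets_nu\<close>)

lemma integrable_min: "integrable \<nu> (\<lambda>\<xi>. min (\<xi> ^ p) 1)"
proof (rule integrableI_nonneg)
  show "AE \<xi> in \<nu>. 0 \<le> min (\<xi> ^ p) 1" using AE_pos by eventually_elim auto
  have "(\<integral>\<^sup>+\<xi>. ennreal (min (\<xi> ^ p) 1) \<partial>\<nu>) = (\<integral>\<^sup>+\<xi>\<in>{0<..}. ennreal (min (\<xi> ^ p) 1) \<partial>\<nu>)"
    by (rule nn_integral_cong_AE) (use AE_pos in eventually_elim, auto)
  then show "(\<integral>\<^sup>+\<xi>. ennreal (min (\<xi> ^ p) 1) \<partial>\<nu>) < \<infinity>" using jump_integral_finite by simp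
qed measurable

text \<open>Prepares the use of Tonelli. By Markov's inequality the sets where
  \<open>min (\<xi> ^ p) 1\<close> is at least 1 / (n + 1) have finite measure; the null set
  \<open>{..0}\<close> completes the cover.\<close>

sublocale sigma_finite_measure \<nu>
proof
  define A where "A n = {\<xi>::real. 0 < \<xi> \<and> 1 / real (Suc n) \<le> min (\<xi> ^ p) 1}" for n
  have A[measurable]: "A n \<in> sets \<nu>" for n
    unfolding A_def by measurable
  have fin: "emeasure \<nu> (A n) \<noteq> \<infinity>" for n
  proof -
    have "emeasure \<nu> {\<xi> \<in> A n. 1 \<le> ennreal (real (Suc n)) * ennreal (min (\<xi> ^ p) 1)} \<le>
        ennreal (real (Suc n)) * (\<integral>\<^sup>+\<xi>\<in>A n. ennreal (min (\<xi> ^ p) 1) \<partial>\<nu>)"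
      using nn_integral_Markov_inequality[of "\<lambda>\<xi>. ennreal (min (\<xi> ^ p) 1)" "A n" \<nu> "ennreal (real (Suc n))"]
      by (simp add: conj_commute)
    also have "\<dots> \<le> ennreal (real (Suc n)) * (\<integral>\<^sup>+\<xi>\<in>{0<..}. ennreal (min (\<xi> ^ p) 1) \<partial>\<nu>)"
      by (intro mult_left_mono nn_integral_mono) (auto simp: A_def split: split_indicator)
    also have "\<dots> < \<infinity>" using jump_integral_finite by (simp add: ennreal_mult_less_top)
    also have "{\<xi> \<in> A n. 1 \<le> ennreal (real (Suc n)) * ennreal (min (\<xi> ^ p) 1)} = A n"
    proof -
      have "1 \<le> ennreal (real (Suc n)) * ennreal (min (\<xi> ^ p) 1)" if "\<xi> \<in> A n" for \<xi>
      proof -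
        have "1 \<le> real (Suc n) * min (\<xi> ^ p) 1" using that by (auto simp: A_def field_simps)
        then show ?thesis
          by (subst ennreal_mult[symmetric]) (use that in \<open>auto simp: A_def simp del: of_nat_Suc\<close>)
      qed
      then show ?thesis by blast
    qed
    finally show ?thesis by simp
  qed
  have cover: "(\<Union>n. A n) = {0<..}"
  proof -
    have "\<exists>n. \<xi> \<in> A n" if "0 < \<xi>" for \<xi>
    proof -
      have "0 < min (\<xi> ^ p) 1" using that by simp
      then obtain n where "1 / real (Suc n) < min (\<xi> ^ p) 1" by (rule nat_approx_posE)
      then show ?thesis using that by (auto simp: A_def intro!: exI[of _ n])
    qed
    then show ?thesis by (auto simp: A_def)
  qed
  show "\<exists>B. countable B \<and> B \<subseteq> sets \<nu> \<and> \<Union>B = space \<nu> \<and> (\<forall>a\<in>B. emeasure \<nu> a \<noteq> \<infinity>)"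
  proof (intro exI[of _ "insert {..0} (range A)"] conjI)
    show "\<Union> (insert {..0} (range A)) = space \<nu>"
      using cover sets_eq_imp_space_eq[OF sets_nu] by auto
  qed (use A fin nonpos_null in auto)
qed

lemma set_integral_pos:
  fixes g :: "real \<Rightarrow> real"
  assumes [measurable]: "g \<in> borel_measurable borel"
  shows "(LINT \<xi>:{0<..}|\<nu>. g \<xi>) = (\<integral>\<xi>. g \<xi> \<partial>\<nu>)"
  unfolding set_lebesgue_integral_def
  by (rule integral_cong_AE) (use AE_pos in \<open>auto elim!: eventually_mono\<close>)

lemma null_iff: "emeasure \<nu> {0<..} = 0 \<longleftrightarrow> \<nu> = null_measure borel"
proof
  assume *: "emeasure \<nu> {0<..} = 0"
  show "\<nu> = null_measure borel"
  proof (rule measure_eqI)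
    fix A assume "A \<in> sets \<nu>"
    then have "emeasure \<nu> A \<le> emeasure \<nu> ({..0} \<union> {0<..})"
      by (intro emeasure_mono) (auto simp: sets_nu)
    also have "\<dots> \<le> emeasure \<nu> {..0} + emeasure \<nu> {0<..}"
      by (rule emeasure_subadditive) (auto simp: sets_nu)
    finally show "emeasure \<nu> A = emeasure (null_measure borel) A" using * nonpos_null by simp
  qed (simp add: sets_nu)
qed simp

text \<open>Yields the jump size up to which the integrated tails are strictly monotone.\<close>

lemma pos_tail_if_nonnull:
  assumes "emeasure \<nu> {0<..} \<noteq> 0"
  obtains \<delta> where "0 < \<delta>" "0 < emeasure \<nu> {\<delta>..}"
proof -
  have "(\<Union>n. {1 / real (Suc n)..}) = {0::real<..}"
  proof (intro equalityI subsetI)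
    fix x :: real assume "x \<in> {0<..}"
    then obtain n where "1 / real (Suc n) < x" using nat_approx_posE by auto
    then show "x \<in> (\<Union>n. {1 / real (Suc n)..})" by (intro UN_I[of n]) auto
  next
    fix x :: real assume "x \<in> (\<Union>n. {1 / real (Suc n)..})"
    then obtain n where "1 / real (Suc n) \<le> x" by auto
    then have "0 < x" by (rule less_le_trans[rotated]) simp
    then show "x \<in> {0<..}" by simp
  qed
  then have "\<exists>n. emeasure \<nu> {1 / real (Suc n)..} \<noteq> 0"
    using assms emeasure_UN_eq_0[of \<nu> "\<lambda>n. {1 / real (Suc n)..}"] by (force simp: sets_nu)
  then obtain n where "emeasure \<nu> {1 / real (Suc n)..} \<noteq> 0" by blast
  then show thesis by (intro that[of "1 / real (Suc n)"]) (auto simp: zero_less_iff_neq_zero)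
qed

end

locale finite_variation_jump_measure = positive_jump_measure \<nu> 1 for \<nu>
begin

lemma integrable_one_minus_exp:
  assumes "0 \<le> u"
  shows "integrable \<nu> (\<lambda>\<xi>. 1 - exp (- u * \<xi>))"
proof (rule Bochner_Integration.integrable_bound)
  show "integrable \<nu> (\<lambda>\<xi>. max 1 u * min (\<xi> ^ 1) 1)"
    by (intro integrable_mult_right integrable_min)
  show "AE \<xi> in \<nu>. norm (1 - exp (- u * \<xi>)) \<le> norm (max 1 u * min (\<xi> ^ 1) 1)"
    using AE_pos
  proof eventually_elim
    case (elim \<xi>)
    then have "exp (- u * \<xi>) \<le> 1" using assms by simp
    then have "norm (1 - exp (- u * \<xi>)) = 1 - exp (- u * \<xi>)" by simp
    also have "\<dots> \<le> max 1 u * min \<xi> 1" using one_minus_exp_le_min[of u \<xi>] assms elim by simp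
    also have "\<dots> = norm (max 1 u * min (\<xi> ^ 1) 1)" using elim by simp
    finally show ?case .
  qed
qed measurable

text \<open>The Laplace exponent of a driftless subordinator with Levy measure \<open>\<nu>\<close>;
  it is used for \<open>m\<close>, and for \<open>\<mu>\<close> when the small jumps are
  summable.\<close>

definition jump_exponent :: "real \<Rightarrow> real" where
  "jump_exponent u = (\<integral>\<xi>. 1 - exp (- u * \<xi>) \<partial>\<nu>)"

lemma jump_exponent_null: "emeasure \<nu> {0<..} = 0 \<Longrightarrow> jump_exponent u = 0"
  unfolding jump_exponent_def by (simp add: null_iff)

lemma jump_exponent_nonneg: "0 \<le> u \<Longrightarrow> 0 \<le> jump_exponent u"
  unfolding jump_exponent_def
  by (rule integral_nonneg_AE) (use AE_pos in \<open>auto elim!: eventually_mono\<close>)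

lemma jump_exponent_pos:
  assumes "0 < u" "emeasure \<nu> {0<..} \<noteq> 0"
  shows "0 < jump_exponent u"
proof -
  have "jump_exponent u \<noteq> 0"
  proof
    assume "jump_exponent u = 0"
    then have "AE \<xi> in \<nu>. 1 - exp (- u * \<xi>) = 0"
      unfolding jump_exponent_def using integrable_one_minus_exp[of u] assms(1) AE_pos
      by (subst (asm) integral_nonneg_eq_0_iff_AE) (auto elim!: eventually_mono)
    with AE_pos have "AE \<xi> in \<nu>. \<not> 0 < \<xi>"
      by eventually_elim (use assms(1) in auto)
    then have "emeasure \<nu> {\<xi>\<in>space \<nu>. \<not> \<not> 0 < \<xi>} = 0"
      by (intro AE_E2) auto
    moreover have "{\<xi>\<in>space \<nu>. \<not> \<not> 0 < \<xi>} = {0<..}"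
      using sets_eq_imp_space_eq[OF sets_nu] by auto
    ultimately show False using assms(2) by simp
  qed
  then show ?thesis using jump_exponent_nonneg[of u] assms(1) by linarith
qed

text \<open>Dominated convergence with majorant \<open>min \<xi> 1\<close> for u \<ge> 1. Hence only
  the drift is visible in the linear growth of the exponents.\<close>

lemma jump_exponent_sublinear: "((\<lambda>u. jump_exponent u / u) \<longlongrightarrow> 0) at_top"
proof -
  have "((\<lambda>u. \<integral>\<xi>. (1 - exp (- u * \<xi>)) / u \<partial>\<nu>) \<longlongrightarrow> (\<integral>\<xi>. 0 \<partial>\<nu>)) at_top"
  proof (rule integral_dominated_convergence_at_top)
    show "integrable \<nu> (\<lambda>\<xi>. min (\<xi> ^ 1) 1)" by (rule integrable_min)
    show "AE \<xi> in \<nu>. ((\<lambda>u. (1 - exp (- u * \<xi>)) / u) \<longlongrightarrow> 0) at_top"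
      using AE_pos by eventually_elim real_asymp
    show "\<forall>\<^sub>F u in at_top. AE \<xi> in \<nu>. norm ((1 - exp (- u * \<xi>)) / u) \<le> min (\<xi> ^ 1) 1"
      using eventually_ge_at_top[of 1]
    proof eventually_elim
      case (elim u)
      from AE_pos show ?case
      proof eventually_elim
        case (elim \<xi>)
        then have "exp (- u * \<xi>) \<le> 1" using \<open>1 \<le> u\<close> by simp
        have "1 - exp (- u * \<xi>) \<le> max 1 u * min \<xi> 1"
          using one_minus_exp_le_min[of u \<xi>] elim \<open>1 \<le> u\<close> by simp
        also have "max 1 u * min \<xi> 1 = min \<xi> 1 * u"
          using \<open>1 \<le> u\<close> by (simp only: max_absorb2 mult.commute)
        finally have "(1 - exp (- u * \<xi>)) / u \<le> min \<xi> 1"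
          using \<open>1 \<le> u\<close> by (subst pos_divide_le_eq) auto
        then show ?case
          using \<open>exp (- u * \<xi>) \<le> 1\<close> \<open>1 \<le> u\<close> by simp
      qed
    qed
  qed measurable
  then show ?thesis unfolding jump_exponent_def by simp
qed

text \<open>\<open>laplace_transform_min\<close> integrated over \<open>\<nu>\<close>, plus the
  constant density \<open>b\<close>, whose transform is b / u. So \<open>F u / u\<^sup>2\<close> is
  the transform of a nondecreasing function.\<close>

lemma laplace_transform_integrated_tail:
  assumes "0 < u" "0 \<le> b"
  shows "(\<integral>\<^sup>+z. (ennreal b + (\<integral>\<^sup>+\<xi>. ennreal (min \<xi> z) \<partial>\<nu>)) * indicator {0<..} z * ennreal (exp (- u * z)) \<partial>lborel) =
    ennreal ((b * u + jump_exponent u) / u\<^sup>2)"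
proof -
  interpret pair_sigma_finite \<nu> lborel ..
  have "(\<integral>\<^sup>+z. (ennreal b + (\<integral>\<^sup>+\<xi>. ennreal (min \<xi> z) \<partial>\<nu>)) * indicator {0<..} z * ennreal (exp (- u * z)) \<partial>lborel) =
    (\<integral>\<^sup>+z. ennreal b * (indicator {0<..} z * ennreal (exp (- u * z))) +
      (\<integral>\<^sup>+\<xi>. ennreal (min \<xi> z) * indicator {0<..} z * ennreal (exp (- u * z)) \<partial>\<nu>) \<partial>lborel)"
    by (intro nn_integral_cong) (simp add: distrib_right nn_integral_multc mult.assoc)
  also have "\<dots> = ennreal b * (\<integral>\<^sup>+z. indicator {0<..} z * ennreal (exp (- u * z)) \<partial>lborel) +
    (\<integral>\<^sup>+z. (\<integral>\<^sup>+\<xi>. ennreal (min \<xi> z) * indicator {0<..} z * ennreal (exp (- u * z)) \<partial>\<nu>) \<partial>lborel)"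
    by (subst nn_integral_add) (auto simp: nn_integral_cmult)
  also have "(\<integral>\<^sup>+z. (\<integral>\<^sup>+\<xi>. ennreal (min \<xi> z) * indicator {0<..} z * ennreal (exp (- u * z)) \<partial>\<nu>) \<partial>lborel) =
    (\<integral>\<^sup>+\<xi>. (\<integral>\<^sup>+z. ennreal (min \<xi> z) * indicator {0<..} z * ennreal (exp (- u * z)) \<partial>lborel) \<partial>\<nu>)"
    by (rule Fubini') measurable
  also have "\<dots> = (\<integral>\<^sup>+\<xi>. ennreal ((1 - exp (- u * \<xi>)) / u\<^sup>2) \<partial>\<nu>)"
    by (rule nn_integral_cong_AE) (use AE_pos in eventually_elim, use assms laplace_transform_min in auto)
  also have "\<dots> = ennreal (\<integral>\<xi>. (1 - exp (- u * \<xi>)) / u\<^sup>2 \<partial>\<nu>)"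
    using assms(1) AE_pos
    by (intro nn_integral_eq_integral integrable_divide_zero integrable_one_minus_exp)
       (auto elim!: eventually_mono)
  also have "(\<integral>\<xi>. (1 - exp (- u * \<xi>)) / u\<^sup>2 \<partial>\<nu>) = jump_exponent u / u\<^sup>2"
    unfolding jump_exponent_def by simp
  also have "ennreal b * (\<integral>\<^sup>+z. indicator {0<..} z * ennreal (exp (- u * z)) \<partial>lborel) +
      ennreal (jump_exponent u / u\<^sup>2) = ennreal ((b * u + jump_exponent u) / u\<^sup>2)"
    using assms jump_exponent_nonneg[of u]
    by (subst laplace_transform_exponential)
       (auto simp: ennreal_mult[symmetric] ennreal_plus[symmetric] add_divide_distrib power2_eq_square
          simp del: ennreal_plus)
  finally show ?thesis .
qed

end

lemma immigration_parametersD: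
  assumes "immigration_parameters F b m"
  shows "finite_variation_jump_measure m" "0 \<le> b"
    "0 \<le> u \<Longrightarrow> F u = b * u + finite_variation_jump_measure.jump_exponent m u"
proof -
  show m: "finite_variation_jump_measure m"
    using assms by unfold_locales (auto simp: immigration_parameters_def)
  interpret finite_variation_jump_measure m by fact
  show "0 \<le> b" using assms by (simp add: immigration_parameters_def)
  show "F u = b * u + jump_exponent u" if "0 \<le> u"
  proof -
    have "F u = b * u - (LINT \<xi>:{0<..}|m. exp (- u * \<xi>) - 1)"
      using assms that by (simp add: immigration_parameters_def)
    also have "(LINT \<xi>:{0<..}|m. exp (- u * \<xi>) - 1) = (\<integral>\<xi>. - (1 - exp (- u * \<xi>)) \<partial>m)"
      by (subst set_integral_pos) (auto intro: Bochner_Integration.integral_cong)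
    also have "\<dots> = - jump_exponent u"
      unfolding jump_exponent_def by (rule integral_minus)
    finally show ?thesis by simp
  qed
qed

section \<open>Branching mechanisms\<close>

locale branching_mechanism = positive_jump_measure \<mu> 2 for \<mu> +
  fixes R :: "real \<Rightarrow> real" and \<alpha> \<beta> :: real
  assumes alpha_nonneg: "0 \<le> \<alpha>"
    and R_eq: "0 \<le> u \<Longrightarrow> R u = - \<alpha> * u\<^sup>2 + \<beta> * u
        - (\<integral>\<xi>. exp (- u * \<xi>) - 1 + u * \<xi> * indicator {0<..1} \<xi> \<partial>\<mu>)"
begin

text \<open>For jumps up to 1 the integrand is a second-order Taylor remainder, for larger ones it
  lies between -1 and 0. Hence only the upper bound carries the factor
  \<open>u\<^sup>2\<close>.\<close>

lemma compensated_bounds: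
  fixes u \<xi> :: real
  assumes "0 \<le> u" "0 < \<xi>"
  shows "exp (- u * \<xi>) - 1 + u * \<xi> * indicator {0<..1} \<xi> \<le> u\<^sup>2 * min (\<xi>\<^sup>2) 1"
    and "- min (\<xi>\<^sup>2) 1 \<le> exp (- u * \<xi>) - 1 + u * \<xi> * indicator {0<..1} \<xi>"
proof -
  have e: "exp (- u * \<xi>) \<le> 1" using assms by simp
  have t: "0 \<le> exp (- u * \<xi>) - 1 + u * \<xi>" "exp (- u * \<xi>) - 1 + u * \<xi> \<le> (u * \<xi>)\<^sup>2 / 2"
    using exp_minus_taylor2[of "u * \<xi>"] assms by simp_all
  have sq: "\<xi>\<^sup>2 \<le> 1" if "\<xi> \<le> 1" using that assms by (simp add: power_le_one)
  have sq': "1 \<le> \<xi>\<^sup>2" if "1 < \<xi>" using that by (simp add: one_le_power)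
  show "exp (- u * \<xi>) - 1 + u * \<xi> * indicator {0<..1} \<xi> \<le> u\<^sup>2 * min (\<xi>\<^sup>2) 1"
  proof (cases "\<xi> \<le> 1")
    case True
    have "(u * \<xi>)\<^sup>2 / 2 \<le> u\<^sup>2 * \<xi>\<^sup>2" by (simp add: power_mult_distrib)
    then show ?thesis using True t sq assms by (simp add: min_absorb1)
  next
    case False
    have "exp (- u * \<xi>) - 1 + u * \<xi> * indicator {0<..1} \<xi> \<le> 0" using False e by simp
    also have "0 \<le> u\<^sup>2 * min (\<xi>\<^sup>2) 1" by simp
    finally show ?thesis .
  qed
  show "- min (\<xi>\<^sup>2) 1 \<le> exp (- u * \<xi>) - 1 + u * \<xi> * indicator {0<..1} \<xi>"
  proof (cases "\<xi> \<le> 1")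
    case True
    have "0 \<le> min (\<xi>\<^sup>2) 1" by simp
    moreover have "0 \<le> exp (- u * \<xi>) - 1 + u * \<xi> * indicator {0<..1} \<xi>"
      using True t(1) assms by simp
    ultimately show ?thesis by linarith
  qed (use sq' in \<open>simp add: min_absorb2\<close>)
qed

lemma integrable_compensated:
  assumes "0 \<le> u"
  shows "integrable \<mu> (\<lambda>\<xi>. exp (- u * \<xi>) - 1 + u * \<xi> * indicator {0<..1} \<xi>)"
proof (rule Bochner_Integration.integrable_bound)
  show "integrable \<mu> (\<lambda>\<xi>. (u\<^sup>2 + 1) * min (\<xi> ^ 2) 1)"
    by (intro integrable_mult_right integrable_min)
  show "AE \<xi> in \<mu>. norm (exp (- u * \<xi>) - 1 + u * \<xi> * indicator {0<..1} \<xi>) \<le> norm ((u\<^sup>2 + 1) * min (\<xi> ^ 2) 1)"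
    using AE_pos
  proof eventually_elim
    case (elim \<xi>)
    define M where "M = min (\<xi>\<^sup>2) 1"
    have "0 \<le> M" "0 \<le> u\<^sup>2 * M" by (simp_all add: M_def)
    then have "\<bar>exp (- u * \<xi>) - 1 + u * \<xi> * indicator {0<..1} \<xi>\<bar> \<le> u\<^sup>2 * M + M"
      using compensated_bounds[OF assms elim] unfolding M_def[symmetric] by linarith
    also have "\<dots> = norm ((u\<^sup>2 + 1) * M)"
      using \<open>0 \<le> M\<close> \<open>0 \<le> u\<^sup>2 * M\<close> by (simp add: distrib_right)
    finally show ?case by (simp add: M_def)
  qed
qed measurable

text \<open>Quadratic growth is what keeps E exp(- v Y t) bounded on the time scale t = 1 /
  \<open>v\<^sup>2\<close> in the argument for infinite variation.\<close>

lemma R_quadratic_bound: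
  assumes "1 \<le> v"
  shows "- R v \<le> (\<alpha> + \<bar>\<beta>\<bar> + (\<integral>\<xi>. min (\<xi>\<^sup>2) 1 \<partial>\<mu>)) * v\<^sup>2"
proof -
  have "(\<integral>\<xi>. exp (- v * \<xi>) - 1 + v * \<xi> * indicator {0<..1} \<xi> \<partial>\<mu>) \<le> (\<integral>\<xi>. v\<^sup>2 * min (\<xi>\<^sup>2) 1 \<partial>\<mu>)"
    using assms AE_pos compensated_bounds(1)
    by (intro integral_mono_AE integrable_compensated integrable_mult_right integrable_min)
       (auto elim!: eventually_mono)
  moreover have "- \<beta> * v \<le> \<bar>\<beta>\<bar> * v\<^sup>2"
  proof -
    have "- \<beta> * v \<le> \<bar>\<beta>\<bar> * v" using assms by (intro mult_right_mono) auto
    also have "\<dots> \<le> \<bar>\<beta>\<bar> * v\<^sup>2" using assms by (intro mult_left_mono) (auto simp: power2_eq_square)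
    finally show ?thesis .
  qed
  ultimately show ?thesis using assms R_eq[of v] by (simp add: algebra_simps)
qed

lemma finite_variationI:
  assumes "(\<integral>\<^sup>+\<xi>\<in>{0<..1}. ennreal \<xi> \<partial>\<mu>) < \<infinity>"
  shows "finite_variation_jump_measure \<mu>"
proof unfold_locales
  have "(\<integral>\<^sup>+\<xi>\<in>{0<..}. ennreal (min (\<xi> ^ 1) 1) \<partial>\<mu>) \<le>
      (\<integral>\<^sup>+\<xi>. ennreal \<xi> * indicator {0<..1} \<xi> + ennreal (min (\<xi>\<^sup>2) 1) * indicator {0<..} \<xi> \<partial>\<mu>)"
    by (rule nn_integral_mono)
       (auto split: split_indicator simp: min_def one_le_power not_le power_le_one_iff le_less)
  also have "\<dots> = (\<integral>\<^sup>+\<xi>\<in>{0<..1}. ennreal \<xi> \<partial>\<mu>) + (\<integral>\<^sup>+\<xi>\<in>{0<..}. ennreal (min (\<xi>\<^sup>2) 1) \<partial>\<mu>)"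
    by (rule nn_integral_add) measurable
  also have "\<dots> < \<infinity>" using assms jump_integral_finite by simp
  finally show "(\<integral>\<^sup>+\<xi>\<in>{0<..}. ennreal (min (\<xi> ^ 1) 1) \<partial>\<mu>) < \<infinity>" .
qed (rule sets_nu nonpos_null)+

text \<open>If the small jumps are summable, their compensator splits off and joins the linear term,
  whose coefficient becomes minus the effective drift when \<alpha> = 0.\<close>

lemma R_finite_variation:
  assumes fin: "(\<integral>\<^sup>+\<xi>\<in>{0<..1}. ennreal \<xi> \<partial>\<mu>) < \<infinity>" and "0 \<le> u"
  shows "R u = - \<alpha> * u\<^sup>2 - ((LINT \<xi>:{0<..1}|\<mu>. \<xi>) - \<beta>) * u +
    finite_variation_jump_measure.jump_exponent \<mu> u"
proof -
  interpret fv: finite_variation_jump_measure \<mu> using fin by (rule finite_variationI)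
  have int: "integrable \<mu> (\<lambda>\<xi>. \<xi> * indicator {0<..1} \<xi>)"
  proof (rule integrableI_nonneg)
    show "(\<integral>\<^sup>+\<xi>. ennreal (\<xi> * indicator {0<..1} \<xi>) \<partial>\<mu>) < \<infinity>"
      using fin by (simp add: ennreal_mult'' ennreal_indicator)
  qed (auto split: split_indicator)
  have "(\<integral>\<xi>. exp (- u * \<xi>) - 1 + u * \<xi> * indicator {0<..1} \<xi> \<partial>\<mu>) =
      (\<integral>\<xi>. u * (\<xi> * indicator {0<..1} \<xi>) - (1 - exp (- u * \<xi>)) \<partial>\<mu>)"
    by (intro Bochner_Integration.integral_cong) auto
  also have "\<dots> = u * (\<integral>\<xi>. \<xi> * indicator {0<..1} \<xi> \<partial>\<mu>) - fv.jump_exponent u"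
    unfolding fv.jump_exponent_def
    by (subst Bochner_Integration.integral_diff)
       (use int fv.integrable_one_minus_exp[OF assms(2)] in auto)
  also have "(\<integral>\<xi>. \<xi> * indicator {0<..1} \<xi> \<partial>\<mu>) = (LINT \<xi>:{0<..1}|\<mu>. \<xi>)"
    by (simp add: set_lebesgue_integral_def mult.commute)
  finally show ?thesis using R_eq[OF assms(2)] by (simp add: algebra_simps)
qed

end

lemma branching_parametersD:
  assumes "branching_parameters R \<alpha> \<beta> \<mu>"
  shows "branching_mechanism \<mu> R \<alpha> \<beta>"
proof -
  interpret positive_jump_measure \<mu> 2
    using assms by unfold_locales (auto simp: branching_parameters_def)
  show ?thesis
    using assms by unfold_locales (auto simp: branching_parameters_def set_integral_pos)
qed

locale subcritical_branching_mechanism = branching_mechanism +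
  assumes R_neg: "0 < u \<Longrightarrow> R u < 0"
begin

text \<open>In \<open>- R u > 0\<close> the jumps above 1 enter with a negative sign, so their part
  divided by u has integral at most \<open>(\<alpha> + I2) * u - \<beta>\<close>. As u tends to 0
  the integrand tends to \<xi>, and Fatou's lemma carries the bound to the limit.\<close>

lemma large_jump_integral:
  shows "integrable \<mu> (\<lambda>\<xi>. \<xi> * indicator {1<..} \<xi>)"
    and "(\<integral>\<xi>. \<xi> * indicator {1<..} \<xi> \<partial>\<mu>) \<le> - \<beta>"
proof -
  define I2 where "I2 = (\<integral>\<xi>. min (\<xi>\<^sup>2) 1 \<partial>\<mu>)"
  define h where "h u \<xi> = (1 - exp (- u * \<xi>)) * indicator {1<..} \<xi>" for u \<xi> :: real
  have h_eq: "h u \<xi> = (exp (- u * \<xi>) - 1 + u * \<xi>) * indicator {0<..1} \<xi> -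
      (exp (- u * \<xi>) - 1 + u * \<xi> * indicator {0<..1} \<xi>)" if "0 < \<xi>" for u \<xi>
    using that by (auto simp: h_def split: split_indicator)
  have g: "integrable \<mu> (\<lambda>\<xi>. (exp (- u * \<xi>) - 1 + u * \<xi>) * indicator {0<..1} \<xi>)"
    "(\<integral>\<xi>. (exp (- u * \<xi>) - 1 + u * \<xi>) * indicator {0<..1} \<xi> \<partial>\<mu>) \<le> u\<^sup>2 * I2" if "0 < u" for u
  proof -
    have bound: "0 \<le> (exp (- u * \<xi>) - 1 + u * \<xi>) * indicator {0<..1} \<xi>"
      "(exp (- u * \<xi>) - 1 + u * \<xi>) * indicator {0<..1} \<xi> \<le> u\<^sup>2 * min (\<xi>\<^sup>2) 1" if "0 < \<xi>" for \<xi>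
    proof -
      show "0 \<le> (exp (- u * \<xi>) - 1 + u * \<xi>) * indicator {0<..1} \<xi>"
        using exp_minus_taylor2(1)[of "u * \<xi>"] that \<open>0 < u\<close> by (auto split: split_indicator)
      show "(exp (- u * \<xi>) - 1 + u * \<xi>) * indicator {0<..1} \<xi> \<le> u\<^sup>2 * min (\<xi>\<^sup>2) 1"
        using compensated_bounds(1)[of u \<xi>] that \<open>0 < u\<close> by (cases "\<xi> \<le> 1") auto
    qed
    have maj: "integrable \<mu> (\<lambda>\<xi>. u\<^sup>2 * min (\<xi>\<^sup>2) 1)"
      by (intro integrable_mult_right integrable_min)
    show int: "integrable \<mu> (\<lambda>\<xi>. (exp (- u * \<xi>) - 1 + u * \<xi>) * indicator {0<..1} \<xi>)"
    proof (rule Bochner_Integration.integrable_bound[OF maj])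
      show "AE \<xi> in \<mu>. norm ((exp (- u * \<xi>) - 1 + u * \<xi>) * indicator {0<..1} \<xi>)
          \<le> norm (u\<^sup>2 * min (\<xi>\<^sup>2) 1)"
        using AE_pos
      proof eventually_elim
        case (elim \<xi>)
        have "norm ((exp (- u * \<xi>) - 1 + u * \<xi>) * indicator {0<..1} \<xi>) =
            (exp (- u * \<xi>) - 1 + u * \<xi>) * indicator {0<..1} \<xi>"
          using bound(1)[OF elim] by (simp only: real_norm_def abs_of_nonneg)
        also have "\<dots> \<le> u\<^sup>2 * min (\<xi>\<^sup>2) 1" by (rule bound(2)[OF elim])
        also have "\<dots> \<le> norm (u\<^sup>2 * min (\<xi>\<^sup>2) 1)" by (simp only: real_norm_def abs_ge_self)
        finally show ?case .
      qed
    qed measurable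
    have "(\<integral>\<xi>. (exp (- u * \<xi>) - 1 + u * \<xi>) * indicator {0<..1} \<xi> \<partial>\<mu>) \<le> (\<integral>\<xi>. u\<^sup>2 * min (\<xi>\<^sup>2) 1 \<partial>\<mu>)"
      by (rule integral_mono_AE[OF int maj]) (use AE_pos bound(2) in \<open>auto elim!: eventually_mono\<close>)
    then show "(\<integral>\<xi>. (exp (- u * \<xi>) - 1 + u * \<xi>) * indicator {0<..1} \<xi> \<partial>\<mu>) \<le> u\<^sup>2 * I2"
      unfolding I2_def by simp
  qed
  have h: "integrable \<mu> (h u)" "(\<integral>\<xi>. h u \<xi> / u \<partial>\<mu>) \<le> (\<alpha> + I2) * u - \<beta>" if u: "0 < u" for u
  proof -
    let ?d = "\<lambda>\<xi>. (exp (- u * \<xi>) - 1 + u * \<xi>) * indicator {0<..1} \<xi> -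
      (exp (- u * \<xi>) - 1 + u * \<xi> * indicator {0<..1} \<xi>)"
    have int_d: "integrable \<mu> ?d"
      by (intro Bochner_Integration.integrable_diff g(1) integrable_compensated) (use u in auto)
    have [measurable]: "h u \<in> borel_measurable borel" unfolding h_def by measurable
    have ae: "AE \<xi> in \<mu>. h u \<xi> = ?d \<xi>"
      using AE_pos by eventually_elim (rule h_eq)
    show int_h: "integrable \<mu> (h u)"
      by (subst integrable_cong_AE[OF _ _ ae]) (use int_d in auto)
    have "(\<integral>\<xi>. h u \<xi> \<partial>\<mu>) = (\<integral>\<xi>. ?d \<xi> \<partial>\<mu>)"
      by (rule integral_cong_AE[OF _ _ ae]) measurable
    also have "\<dots> = (\<integral>\<xi>. (exp (- u * \<xi>) - 1 + u * \<xi>) * indicator {0<..1} \<xi> \<partial>\<mu>) -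
        (\<integral>\<xi>. exp (- u * \<xi>) - 1 + u * \<xi> * indicator {0<..1} \<xi> \<partial>\<mu>)"
      by (intro Bochner_Integration.integral_diff g(1) integrable_compensated) (use u in auto)
    also have "\<dots> \<le> u\<^sup>2 * I2 + \<alpha> * u\<^sup>2 - \<beta> * u"
      using g(2)[OF u] R_eq[of u] R_neg[OF u] u by simp
    also have "\<dots> = ((\<alpha> + I2) * u - \<beta>) * u" by (simp add: algebra_simps power2_eq_square)
    finally show "(\<integral>\<xi>. h u \<xi> / u \<partial>\<mu>) \<le> (\<alpha> + I2) * u - \<beta>"
      using u by (simp add: pos_divide_le_eq)
  qed
  define w where "w n = 1 / real (Suc n)" for n
  have w_pos: "0 < w n" for n by (simp add: w_def)
  have w_lim: "w \<longlonglongrightarrow> 0" unfolding w_def by (rule lim_1_over_n[THEN LIMSEQ_Suc])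
  have w_at: "filterlim w (at_right 0) sequentially"
    using w_lim w_pos by (auto simp: filterlim_at intro!: always_eventually) (metis less_irrefl)
  have bound_lim: "(\<lambda>n. (\<alpha> + I2) * w n - \<beta>) \<longlonglongrightarrow> (\<alpha> + I2) * 0 - \<beta>"
    by (intro tendsto_intros w_lim)
  have h_nonneg: "0 \<le> h (w n) \<xi> / w n" for n \<xi>
    using w_pos[of n] by (auto simp: h_def split: split_indicator)
  have nn: "0 \<le> (\<alpha> + I2) * w n - \<beta>" for n
    using h(2)[OF w_pos] integral_nonneg_AE[where M=\<mu> and f="\<lambda>\<xi>. h (w n) \<xi> / w n"] h_nonneg
    by (meson AE_I2 order_trans)
  \<comment> \<open>\<open>ennreal (- \<beta>)\<close> would be 0 for positive \<beta>; the sign is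
    needed to read the final inequality in the reals.\<close>
  have beta: "0 \<le> - \<beta>"
    using tendsto_lowerbound[OF bound_lim, of 0] nn by auto
  have "(\<integral>\<^sup>+\<xi>. ennreal (\<xi> * indicator {1<..} \<xi>) \<partial>\<mu>) =
      (\<integral>\<^sup>+\<xi>. liminf (\<lambda>n. ennreal (h (w n) \<xi> / w n)) \<partial>\<mu>)"
  proof (rule nn_integral_cong)
    fix \<xi>
    have "(\<lambda>n. h (w n) \<xi> / w n) \<longlonglongrightarrow> \<xi> * indicator {1<..} \<xi>"
    proof (cases "1 < \<xi>")
      case True
      then have "((\<lambda>u. (1 - exp (- u * \<xi>)) / u) \<longlongrightarrow> \<xi>) (at_right 0)" by real_asymp
      from filterlim_compose[OF this w_at] show ?thesis using True by (simp add: h_def)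
    qed (simp add: h_def)
    then have "(\<lambda>n. ennreal (h (w n) \<xi> / w n)) \<longlonglongrightarrow> ennreal (\<xi> * indicator {1<..} \<xi>)"
      by (rule tendsto_ennrealI)
    from lim_imp_Liminf[OF _ this]
    show "ennreal (\<xi> * indicator {1<..} \<xi>) = liminf (\<lambda>n. ennreal (h (w n) \<xi> / w n))" by simp
  qed
  also have "\<dots> \<le> liminf (\<lambda>n. \<integral>\<^sup>+\<xi>. ennreal (h (w n) \<xi> / w n) \<partial>\<mu>)"
    by (rule nn_integral_liminf) (auto simp: h_def)
  also have "\<dots> \<le> liminf (\<lambda>n. ennreal ((\<alpha> + I2) * w n - \<beta>))"
  proof (intro Liminf_mono always_eventually allI)
    fix n
    have "(\<integral>\<^sup>+\<xi>. ennreal (h (w n) \<xi> / w n) \<partial>\<mu>) = ennreal (\<integral>\<xi>. h (w n) \<xi> / w n \<partial>\<mu>)"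
      by (intro nn_integral_eq_integral integrable_divide_zero h(1) w_pos AE_I2 h_nonneg)
    then show "(\<integral>\<^sup>+\<xi>. ennreal (h (w n) \<xi> / w n) \<partial>\<mu>) \<le> ennreal ((\<alpha> + I2) * w n - \<beta>)"
      using h(2)[OF w_pos] by (simp add: ennreal_leI)
  qed
  also have "\<dots> = ennreal (- \<beta>)"
    using lim_imp_Liminf[OF _ tendsto_ennrealI[OF bound_lim]] by simp
  finally have le: "(\<integral>\<^sup>+\<xi>. ennreal (\<xi> * indicator {1<..} \<xi>) \<partial>\<mu>) \<le> ennreal (- \<beta>)" .
  show int: "integrable \<mu> (\<lambda>\<xi>. \<xi> * indicator {1<..} \<xi>)"
  proof (rule integrableI_nonneg)
    show "(\<integral>\<^sup>+\<xi>. ennreal (\<xi> * indicator {1<..} \<xi>) \<partial>\<mu>) < \<infinity>"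
      using le by (simp add: le_less_trans)
  qed (auto split: split_indicator)
  have "ennreal (\<integral>\<xi>. \<xi> * indicator {1<..} \<xi> \<partial>\<mu>) \<le> ennreal (- \<beta>)"
    using le by (subst nn_integral_eq_integral[symmetric, OF int]) (auto split: split_indicator)
  then show "(\<integral>\<xi>. \<xi> * indicator {1<..} \<xi> \<partial>\<mu>) \<le> - \<beta>"
    using beta by (simp add: ennreal_le_iff)
qed

text \<open>This is \<open>- R'(0+)\<close>, the linear coefficient of \<open>- R\<close> once all
  jumps are compensated.\<close>

definition mean_drift :: real where
  "mean_drift = - \<beta> - (\<integral>\<xi>. \<xi> * indicator {1<..} \<xi> \<partial>\<mu>)"

lemma mean_drift_nonneg: "0 \<le> mean_drift"
  using large_jump_integral(2) by (simp add: mean_drift_def)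

text \<open>Finiteness of the mean of the large jumps allows their compensation too. Every term is
  now nonnegative, as the reading of \<open>- R\<close> as a transform of a measure demands.\<close>

lemma minus_R_eq:
  assumes "0 \<le> u"
  shows "integrable \<mu> (\<lambda>\<xi>. exp (- u * \<xi>) - 1 + u * \<xi>)"
    and "- R u = \<alpha> * u\<^sup>2 + mean_drift * u + (\<integral>\<xi>. exp (- u * \<xi>) - 1 + u * \<xi> \<partial>\<mu>)"
proof -
  let ?s = "\<lambda>\<xi>. (exp (- u * \<xi>) - 1 + u * \<xi> * indicator {0<..1} \<xi>) + u * (\<xi> * indicator {1<..} \<xi>)"
  have ae: "AE \<xi> in \<mu>. exp (- u * \<xi>) - 1 + u * \<xi> = ?s \<xi>"
    using AE_pos by eventually_elim (auto split: split_indicator)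
  have int_s: "integrable \<mu> ?s"
    by (intro Bochner_Integration.integrable_add integrable_compensated assms
        integrable_mult_right large_jump_integral(1))
  show "integrable \<mu> (\<lambda>\<xi>. exp (- u * \<xi>) - 1 + u * \<xi>)"
    by (subst integrable_cong_AE[OF _ _ ae]) (use int_s in auto)
  have "(\<integral>\<xi>. exp (- u * \<xi>) - 1 + u * \<xi> \<partial>\<mu>) = (\<integral>\<xi>. ?s \<xi> \<partial>\<mu>)"
    by (rule integral_cong_AE[OF _ _ ae]) measurable
  also have "\<dots> = (\<integral>\<xi>. exp (- u * \<xi>) - 1 + u * \<xi> * indicator {0<..1} \<xi> \<partial>\<mu>) +
      (\<integral>\<xi>. u * (\<xi> * indicator {1<..} \<xi>) \<partial>\<mu>)"
    by (intro Bochner_Integration.integral_add integrable_compensated assms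
        integrable_mult_right large_jump_integral(1))
  also have "(\<integral>\<xi>. u * (\<xi> * indicator {1<..} \<xi>) \<partial>\<mu>) = u * (\<integral>\<xi>. \<xi> * indicator {1<..} \<xi> \<partial>\<mu>)"
    by simp
  finally show "- R u = \<alpha> * u\<^sup>2 + mean_drift * u + (\<integral>\<xi>. exp (- u * \<xi>) - 1 + u * \<xi> \<partial>\<mu>)"
    using R_eq[OF assms] by (simp add: mean_drift_def algebra_simps)
qed

text \<open>\<open>laplace_transform_pos_part\<close> integrated over \<open>\<mu>\<close>. The
  quadratic term becomes an atom of mass \<alpha> at 0, which has no Lebesgue density and therefore
  stands outside the integral.\<close>

lemma laplace_transform_double_tail:
  assumes "0 < u"
  shows "ennreal \<alpha> + (\<integral>\<^sup>+z. (ennreal mean_drift + (\<integral>\<^sup>+\<xi>. ennreal (\<xi> - z) \<partial>\<mu>)) *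
      indicator {0<..} z * ennreal (exp (- u * z)) \<partial>lborel) = ennreal (- R u / u\<^sup>2)"
proof -
  interpret pair_sigma_finite \<mu> lborel ..
  have nn: "0 \<le> exp (- u * \<xi>) - 1 + u * \<xi>" for \<xi>
    using exp_ge_add_one_self[of "- u * \<xi>"] by simp
  have "(\<integral>\<^sup>+z. (ennreal mean_drift + (\<integral>\<^sup>+\<xi>. ennreal (\<xi> - z) \<partial>\<mu>)) *
      indicator {0<..} z * ennreal (exp (- u * z)) \<partial>lborel) =
    (\<integral>\<^sup>+z. ennreal mean_drift * (indicator {0<..} z * ennreal (exp (- u * z))) +
      (\<integral>\<^sup>+\<xi>. ennreal (\<xi> - z) * indicator {0<..} z * ennreal (exp (- u * z)) \<partial>\<mu>) \<partial>lborel)"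
    by (intro nn_integral_cong) (simp add: distrib_right nn_integral_multc mult.assoc)
  also have "\<dots> = ennreal mean_drift * (\<integral>\<^sup>+z. indicator {0<..} z * ennreal (exp (- u * z)) \<partial>lborel) +
    (\<integral>\<^sup>+z. (\<integral>\<^sup>+\<xi>. ennreal (\<xi> - z) * indicator {0<..} z * ennreal (exp (- u * z)) \<partial>\<mu>) \<partial>lborel)"
    by (subst nn_integral_add) (auto simp: nn_integral_cmult)
  also have "(\<integral>\<^sup>+z. (\<integral>\<^sup>+\<xi>. ennreal (\<xi> - z) * indicator {0<..} z * ennreal (exp (- u * z)) \<partial>\<mu>) \<partial>lborel) =
    (\<integral>\<^sup>+\<xi>. (\<integral>\<^sup>+z. ennreal (\<xi> - z) * indicator {0<..} z * ennreal (exp (- u * z)) \<partial>lborel) \<partial>\<mu>)"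
    by (rule Fubini') measurable
  also have "\<dots> = (\<integral>\<^sup>+\<xi>. ennreal ((exp (- u * \<xi>) - 1 + u * \<xi>) / u\<^sup>2) \<partial>\<mu>)"
    by (rule nn_integral_cong_AE) (use AE_pos in eventually_elim, use assms laplace_transform_pos_part in auto)
  also have "\<dots> = ennreal (\<integral>\<xi>. (exp (- u * \<xi>) - 1 + u * \<xi>) / u\<^sup>2 \<partial>\<mu>)"
    using assms nn by (intro nn_integral_eq_integral integrable_divide_zero minus_R_eq(1)) auto
  also have "(\<integral>\<xi>. (exp (- u * \<xi>) - 1 + u * \<xi>) / u\<^sup>2 \<partial>\<mu>) = (\<integral>\<xi>. exp (- u * \<xi>) - 1 + u * \<xi> \<partial>\<mu>) / u\<^sup>2"
    by simp
  also have "ennreal mean_drift * (\<integral>\<^sup>+z. indicator {0<..} z * ennreal (exp (- u * z)) \<partial>lborel) =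
      ennreal (mean_drift / u)"
    using assms mean_drift_nonneg
    by (subst laplace_transform_exponential) (auto simp: ennreal_mult[symmetric])
  also have "ennreal \<alpha> + (ennreal (mean_drift / u) + ennreal ((\<integral>\<xi>. exp (- u * \<xi>) - 1 + u * \<xi> \<partial>\<mu>) / u\<^sup>2)) =
      ennreal (\<alpha> + (mean_drift / u + (\<integral>\<xi>. exp (- u * \<xi>) - 1 + u * \<xi> \<partial>\<mu>) / u\<^sup>2))"
    using assms alpha_nonneg mean_drift_nonneg nn
    by (simp add: ennreal_plus[symmetric] integral_nonneg del: ennreal_plus)
  also have "\<alpha> + (mean_drift / u + (\<integral>\<xi>. exp (- u * \<xi>) - 1 + u * \<xi> \<partial>\<mu>) / u\<^sup>2) = - R u / u\<^sup>2"
    using minus_R_eq(2)[of u] assms by (simp add: field_simps power2_eq_square)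
  finally show ?thesis .
qed

text \<open>With bounded variation the jump exponent is sublinear and only the drift survives.
  Otherwise either \<alpha> u diverges, or \<open>(exp (- u * \<xi>) - 1 + u * \<xi>) / u\<close>
  tends to \<xi>, whose \<open>\<mu>\<close>-integral is infinite, and Fatou's lemma
  applies.\<close>

lemma minus_R_over_u_tendsto: "((\<lambda>u. ereal (- R u / u)) \<longlongrightarrow> effective_drift \<alpha> \<beta> \<mu>) at_top"
proof (cases "\<alpha> = 0 \<and> (\<integral>\<^sup>+\<xi>\<in>{0<..1}. ennreal \<xi> \<partial>\<mu>) < \<infinity>")
  case True
  then interpret fv: finite_variation_jump_measure \<mu> by (intro finite_variationI) auto
  define l where "l = (LINT \<xi>:{0<..1}|\<mu>. \<xi>) - \<beta>"
  have "((\<lambda>u. l - fv.jump_exponent u / u) \<longlongrightarrow> l - 0) at_top"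
    by (intro tendsto_intros fv.jump_exponent_sublinear)
  moreover have "\<forall>\<^sub>F u in at_top. l - fv.jump_exponent u / u = - R u / u"
    using eventually_gt_at_top[of 0]
  proof eventually_elim
    case (elim u)
    then have "R u = - l * u + fv.jump_exponent u"
      using True R_finite_variation[of u] by (simp add: l_def left_diff_distrib)
    then have "- R u / u = (l * u - fv.jump_exponent u) / u" by simp
    also have "\<dots> = l - fv.jump_exponent u / u" using elim by (simp add: diff_divide_distrib)
    finally show ?case ..
  qed
  ultimately have "((\<lambda>u. - R u / u) \<longlongrightarrow> l) at_top"
    by (simp add: Lim_transform_eventually)
  then show ?thesis using True by (simp add: effective_drift_def l_def)
next
  case False
  define D where "D u = (\<integral>\<xi>. exp (- u * \<xi>) - 1 + u * \<xi> \<partial>\<mu>) / u" for u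
  have nn: "0 \<le> exp (- u * \<xi>) - 1 + u * \<xi>" for u \<xi> :: real
    using exp_ge_add_one_self[of "- u * \<xi>"] by simp
  have D_nonneg: "0 \<le> D u" if "0 < u" for u
    unfolding D_def using that nn by (intro divide_nonneg_pos integral_nonneg) auto
  have R_D: "- R u / u = \<alpha> * u + mean_drift + D u" if "0 < u" for u
    using minus_R_eq(2)[of u] that by (simp add: D_def field_simps power2_eq_square)
  have "filterlim (\<lambda>u. - R u / u) at_top at_top"
  proof (cases "\<alpha> = 0")
    case False
    then have "filterlim (\<lambda>u. \<alpha> * u) at_top at_top"
      using alpha_nonneg by (intro filterlim_tendsto_pos_mult_at_top[OF tendsto_const] filterlim_ident) auto
    moreover have "\<forall>\<^sub>F u in at_top. \<alpha> * u \<le> - R u / u"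
      using eventually_gt_at_top[of 0]
      by eventually_elim (use R_D D_nonneg mean_drift_nonneg in \<open>auto simp: add_nonneg_nonneg\<close>)
    ultimately show ?thesis by (rule filterlim_at_top_mono)
  next
    case True
    with False have inf: "(\<integral>\<^sup>+\<xi>\<in>{0<..1}. ennreal \<xi> \<partial>\<mu>) = \<infinity>"
      by (auto simp: not_less top_unique)
    \<comment> \<open>Fatou's lemma concerns sequences, so divergence is proved along every sequence
      tending to infinity.\<close>
    have seq: "filterlim (\<lambda>n. - R (x n) / x n) at_top sequentially"
      if x: "filterlim x at_top sequentially" for x :: "nat \<Rightarrow> real"
    proof -
      have "(\<integral>\<^sup>+\<xi>\<in>{0<..1}. ennreal \<xi> \<partial>\<mu>) \<le> (\<integral>\<^sup>+\<xi>. ennreal \<xi> \<partial>\<mu>)"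
        by (rule nn_integral_mono) (auto split: split_indicator)
      also have "\<dots> = (\<integral>\<^sup>+\<xi>. liminf (\<lambda>n. ennreal ((exp (- x n * \<xi>) - 1 + x n * \<xi>) / x n)) \<partial>\<mu>)"
      proof (rule nn_integral_cong_AE, use AE_pos in eventually_elim)
        fix \<xi> :: real assume "0 < \<xi>"
        then have "((\<lambda>u. (exp (- u * \<xi>) - 1 + u * \<xi>) / u) \<longlongrightarrow> \<xi>) at_top" by real_asymp
        from tendsto_ennrealI[OF filterlim_compose[OF this x]]
        show "ennreal \<xi> = liminf (\<lambda>n. ennreal ((exp (- x n * \<xi>) - 1 + x n * \<xi>) / x n))"
          by (subst lim_imp_Liminf) auto
      qed
      also have "\<dots> \<le> liminf (\<lambda>n. \<integral>\<^sup>+\<xi>. ennreal ((exp (- x n * \<xi>) - 1 + x n * \<xi>) / x n) \<partial>\<mu>)"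
        by (rule nn_integral_liminf) measurable
      finally have liminf: "liminf (\<lambda>n. \<integral>\<^sup>+\<xi>. ennreal ((exp (- x n * \<xi>) - 1 + x n * \<xi>) / x n) \<partial>\<mu>) = \<infinity>"
        using inf by (simp add: top_unique)
      show ?thesis
        unfolding filterlim_at_top
      proof
        fix K :: real
        have "\<forall>\<^sub>F n in sequentially. ennreal K < (\<integral>\<^sup>+\<xi>. ennreal ((exp (- x n * \<xi>) - 1 + x n * \<xi>) / x n) \<partial>\<mu>)"
          by (rule less_LiminfD) (unfold liminf, simp)
        moreover have "\<forall>\<^sub>F n in sequentially. 0 < x n"
          using x by (simp add: filterlim_at_top_dense)
        ultimately show "\<forall>\<^sub>F n in sequentially. K \<le> - R (x n) / x n"
        proof eventually_elim
          case (elim n)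
          have "(\<integral>\<^sup>+\<xi>. ennreal ((exp (- x n * \<xi>) - 1 + x n * \<xi>) / x n) \<partial>\<mu>) = ennreal (D (x n))"
            unfolding D_def using elim nn minus_R_eq(1)[of "x n"]
            by (subst nn_integral_eq_integral) (auto intro!: AE_I2 divide_nonneg_pos)
          with elim have "ennreal K < ennreal (D (x n))" by simp
          then have "K < D (x n)"
            by (meson ennreal_leI not_le)
          then show ?case
            using R_D[of "x n"] elim True mean_drift_nonneg by simp
        qed
      qed
    qed
    have "((\<lambda>u. ereal (- R u / u)) \<longlongrightarrow> \<infinity>) at_top"
      by (rule tendsto_at_topI_sequentially) (unfold tendsto_PInfty_eq_at_top, rule seq)
    then show ?thesis by (simp add: tendsto_PInfty_eq_at_top)
  qed
  then show ?thesis using False by (auto simp: effective_drift_def tendsto_PInfty_eq_at_top)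
qed

text \<open>In the finite case \<open>R 1\<close> is minus the drift plus a nonnegative jump
  exponent, and yet negative.\<close>

lemma effective_drift_pos: "0 < effective_drift \<alpha> \<beta> \<mu>"
proof (cases "\<alpha> = 0 \<and> (\<integral>\<^sup>+\<xi>\<in>{0<..1}. ennreal \<xi> \<partial>\<mu>) < \<infinity>")
  case True
  then interpret fv: finite_variation_jump_measure \<mu> by (intro finite_variationI) auto
  show ?thesis
    using True R_neg[of 1] R_finite_variation[of 1] fv.jump_exponent_nonneg[of 1]
    by (auto simp: effective_drift_def)
qed (auto simp: effective_drift_def)

end

section \<open>Exponents of CBI processes\<close>

text \<open>With one-sided derivatives the mean value theorem is out of reach. Instead a line of
  slope \<open>e\<close> is subtracted: to the right of the last time \<open>c\<close> at which the
  result is nonpositive, all difference quotients of \<open>f\<close> up to \<open>T\<close> are at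
  least \<open>e\<close>, against derivative 0 at \<open>c\<close>.\<close>

lemma right_derivative_zero_imp_nonincreasing:
  fixes f :: "real \<Rightarrow> real"
  assumes cont: "continuous_on {0..} f"
    and deriv: "\<And>t. 0 \<le> t \<Longrightarrow> (f has_real_derivative 0) (at t within {t..})"
    and "0 \<le> T"
  shows "f T \<le> f 0"
proof (rule ccontr)
  assume less: "\<not> f T \<le> f 0"
  then have T: "0 < T" using assms(3) by (cases "T = 0") auto
  \<comment> \<open>Half the mean slope, so that \<open>h T\<close> stays positive.\<close>
  define e where "e = (f T - f 0) / (2 * T)"
  have e: "0 < e" using less T by (simp add: e_def)
  define h where "h t = f t - f 0 - e * t" for t
  have hT: "0 < h T" using less T by (simp add: h_def e_def field_simps)
  define S where "S = {t \<in> {0..T}. h t \<le> 0}"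
  have "continuous_on {0..T} h"
    unfolding h_def by (intro continuous_intros continuous_on_subset[OF cont]) auto
  then have "closed S"
    unfolding S_def by (intro continuous_on_closed_Collect_le) (auto intro!: continuous_intros)
  then have "compact S"
    using bounded_subset[OF bounded_closed_interval[of 0 T], of S]
    by (force simp: compact_eq_bounded_closed S_def)
  moreover have "0 \<in> S" using T by (simp add: S_def h_def)
  ultimately obtain c where c: "c \<in> S" "\<And>s. s \<in> S \<Longrightarrow> s \<le> c"
    using compact_attains_sup[of S] by blast
  have cT: "0 \<le> c" "c < T" using c(1) hT by (auto simp: S_def less_le)
  have "((\<lambda>s. (f s - f c) / (s - c)) \<longlongrightarrow> 0) (at_right c)"
    using deriv[OF cT(1)] by (simp add: has_field_derivative_iff at_within_Ici_at_right)
  moreover have "\<forall>\<^sub>F s in at_right c. e \<le> (f s - f c) / (s - c)"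
    using eventually_at_right_real[OF cT(2)]
  proof eventually_elim
    case (elim s)
    then have s: "c < s" "s < T" by auto
    have "s \<notin> S" using c(2)[of s] s by auto
    then have "0 < h s" using s cT by (auto simp: S_def)
    moreover have "h c \<le> 0" using c(1) by (simp add: S_def)
    ultimately have "e * (s - c) \<le> f s - f c" by (simp add: h_def algebra_simps)
    then show ?case using s by (simp add: pos_le_divide_eq)
  qed
  ultimately have "e \<le> 0" by (rule tendsto_lowerbound) simp
  with e show False by simp
qed

lemma right_derivative_zero_imp_constant:
  fixes f :: "real \<Rightarrow> real"
  assumes cont: "continuous_on {0..} f"
    and deriv: "\<And>t. 0 \<le> t \<Longrightarrow> (f has_real_derivative 0) (at t within {t..})"
    and "0 \<le> T"
  shows "f T = f 0"
proof (rule antisym)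
  show "f T \<le> f 0" by (rule right_derivative_zero_imp_nonincreasing[OF assms])
  have "- f T \<le> - f 0"
    using DERIV_minus[OF deriv] by (intro right_derivative_zero_imp_nonincreasing continuous_intros assms) auto
  then show "f 0 \<le> f T" by simp
qed

section \<open>The Chapman-Kolmogorov equation\<close>

context markov_process
begin

lemma space_P: "0 \<le> x \<Longrightarrow> space (P x) = space (P 0)"
  using sets_P sets_eq_imp_space_eq by blast

lemma measurable_X_P: "0 \<le> t \<Longrightarrow> 0 \<le> x \<Longrightarrow> X t \<in> borel_measurable (P x)"
  by (subst measurable_cong_sets[OF sets_P refl], assumption) (rule measurable_X)

text \<open>\<open>max y 0\<close> extends the kernel to negative states, where nothing is known of
  \<open>P\<close>, so that it is measurable on the whole line.\<close>

definition transition_kernel :: "real \<Rightarrow> real \<Rightarrow> real measure" where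
  "transition_kernel t y = distr (P (max y 0)) borel (X t)"

lemma prob_space_distr_X: "0 \<le> t \<Longrightarrow> 0 \<le> x \<Longrightarrow> prob_space (distr (P x) borel (X t))"
  by (intro prob_space.prob_space_distr prob_space_P measurable_X_P)

lemma transition_kernel_measurable:
  assumes t: "0 \<le> t"
  shows "transition_kernel t \<in> borel \<rightarrow>\<^sub>M subprob_algebra borel"
proof (rule measurable_subprob_algebra)
  have ps: "prob_space (transition_kernel t y)" for y
    unfolding transition_kernel_def using t by (intro prob_space_distr_X) auto
  show "subprob_space (transition_kernel t y)" for y
    by (rule prob_space_imp_subprob_space[OF ps])
  show "sets (transition_kernel t y) = sets borel" for y
    by (simp add: transition_kernel_def)
  fix A :: "real set" assume A: "A \<in> sets borel"
  have "(\<lambda>y. max y 0) \<in> borel \<rightarrow>\<^sub>M restrict_space borel {0::real..}"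
    by (rule measurable_restrict_space2) auto
  from measurable_compose[OF this measurable_transition[OF t A]]
  have "(\<lambda>y. measure (transition_kernel t y) A) \<in> borel_measurable borel"
    by (simp add: transition_kernel_def)
  then show "(\<lambda>y. emeasure (transition_kernel t y) A) \<in> borel_measurable borel"
    using finite_measure.emeasure_eq_measure[OF prob_space.finite_measure[OF ps]] by simp
qed

text \<open>Integrating the conditional expectation in the Markov property removes the conditioning
  and leaves the Chapman-Kolmogorov equation.\<close>

lemma distr_X_add:
  assumes x: "0 \<le> x" and s: "0 \<le> s" and t: "0 \<le> t"
  shows "distr (P x) borel (X (s + t)) = distr (P x) borel (X s) \<bind> transition_kernel t"
proof (rule measure_eqI)
  interpret prob_space "P x" using x by (rule prob_space_P)
  let ?N = "distr (P x) borel (X s)"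
  have K: "transition_kernel t \<in> ?N \<rightarrow>\<^sub>M subprob_algebra borel"
    using transition_kernel_measurable[OF t] by simp
  have ps: "prob_space (transition_kernel t y)" for y
    unfolding transition_kernel_def using t by (intro prob_space_distr_X) auto
  have Xm: "X r \<in> borel_measurable (P x)" if "0 \<le> r" for r
    by (rule measurable_X_P[OF that x])
  show "sets (distr (P x) borel (X (s + t))) = sets (?N \<bind> transition_kernel t)"
    by (subst sets_bind[where N=borel]) (auto simp: transition_kernel_def)
  fix A assume "A \<in> sets (distr (P x) borel (X (s + t)))"
  then have A: "A \<in> sets borel" by simp
  let ?F = "natural_filtration (P x) X s"
  have gen: "{X r -` B \<inter> space (P x) | r B. 0 \<le> r \<and> r \<le> s \<and> B \<in> sets borel} \<subseteq> sets (P x)"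
    using Xm by (auto intro!: measurable_sets)
  have "sets ?F \<subseteq> sets (P x)"
    unfolding natural_filtration_def
    by (subst sets_measure_of) (use gen sets.space_closed in blast, rule sets.sigma_sets_subset[OF gen])
  then have "subalgebra (P x) ?F"
    by (simp add: subalgebra_def natural_filtration_def space_measure_of_conv)
  then interpret sub: finite_measure_subalgebra "P x" ?F
    by unfold_locales
  have mA: "X (s + t) -` A \<inter> space (P x) \<in> sets (P x)"
    using A Xm[of "s + t"] s t by (auto intro!: measurable_sets)
  have int: "integrable (P x) (\<lambda>\<omega>. indicator A (X (s + t) \<omega>) :: real)"
    using A Xm[of "s + t"] s t
    by (intro integrable_const_bound[where B=1]) (auto intro!: measurable_compose[of _ _ borel] split: split_indicator)
  have Xpos: "\<omega> \<in> space (P x) \<Longrightarrow> max (X s \<omega>) 0 = X s \<omega>" for \<omega>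
    using nonneg_X[OF s] space_P[OF x] by (simp add: max_absorb1)
  have "emeasure (distr (P x) borel (X (s + t))) A = ennreal (\<integral>\<omega>. indicator A (X (s + t) \<omega>) \<partial>P x)"
  proof -
    have "(\<integral>\<omega>. indicator A (X (s + t) \<omega>) \<partial>P x) = (\<integral>\<omega>. indicator (X (s + t) -` A \<inter> space (P x)) \<omega> \<partial>P x)"
      by (rule Bochner_Integration.integral_cong) (auto split: split_indicator)
    also have "\<dots> = prob (X (s + t) -` A \<inter> space (P x))" using mA by simp
    finally show ?thesis using A Xm[of "s + t"] s t by (simp add: emeasure_distr emeasure_eq_measure)
  qed
  also have "(\<integral>\<omega>. indicator A (X (s + t) \<omega>) \<partial>P x) =
      (\<integral>\<omega>. real_cond_exp (P x) ?F (\<lambda>\<omega>'. indicator A (X (s + t) \<omega>')) \<omega> \<partial>P x)"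
    by (rule sub.real_cond_exp_int(2)[OF int, symmetric])
  also have "\<dots> = (\<integral>\<omega>. measure (transition_kernel t (X s \<omega>)) A \<partial>P x)"
  proof (rule integral_cong_AE)
    have "(\<lambda>y. measure (transition_kernel t y) A) \<in> borel_measurable borel"
      using measurable_measure_subprob_algebra[OF A] transition_kernel_measurable[OF t]
      by (rule measurable_compose[rotated])
    then show "(\<lambda>\<omega>. measure (transition_kernel t (X s \<omega>)) A) \<in> borel_measurable (P x)"
      using Xm[OF s] by (rule measurable_compose[rotated])
    show "AE \<omega> in P x. real_cond_exp (P x) ?F (\<lambda>\<omega>'. indicator A (X (s + t) \<omega>')) \<omega> =
        measure (transition_kernel t (X s \<omega>)) A"
      using markov_property[OF x s t A] AE_space
      by eventually_elim (simp add: transition_kernel_def Xpos)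
  qed auto
  also have "ennreal \<dots> = (\<integral>\<^sup>+\<omega>. emeasure (transition_kernel t (X s \<omega>)) A \<partial>P x)"
  proof -
    have m: "(\<lambda>y. measure (transition_kernel t y) A) \<in> borel_measurable borel"
      using measurable_measure_subprob_algebra[OF A] transition_kernel_measurable[OF t]
      by (rule measurable_compose[rotated])
    have "integrable (P x) (\<lambda>\<omega>. measure (transition_kernel t (X s \<omega>)) A)"
      using measurable_compose[OF Xm[OF s] m] prob_space.prob_le_1[OF ps]
      by (intro integrable_const_bound[where B=1]) auto
    then show ?thesis
      by (subst nn_integral_eq_integral[symmetric])
         (auto simp: finite_measure.emeasure_eq_measure[OF prob_space.finite_measure[OF ps]])
  qed
  also have "\<dots> = (\<integral>\<^sup>+y. emeasure (transition_kernel t y) A \<partial>?N)"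
    using measurable_emeasure_subprob_algebra[OF A] transition_kernel_measurable[OF t] Xm[OF s]
    by (subst nn_integral_distr) (auto intro: measurable_compose[rotated])
  also have "\<dots> = emeasure (?N \<bind> transition_kernel t) A"
    by (rule emeasure_bind[symmetric, OF _ K A]) simp
  finally show "emeasure (distr (P x) borel (X (s + t))) A = emeasure (?N \<bind> transition_kernel t) A" .
qed

end

section \<open>Affine exponents and their Riccati equations\<close>

locale CBI_process = markov_process P X for P :: "real \<Rightarrow> 'w measure" and X +
  fixes \<phi> \<psi> :: "real \<Rightarrow> real \<Rightarrow> real" and F R :: "real \<Rightarrow> real"
  assumes stoch_cont: "stochastically_continuous P X"
    and affine: "affine_exponents P X \<phi> \<psi>"
    and phi_deriv: "0 \<le> u \<Longrightarrow> ((\<lambda>t. \<phi> t u) has_real_derivative F u) (at 0 within {0..})"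
    and psi_deriv: "0 \<le> u \<Longrightarrow> ((\<lambda>t. \<psi> t u) has_real_derivative R u) (at 0 within {0..})"
begin

lemma exp_X_bounds:
  assumes "0 \<le> t" "0 \<le> u" "0 \<le> x" "\<omega> \<in> space (P x)"
  shows "0 < exp (- u * X t \<omega>)" "exp (- u * X t \<omega>) \<le> 1"
  using nonneg_X[of t \<omega>] space_P[of x] assms by auto

lemma integrable_exp_X:
  assumes "0 \<le> t" "0 \<le> u" "0 \<le> x"
  shows "integrable (P x) (\<lambda>\<omega>. exp (- u * X t \<omega>))"
proof -
  interpret prob_space "P x" using assms by (intro prob_space_P)
  have [measurable]: "X t \<in> borel_measurable (P x)" using assms by (intro measurable_X_P)
  show ?thesis
  proof (rule integrable_const_bound[where B=1])
    show "AE \<omega> in P x. norm (exp (- u * X t \<omega>)) \<le> 1"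
      using exp_X_bounds(2)[OF assms] by simp
  qed measurable
qed

text \<open>Since \<open>ln\<close> is total, the definition through \<open>- ln\<close> can be
  inverted only once the expectation is known to be positive.\<close>

lemma laplace_X:
  assumes "0 \<le> t" "0 \<le> u" "0 \<le> x"
  shows "(\<integral>\<omega>. exp (- u * X t \<omega>) \<partial>P x) = exp (- (\<phi> t u + x * \<psi> t u))"
proof -
  interpret prob_space "P x" using assms by (intro prob_space_P)
  let ?I = "\<integral>\<omega>. exp (- u * X t \<omega>) \<partial>P x"
  have "?I \<noteq> 0"
  proof
    assume "?I = 0"
    then have "AE \<omega> in P x. exp (- u * X t \<omega>) = 0"
      using integrable_exp_X[OF assms] by (subst (asm) integral_nonneg_eq_0_iff_AE) auto
    then show False by simp
  qed
  moreover have "0 \<le> ?I" by simp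
  ultimately have "0 < ?I" unfolding less_le by metis
  moreover have "- ln ?I = \<phi> t u + x * \<psi> t u"
    using affine assms by (simp add: affine_exponents_def)
  ultimately show ?thesis by (metis exp_ln minus_minus)
qed

lemma exponent_nonneg:
  assumes "0 \<le> t" "0 \<le> u" "0 \<le> x"
  shows "0 \<le> \<phi> t u + x * \<psi> t u"
proof -
  interpret prob_space "P x" using assms by (intro prob_space_P)
  have "(\<integral>\<omega>. exp (- u * X t \<omega>) \<partial>P x) \<le> (\<integral>\<omega>. 1 \<partial>P x)"
    by (intro integral_mono integrable_exp_X exp_X_bounds(2)[of t u x] assms) auto
  then show ?thesis
    unfolding laplace_X[OF assms] by (simp add: prob_space)
qed

lemma phi_nonneg: "0 \<le> t \<Longrightarrow> 0 \<le> u \<Longrightarrow> 0 \<le> \<phi> t u"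
  using exponent_nonneg[of t u 0] by simp

text \<open>A negative value would make the exponent negative for a large starting point; the
  \<open>x\<close> chosen makes it exactly -1.\<close>

lemma psi_nonneg:
  assumes "0 \<le> t" "0 \<le> u"
  shows "0 \<le> \<psi> t u"
proof (rule ccontr)
  assume "\<not> 0 \<le> \<psi> t u"
  then have neg: "\<psi> t u < 0" by simp
  define x where "x = (\<phi> t u + 1) / - \<psi> t u"
  have "0 \<le> x" unfolding x_def using phi_nonneg[OF assms] neg by (intro divide_nonneg_pos) auto
  moreover have "\<phi> t u + x * \<psi> t u = - 1" using neg by (simp add: x_def field_simps)
  ultimately show False using exponent_nonneg[OF assms, of x] by simp
qed

lemma initial_exponents:
  assumes "0 \<le> u"
  shows "\<phi> 0 u = 0" "\<psi> 0 u = u"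
proof -
  have "\<phi> 0 u + x * \<psi> 0 u = x * u" if "0 \<le> x" for x
  proof -
    interpret prob_space "P x" using that by (rule prob_space_P)
    have [measurable]: "X 0 \<in> borel_measurable (P x)" using that by (intro measurable_X_P) auto
    have "(\<integral>\<omega>. exp (- u * X 0 \<omega>) \<partial>P x) = (\<integral>\<omega>. exp (- u * x) \<partial>P x)"
      by (rule integral_cong_AE) (use start_X[OF that] in \<open>auto elim!: eventually_mono\<close>)
    then have "exp (- (\<phi> 0 u + x * \<psi> 0 u)) = exp (- u * x)"
      using laplace_X[of 0 u x] that assms by (simp add: prob_space)
    then show ?thesis by (simp add: algebra_simps)
  qed
  from this[of 0] this[of 1] show "\<phi> 0 u = 0" "\<psi> 0 u = u" by auto
qed

text \<open>The semigroup maps the exponential with parameter \<open>u\<close> to a multiple of the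
  one with parameter \<open>\<psi> t u\<close>. Both the semiflow property and the stationarity of
  the limit rest on this.\<close>

lemma integral_exp_X_add:
  assumes s: "0 \<le> s" and t: "0 \<le> t" and u: "0 \<le> u" and x: "0 \<le> x"
  shows "(\<integral>\<omega>. exp (- u * X (s + t) \<omega>) \<partial>P x) =
    exp (- \<phi> t u) * (\<integral>\<omega>. exp (- \<psi> t u * X s \<omega>) \<partial>P x)"
proof -
  let ?N = "distr (P x) borel (X s)"
  have Xm: "X r \<in> borel_measurable (P y)" if "0 \<le> r" "0 \<le> y" for r y
    using that by (rule measurable_X_P)
  have K: "transition_kernel t \<in> ?N \<rightarrow>\<^sub>M subprob_algebra borel"
    using transition_kernel_measurable[OF t] by simp
  have nn: "(\<integral>\<^sup>+\<omega>. ennreal (exp (- v * X r \<omega>)) \<partial>P y) = ennreal (exp (- (\<phi> r v + y * \<psi> r v)))"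
    if "0 \<le> r" "0 \<le> v" "0 \<le> y" for r v y
    using that laplace_X[of r v y] by (subst nn_integral_eq_integral[OF integrable_exp_X]) auto
  have "ennreal (\<integral>\<omega>. exp (- u * X (s + t) \<omega>) \<partial>P x) = (\<integral>\<^sup>+\<omega>. exp (- u * X (s + t) \<omega>) \<partial>P x)"
    using assms by (intro nn_integral_eq_integral[symmetric] integrable_exp_X) auto
  also have "\<dots> = (\<integral>\<^sup>+z. exp (- u * z) \<partial>distr (P x) borel (X (s + t)))"
    using Xm[of "s + t" x] assms by (subst nn_integral_distr) auto
  also have "\<dots> = (\<integral>\<^sup>+y. (\<integral>\<^sup>+z. exp (- u * z) \<partial>transition_kernel t y) \<partial>?N)"
    unfolding distr_X_add[OF x s t] by (rule nn_integral_bind[OF _ K]) measurable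
  also have "\<dots> = (\<integral>\<^sup>+y. ennreal (exp (- (\<phi> t u + max y 0 * \<psi> t u))) \<partial>?N)"
  proof (rule nn_integral_cong)
    fix y
    have "(\<integral>\<^sup>+z. exp (- u * z) \<partial>transition_kernel t y) =
        (\<integral>\<^sup>+\<omega>. ennreal (exp (- u * X t \<omega>)) \<partial>P (max y 0))"
      unfolding transition_kernel_def using t by (subst nn_integral_distr) (auto intro: Xm)
    then show "(\<integral>\<^sup>+z. exp (- u * z) \<partial>transition_kernel t y) =
        ennreal (exp (- (\<phi> t u + max y 0 * \<psi> t u)))"
      using nn[of t u "max y 0"] t u by simp
  qed
  also have "\<dots> = (\<integral>\<^sup>+\<omega>. ennreal (exp (- (\<phi> t u + max (X s \<omega>) 0 * \<psi> t u))) \<partial>P x)"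
    using Xm[OF s x] by (subst nn_integral_distr) auto
  also have "\<dots> = (\<integral>\<^sup>+\<omega>. ennreal (exp (- \<phi> t u)) * ennreal (exp (- \<psi> t u * X s \<omega>)) \<partial>P x)"
  proof (rule nn_integral_cong)
    fix \<omega> assume "\<omega> \<in> space (P x)"
    then have "max (X s \<omega>) 0 = X s \<omega>"
      using nonneg_X[OF s] space_P[OF x] by (simp add: max_absorb1)
    then show "ennreal (exp (- (\<phi> t u + max (X s \<omega>) 0 * \<psi> t u))) =
        ennreal (exp (- \<phi> t u)) * ennreal (exp (- \<psi> t u * X s \<omega>))"
      by (simp add: ennreal_mult[symmetric] exp_add[symmetric] mult.commute)
  qed
  also have "\<dots> = ennreal (exp (- \<phi> t u)) * ennreal (\<integral>\<omega>. exp (- \<psi> t u * X s \<omega>) \<partial>P x)"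
    using Xm[OF s x] integrable_exp_X[OF s psi_nonneg[OF t u] x]
    by (subst nn_integral_cmult) (auto simp: nn_integral_eq_integral)
  also have "\<dots> = ennreal (exp (- \<phi> t u) * (\<integral>\<omega>. exp (- \<psi> t u * X s \<omega>) \<partial>P x))"
    by (simp add: ennreal_mult[symmetric] integral_nonneg)
  finally show ?thesis
    by (subst (asm) ennreal_inj) (auto intro!: mult_nonneg_nonneg integral_nonneg)
qed

lemma semiflow:
  assumes "0 \<le> s" "0 \<le> t" "0 \<le> u"
  shows "\<phi> (t + s) u = \<phi> t u + \<phi> s (\<psi> t u)" "\<psi> (t + s) u = \<psi> s (\<psi> t u)"
proof -
  have "\<phi> (t + s) u + x * \<psi> (t + s) u = \<phi> t u + \<phi> s (\<psi> t u) + x * \<psi> s (\<psi> t u)" if "0 \<le> x" for x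
  proof -
    have "exp (- (\<phi> (t + s) u + x * \<psi> (t + s) u)) =
        exp (- \<phi> t u) * exp (- (\<phi> s (\<psi> t u) + x * \<psi> s (\<psi> t u)))"
      using integral_exp_X_add[OF assms that] laplace_X[of "s + t" u x]
        laplace_X[of s "\<psi> t u" x] psi_nonneg[OF assms(2,3)] assms that by (simp add: add.commute)
    then show ?thesis by (simp add: exp_add[symmetric])
  qed
  from this[of 0] this[of 1]
  show "\<phi> (t + s) u = \<phi> t u + \<phi> s (\<psi> t u)" "\<psi> (t + s) u = \<psi> s (\<psi> t u)" by auto
qed

text \<open>The semiflow property transports the derivatives at time 0 to time \<open>t\<close>, but
  only from the right. These are the Riccati equations.\<close>

lemma right_derivatives:
  assumes "0 \<le> t" "0 \<le> u"
  shows "((\<lambda>t. \<phi> t u) has_real_derivative F (\<psi> t u)) (at t within {t..})"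
    "((\<lambda>t. \<psi> t u) has_real_derivative R (\<psi> t u)) (at t within {t..})"
proof -
  have shift: "(+) t ` {0..} = {t..}"
    using image_add_atLeast[of t 0] by simp
  note nn = psi_nonneg[OF assms]
  have "((\<lambda>s. \<phi> (t + s) u) has_real_derivative F (\<psi> t u)) (at 0 within {0..})"
  proof (rule has_field_derivative_transform_within[where d=1 and f="\<lambda>s. \<phi> t u + \<phi> s (\<psi> t u)"])
    show "((\<lambda>s. \<phi> t u + \<phi> s (\<psi> t u)) has_real_derivative F (\<psi> t u)) (at 0 within {0..})"
      using phi_deriv[OF nn] by (auto intro!: derivative_eq_intros)
  qed (use semiflow assms in auto)
  then show "((\<lambda>t. \<phi> t u) has_real_derivative F (\<psi> t u)) (at t within {t..})"
    using DERIV_at_within_shift[of "\<lambda>t. \<phi> t u" _ t 0 "{0..}"] by (simp add: shift)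
  have "((\<lambda>s. \<psi> (t + s) u) has_real_derivative R (\<psi> t u)) (at 0 within {0..})"
    by (rule has_field_derivative_transform_within[where d=1 and f="\<lambda>s. \<psi> s (\<psi> t u)"])
       (use semiflow assms psi_deriv[OF nn] in auto)
  then show "((\<lambda>t. \<psi> t u) has_real_derivative R (\<psi> t u)) (at t within {t..})"
    using DERIV_at_within_shift[of "\<lambda>t. \<psi> t u" _ t 0 "{0..}"] by (simp add: shift)
qed

text \<open>Right derivatives give no continuity from the left; stochastic continuity does. Where
  the increment is small the exponential is Lipschitz with constant \<open>u\<close>, elsewhere the
  difference is at most 1.\<close>

lemma continuous_laplace_X:
  assumes "0 \<le> u" "0 \<le> x"
  shows "continuous_on {0..} (\<lambda>t. \<integral>\<omega>. exp (- u * X t \<omega>) \<partial>P x)"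
  unfolding continuous_on_def
proof
  fix t :: real assume "t \<in> {0..}"
  then have t: "0 \<le> t" by simp
  interpret prob_space "P x" using assms(2) by (rule prob_space_P)
  let ?D = "\<lambda>s e. {\<omega> \<in> space (P x). e \<le> \<bar>X s \<omega> - X t \<omega>\<bar>}"
  have bound: "\<bar>(\<integral>\<omega>. exp (- u * X s \<omega>) \<partial>P x) - (\<integral>\<omega>. exp (- u * X t \<omega>) \<partial>P x)\<bar> \<le>
      u * e + prob (?D s e)" if s: "0 \<le> s" and e: "0 < e" for s e
  proof -
    have [measurable]: "X s \<in> borel_measurable (P x)" "X t \<in> borel_measurable (P x)"
      using s t assms by (auto intro: measurable_X_P)
    note int = integrable_exp_X[OF _ assms]
    have D: "?D s e \<in> events" by measurable
    have "\<bar>(\<integral>\<omega>. exp (- u * X s \<omega>) \<partial>P x) - (\<integral>\<omega>. exp (- u * X t \<omega>) \<partial>P x)\<bar> =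
        \<bar>\<integral>\<omega>. exp (- u * X s \<omega>) - exp (- u * X t \<omega>) \<partial>P x\<bar>"
      using int[OF s] int[OF t] by simp
    also have "\<dots> \<le> (\<integral>\<omega>. \<bar>exp (- u * X s \<omega>) - exp (- u * X t \<omega>)\<bar> \<partial>P x)"
      by (rule integral_abs_bound)
    also have "\<dots> \<le> (\<integral>\<omega>. u * e + indicator (?D s e) \<omega> \<partial>P x)"
    proof (rule integral_mono)
      show "integrable (P x) (\<lambda>\<omega>. \<bar>exp (- u * X s \<omega>) - exp (- u * X t \<omega>)\<bar>)"
        using int[OF s] int[OF t] by simp
      show "integrable (P x) (\<lambda>\<omega>. u * e + indicator (?D s e) \<omega>)"
        using D by (simp add: less_top[symmetric])
      fix \<omega> assume \<omega>: "\<omega> \<in> space (P x)"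
      have ex: "0 < exp (- u * X s \<omega>)" "exp (- u * X s \<omega>) \<le> 1"
        "0 < exp (- u * X t \<omega>)" "exp (- u * X t \<omega>) \<le> 1"
        using exp_X_bounds assms s t \<omega> by blast+
      have lip: "exp (- a) - exp (- c) \<le> \<bar>a - c\<bar>" if "0 \<le> a" for a c :: real
      proof -
        have "exp (- a) * (1 - exp (a - c)) \<le> 1 * \<bar>a - c\<bar>"
        proof (cases "a \<le> c")
          case True
          then have "1 - exp (a - c) \<le> \<bar>a - c\<bar>"
            using exp_ge_add_one_self[of "a - c"] by linarith
          then show ?thesis using that True by (intro mult_mono) auto
        next
          case False
          then have "exp (- a) * (1 - exp (a - c)) \<le> 0" by (intro mult_nonneg_nonpos) auto
          then show ?thesis by (rule order_trans) simp
        qed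
        then show ?thesis by (simp add: right_diff_distrib exp_add[symmetric])
      qed
      have X_nn: "0 \<le> u * X s \<omega>" "0 \<le> u * X t \<omega>"
        using nonneg_X s t \<omega> space_P[OF assms(2)] assms(1) by auto
      show "\<bar>exp (- u * X s \<omega>) - exp (- u * X t \<omega>)\<bar> \<le> u * e + indicator (?D s e) \<omega>"
      proof (cases "\<omega> \<in> ?D s e")
        case True
        have "\<bar>exp (- u * X s \<omega>) - exp (- u * X t \<omega>)\<bar> \<le> 1" using ex by linarith
        moreover have "0 \<le> u * e" using assms e by simp
        ultimately show ?thesis using True by simp
      next
        case False
        then have "\<bar>X s \<omega> - X t \<omega>\<bar> \<le> e" using \<omega> by auto
        then have "u * \<bar>X s \<omega> - X t \<omega>\<bar> \<le> u * e" using assms by (intro mult_left_mono)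
        moreover have "\<bar>exp (- u * X s \<omega>) - exp (- u * X t \<omega>)\<bar> \<le> u * \<bar>X s \<omega> - X t \<omega>\<bar>"
          using lip[OF X_nn(1), of "u * X t \<omega>"] lip[OF X_nn(2), of "u * X s \<omega>"] assms(1)
          by (simp add: right_diff_distrib[symmetric] abs_mult abs_minus_commute abs_le_iff)
        ultimately show ?thesis using False by simp
      qed
    qed
    also have "\<dots> = u * e + prob (?D s e)"
      using D by (subst Bochner_Integration.integral_add) (auto simp: prob_space less_top[symmetric])
    finally show ?thesis .
  qed
  show "((\<lambda>t. \<integral>\<omega>. exp (- u * X t \<omega>) \<partial>P x) \<longlongrightarrow> (\<integral>\<omega>. exp (- u * X t \<omega>) \<partial>P x)) (at t within {0..})"
  proof (rule tendstoI)
    fix r :: real assume r: "0 < r"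
    \<comment> \<open>The denominator has \<open>u + 1\<close> so that u = 0 is covered.\<close>
    define e where "e = r / (2 * (u + 1))"
    have e: "0 < e" using r assms by (simp add: e_def add_nonneg_pos)
    have "u * e < r / 2"
      using r assms by (simp add: e_def field_simps)
    have "((\<lambda>s. prob (?D s e)) \<longlongrightarrow> 0) (at t within {0..})"
      using stoch_cont assms t e unfolding stochastically_continuous_def by blast
    from order_tendstoD(2)[OF this, of "r / 2"]
    have "\<forall>\<^sub>F s in at t within {0..}. prob (?D s e) < r / 2" using r by simp
    moreover have "\<forall>\<^sub>F s in at t within {0..}. s \<in> {0..}"
      by (simp add: eventually_at_filter)
    ultimately show "\<forall>\<^sub>F s in at t within {0..}.
        dist (\<integral>\<omega>. exp (- u * X s \<omega>) \<partial>P x) (\<integral>\<omega>. exp (- u * X t \<omega>) \<partial>P x) < r"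
    proof eventually_elim
      case (elim s)
      then show ?case using bound[of s e] e \<open>u * e < r / 2\<close> by (simp add: dist_real_def)
    qed
  qed
qed

lemma continuous_exponents:
  assumes "0 \<le> u"
  shows "continuous_on {0..} (\<lambda>t. \<phi> t u)" "continuous_on {0..} (\<lambda>t. \<psi> t u)"
proof -
  have *: "continuous_on {0..} (\<lambda>t. \<phi> t u + x * \<psi> t u)" if x: "0 \<le> x" for x
  proof -
    have "continuous_on {0..} (\<lambda>t. - ln (\<integral>\<omega>. exp (- u * X t \<omega>) \<partial>P x))"
      using laplace_X[OF _ assms x] by (intro continuous_intros continuous_laplace_X assms x) auto
    then show ?thesis
      by (rule continuous_on_cong[THEN iffD1, OF refl, rotated])
         (use affine assms x in \<open>auto simp: affine_exponents_def\<close>)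
  qed
  from *[of 0] show c: "continuous_on {0..} (\<lambda>t. \<phi> t u)" by simp
  have "continuous_on {0..} (\<lambda>t. (\<phi> t u + 1 * \<psi> t u) - \<phi> t u)"
    by (intro continuous_intros * c) simp
  then show "continuous_on {0..} (\<lambda>t. \<psi> t u)" by simp
qed

text \<open>\<open>\<phi>\<close> stays 0, so from 0 the mean of \<open>exp (- X t)\<close> is 1;
  being at most 1, the variable is 1 almost surely.\<close>

lemma degenerate_second_kind_if_F_zero:
  assumes "\<And>u. 0 \<le> u \<Longrightarrow> F u = 0"
  shows "degenerate_second_kind P X"
  unfolding degenerate_second_kind_def deterministic_from_def
proof (intro exI[of _ "\<lambda>_. 0"] allI impI)
  fix t :: real assume t: "0 \<le> t"
  interpret prob_space "P 0" by (rule prob_space_P) simp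
  have "\<phi> t 1 = \<phi> 0 1"
  proof (rule right_derivative_zero_imp_constant[OF continuous_exponents(1) _ t])
    show "((\<lambda>t. \<phi> t 1) has_real_derivative 0) (at s within {s..})" if "0 \<le> s" for s
      using right_derivatives(1)[OF that, of 1] assms[OF psi_nonneg[OF that]] by simp
  qed simp
  then have "(\<integral>\<omega>. exp (- 1 * X t \<omega>) \<partial>P 0) = 1"
    using laplace_X[OF t, of 1 0] initial_exponents[of 1] by simp
  then have "(\<integral>\<omega>. 1 - exp (- 1 * X t \<omega>) \<partial>P 0) = 0"
    using integrable_exp_X[OF t, of 1 0] by (simp add: prob_space)
  moreover have "AE \<omega> in P 0. 0 \<le> 1 - exp (- 1 * X t \<omega>)"
    using nonneg_X[OF t] by auto
  moreover have "integrable (P 0) (\<lambda>\<omega>. 1 - exp (- 1 * X t \<omega>))"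
    using integrable_exp_X[OF t, of 1 0] by simp
  ultimately have "AE \<omega> in P 0. 1 - exp (- 1 * X t \<omega>) = 0"
    using integral_nonneg_eq_0_iff_AE by blast
  then show "AE \<omega> in P 0. X t \<omega> = 0"
    by eventually_elim simp
qed

text \<open>For linear \<open>F\<close> and \<open>R\<close> the exponents are linear in \<open>u\<close>, so \<open>exp (- X t)\<close> has variance
  zero.\<close>

lemma degenerate_first_kind_if_linear:
  assumes F_lin: "\<And>u. 0 \<le> u \<Longrightarrow> F u = b * u" and R_lin: "\<And>u. 0 \<le> u \<Longrightarrow> R u = c * u"
  shows "degenerate_first_kind P X"
  unfolding degenerate_first_kind_def deterministic_from_def
proof (intro allI impI exI[of _ "\<lambda>t. \<phi> t 1 + x * \<psi> t 1" for x])
  fix x t :: real assume x: "0 \<le> x" and t: "0 \<le> t"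
  interpret prob_space "P x" using x by (rule prob_space_P)
  \<comment> \<open>The defect of linearity of \<open>\<psi>\<close> between u = 1 and u = 2. It
    solves d' = c d with d 0 = 0, so \<open>exp (- c * s) * d s\<close> is constant.\<close>
  define d where "d t = \<psi> t 2 - 2 * \<psi> t 1" for t
  have d_deriv: "(d has_real_derivative c * d s) (at s within {s..})" if "0 \<le> s" for s
    unfolding d_def using right_derivatives(2)[OF that, of 1] right_derivatives(2)[OF that, of 2]
      R_lin psi_nonneg that
    by (auto intro!: derivative_eq_intros simp: algebra_simps)
  have d_zero: "d s = 0" if s: "0 \<le> s" for s
  proof -
    have "exp (- c * s) * d s = exp (- c * 0) * d 0"
    proof (rule right_derivative_zero_imp_constant[OF _ _ s])
      show "continuous_on {0..} (\<lambda>s. exp (- c * s) * d s)"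
        unfolding d_def by (intro continuous_intros continuous_exponents) auto
      show "((\<lambda>s. exp (- c * s) * d s) has_real_derivative 0) (at r within {r..})" if "0 \<le> r" for r
        using d_deriv[OF that] by (auto intro!: derivative_eq_intros)
    qed
    then show ?thesis using initial_exponents[of 1] initial_exponents[of 2] by (simp add: d_def)
  qed
  have "\<phi> t 2 - 2 * \<phi> t 1 = \<phi> 0 2 - 2 * \<phi> 0 1"
  proof (rule right_derivative_zero_imp_constant[OF _ _ t])
    show "continuous_on {0..} (\<lambda>t. \<phi> t 2 - 2 * \<phi> t 1)"
      by (intro continuous_intros continuous_exponents) auto
    fix s :: real assume s: "0 \<le> s"
    have "((\<lambda>t. \<phi> t 2 - 2 * \<phi> t 1) has_real_derivative b * d s) (at s within {s..})"
      unfolding d_def using right_derivatives(1)[OF s, of 1] right_derivatives(1)[OF s, of 2]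
        F_lin psi_nonneg s
      by (auto intro!: derivative_eq_intros simp: algebra_simps)
    then show "((\<lambda>t. \<phi> t 2 - 2 * \<phi> t 1) has_real_derivative 0) (at s within {s..})"
      using d_zero[OF s] by simp
  qed
  then have phi2: "\<phi> t 2 = 2 * \<phi> t 1"
    using initial_exponents[of 1] initial_exponents[of 2] by simp
  have psi2: "\<psi> t 2 = 2 * \<psi> t 1" using d_zero[OF t] by (simp add: d_def)
  define f where "f = \<phi> t 1 + x * \<psi> t 1"
  have E1: "(\<integral>\<omega>. exp (- 1 * X t \<omega>) \<partial>P x) = exp (- f)"
    using laplace_X[OF t, of 1 x] x by (simp add: f_def)
  have E2: "(\<integral>\<omega>. exp (- 2 * X t \<omega>) \<partial>P x) = exp (- 2 * f)"
    using laplace_X[OF t, of 2 x] x phi2 psi2 by (simp add: f_def algebra_simps)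
  have i1: "integrable (P x) (\<lambda>\<omega>. exp (- 1 * X t \<omega>))" and i2: "integrable (P x) (\<lambda>\<omega>. exp (- 2 * X t \<omega>))"
    using integrable_exp_X[OF t _ x, of 1] integrable_exp_X[OF t _ x, of 2] by simp_all
  have sq: "(exp (- 1 * X t \<omega>) - exp (- f))\<^sup>2 =
      exp (- 2 * X t \<omega>) - 2 * exp (- f) * exp (- 1 * X t \<omega>) + exp (- 2 * f)" for \<omega>
  proof -
    have "(exp (- 1 * X t \<omega>))\<^sup>2 = exp (- 2 * X t \<omega>)" "(exp (- f))\<^sup>2 = exp (- 2 * f)"
      by (simp_all add: power2_eq_square exp_add[symmetric])
    then show ?thesis by (simp only: power2_diff mult_ac)
  qed
  have int_sq: "integrable (P x) (\<lambda>\<omega>. (exp (- 1 * X t \<omega>) - exp (- f))\<^sup>2)"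
    unfolding sq using i1 i2 by (intro Bochner_Integration.integrable_add Bochner_Integration.integrable_diff integrable_mult_right) auto
  have "(\<integral>\<omega>. (exp (- 1 * X t \<omega>) - exp (- f))\<^sup>2 \<partial>P x) =
      exp (- 2 * f) - 2 * exp (- f) * exp (- f) + exp (- 2 * f)"
    unfolding sq using i1 i2 E1 E2 by (simp add: prob_space)
  also have "\<dots> = 0" by (simp add: exp_add[symmetric])
  finally have "AE \<omega> in P x. (exp (- 1 * X t \<omega>) - exp (- f))\<^sup>2 = 0"
    using integral_nonneg_eq_0_iff_AE[OF int_sq] by auto
  then show "AE \<omega> in P x. X t \<omega> = \<phi> t 1 + x * \<psi> t 1"
    by eventually_elim (simp add: f_def)
qed

end

section \<open>Stationary distributions\<close>

text \<open>Holds the two sides of the branching term together: \<alpha> x L(dx), not known to have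
  a Lebesgue density, and a measure that has one. Meaningful when both arguments have the same
  sigma-algebra.\<close>

definition add_measure :: "'a measure \<Rightarrow> 'a measure \<Rightarrow> 'a measure" where
  "add_measure M N = measure_of (space M) (sets M) (\<lambda>A. emeasure M A + emeasure N A)"

lemma sets_add_measure [simp, measurable_cong]: "sets (add_measure M N) = sets M"
  by (simp add: add_measure_def)

lemma space_add_measure [simp]: "space (add_measure M N) = space M"
  by (simp add: add_measure_def space_measure_of_conv)

lemma emeasure_add_measure:
  assumes "sets M = sets N" "A \<in> sets M"
  shows "emeasure (add_measure M N) A = emeasure M A + emeasure N A"
proof (rule emeasure_measure_of[OF add_measure_def])
  show "positive (sets (add_measure M N)) (\<lambda>A. emeasure M A + emeasure N A)"
    by (simp add: positive_def)
  show "countably_additive (sets (add_measure M N)) (\<lambda>A. emeasure M A + emeasure N A)"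
  proof (rule countably_additiveI)
    fix B :: "nat \<Rightarrow> 'a set"
    assume B: "range B \<subseteq> sets (add_measure M N)" "disjoint_family B"
    then have "(\<Sum>i. emeasure M (B i)) = emeasure M (\<Union>i. B i)"
      "(\<Sum>i. emeasure N (B i)) = emeasure N (\<Union>i. B i)"
      using assms(1) by (auto intro!: suminf_emeasure)
    then show "(\<Sum>i. emeasure M (B i) + emeasure N (B i)) = emeasure M (\<Union>i. B i) + emeasure N (\<Union>i. B i)"
      by (simp add: suminf_add[symmetric])
  qed
qed (use assms sets.space_closed in auto)

lemma nn_integral_add_measure:
  assumes sets: "sets M = sets N" and f: "f \<in> borel_measurable M"
  shows "(\<integral>\<^sup>+x. f x \<partial>add_measure M N) = (\<integral>\<^sup>+x. f x \<partial>M) + (\<integral>\<^sup>+x. f x \<partial>N)"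
proof -
  have mN: "borel_measurable N = (borel_measurable M :: ('a \<Rightarrow> ennreal) set)"
    by (rule measurable_cong_sets[OF sets[symmetric] refl])
  have mA: "borel_measurable (add_measure M N) = (borel_measurable M :: ('a \<Rightarrow> ennreal) set)"
    by (rule measurable_cong_sets) simp_all
  from f show ?thesis
  proof (induct rule: borel_measurable_induct)
    case (cong f g)
    have "space M = space N" using sets by (rule sets_eq_imp_space_eq)
    then have "(\<integral>\<^sup>+x. f x \<partial>M) = (\<integral>\<^sup>+x. g x \<partial>M)" "(\<integral>\<^sup>+x. f x \<partial>N) = (\<integral>\<^sup>+x. g x \<partial>N)"
      "(\<integral>\<^sup>+x. f x \<partial>add_measure M N) = (\<integral>\<^sup>+x. g x \<partial>add_measure M N)"
      using cong(3) by (auto intro!: nn_integral_cong)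
    with cong(4) show ?case by simp
  next
    case (set A)
    then show ?case using sets by (simp add: emeasure_add_measure)
  next
    case (mult u c)
    then have "u \<in> borel_measurable N" "u \<in> borel_measurable (add_measure M N)"
      by (simp_all add: mN mA)
    with mult show ?case by (simp add: nn_integral_cmult distrib_left)
  next
    case (add u v)
    then have "u \<in> borel_measurable N" "u \<in> borel_measurable (add_measure M N)"
      "v \<in> borel_measurable N" "v \<in> borel_measurable (add_measure M N)"
      by (simp_all add: mN mA)
    with add show ?case by (simp add: nn_integral_add add_ac)
  next
    case (seq U)
    then have m: "U i \<in> borel_measurable N" "U i \<in> borel_measurable (add_measure M N)" for i
      by (simp_all add: mN mA)
    have inc: "incseq (\<lambda>i. \<integral>\<^sup>+x. U i x \<partial>Q)" for Q
      using \<open>incseq U\<close> by (auto simp: incseq_def le_fun_def intro!: nn_integral_mono)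
    have "(\<integral>\<^sup>+x. (SUP i. U i) x \<partial>add_measure M N) = (SUP i. \<integral>\<^sup>+x. U i x \<partial>add_measure M N)"
      using m seq by (simp add: nn_integral_monotone_convergence_SUP image_comp)
    also have "\<dots> = (SUP i. (\<integral>\<^sup>+x. U i x \<partial>M) + (\<integral>\<^sup>+x. U i x \<partial>N))"
      using seq by simp
    also have "\<dots> = (SUP i. \<integral>\<^sup>+x. U i x \<partial>M) + (SUP i. \<integral>\<^sup>+x. U i x \<partial>N)"
      by (rule ennreal_SUP_add[OF inc inc])
    also have "\<dots> = (\<integral>\<^sup>+x. (SUP i. U i) x \<partial>M) + (\<integral>\<^sup>+x. (SUP i. U i) x \<partial>N)"
      using m seq by (simp add: nn_integral_monotone_convergence_SUP image_comp)
    finally show ?case .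
  qed
qed

section \<open>Distributions on the half-line: transforms, tilted means, gaps of the support\<close>

locale nonneg_distribution = real_distribution L for L +
  assumes negative_null: "emeasure L {..<0} = 0"
begin

lemma AE_nonneg: "AE x in L. 0 \<le> x"
  by (rule AE_I[of _ _ "{..<0}"]) (use negative_null in auto)

definition laplace :: "real \<Rightarrow> real" where
  "laplace u = (\<integral>x. exp (- u * x) \<partial>L)"

definition laplace_moment :: "real \<Rightarrow> real" where
  "laplace_moment u = (\<integral>x. x * exp (- u * x) \<partial>L)"

lemma integrable_laplace: "0 \<le> u \<Longrightarrow> integrable L (\<lambda>x. exp (- u * x))"
  by (rule integrable_const_bound[where B=1]) (use AE_nonneg in \<open>auto elim!: eventually_mono\<close>)

lemma mult_exp_le:
  fixes x u :: real
  assumes "0 < u"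
  shows "x * exp (- u * x) \<le> 1 / u"
proof -
  have "u * x \<le> exp (u * x)" using exp_ge_add_one_self[of "u * x"] by linarith
  then have "u * x * exp (- u * x) \<le> exp (u * x) * exp (- u * x)" by (intro mult_right_mono) auto
  also have "\<dots> = 1" by (simp add: exp_add[symmetric])
  finally show ?thesis using assms by (simp add: field_simps)
qed

lemma integrable_laplace_moment:
  assumes "0 < u"
  shows "integrable L (\<lambda>x. x * exp (- u * x))"
proof (rule integrable_const_bound[where B="1 / u"])
  show "AE x in L. norm (x * exp (- u * x)) \<le> 1 / u"
    using AE_nonneg
  proof eventually_elim
    case (elim x)
    have "norm (x * exp (- u * x)) = x * exp (- u * x)" using elim by simp
    then show ?case using mult_exp_le[OF assms, of x] by simp
  qed
qed measurable

lemma laplace_pos: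
  assumes "0 \<le> u"
  shows "0 < laplace u"
proof -
  have "laplace u \<noteq> 0"
  proof
    assume "laplace u = 0"
    then have "AE x in L. exp (- u * x) = 0"
      unfolding laplace_def
      using integrable_laplace[OF assms] by (subst (asm) integral_nonneg_eq_0_iff_AE) auto
    then show False by simp
  qed
  moreover have "0 \<le> laplace u" unfolding laplace_def by simp
  ultimately show ?thesis by linarith
qed

lemma laplace_moment_nonneg: "0 \<le> laplace_moment u"
  unfolding laplace_moment_def
  by (rule integral_nonneg_AE) (use AE_nonneg in \<open>auto elim!: eventually_mono\<close>)

text \<open>Difference quotients at points above \<open>u / 2\<close> are dominated by
  \<open>x * exp (- (u / 2) * x)\<close>, which is integrable without any moment of
  \<open>L\<close>.\<close>

lemma laplace_has_derivative:
  assumes u: "0 < u"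
  shows "(laplace has_real_derivative - laplace_moment u) (at u)"
proof -
  have "((\<lambda>v. (laplace v - laplace u) / (v - u)) \<longlongrightarrow> - laplace_moment u) (at u within {u / 2<..})"
    unfolding tendsto_at_iff_sequentially comp_def
  proof (intro allI impI)
    fix V :: "nat \<Rightarrow> real"
    assume V: "\<forall>i. V i \<in> {u / 2<..} - {u}" and lim: "V \<longlonglongrightarrow> u"
    have Vpos: "0 < V i" for i using V u by (auto intro: less_trans[of 0 "u / 2"])
    have V_at: "filterlim V (at u) sequentially"
      using V lim by (auto simp: filterlim_at)
    have "(laplace (V i) - laplace u) / (V i - u) =
        (\<integral>x. (exp (- V i * x) - exp (- u * x)) / (V i - u) \<partial>L)" for i
      unfolding laplace_def
      using integrable_laplace[of "V i"] integrable_laplace[of u] Vpos[of i] u by simp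
    moreover have "(\<lambda>i. \<integral>x. (exp (- V i * x) - exp (- u * x)) / (V i - u) \<partial>L) \<longlonglongrightarrow>
        (\<integral>x. - (x * exp (- u * x)) \<partial>L)"
    proof (rule integral_dominated_convergence)
      show "integrable L (\<lambda>x. x * exp (- (u / 2) * x))"
        using u by (intro integrable_laplace_moment) simp
      show "AE x in L. (\<lambda>i. (exp (- V i * x) - exp (- u * x)) / (V i - u)) \<longlonglongrightarrow> - (x * exp (- u * x))"
      proof (rule AE_I2)
        fix x
        have "((\<lambda>v. exp (- v * x)) has_real_derivative - (x * exp (- u * x))) (at u)"
          by (auto intro!: derivative_eq_intros)
        then show "(\<lambda>i. (exp (- V i * x) - exp (- u * x)) / (V i - u)) \<longlonglongrightarrow> - (x * exp (- u * x))"
          unfolding has_field_derivative_iff by (rule filterlim_compose[OF _ V_at])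
      qed
      show "AE x in L. norm ((exp (- V i * x) - exp (- u * x)) / (V i - u)) \<le> x * exp (- (u / 2) * x)" for i
        using AE_nonneg
      proof eventually_elim
        case (elim x)
        have "norm (exp (- V i * x) - exp (- u * x)) \<le> (x * exp (- (u / 2) * x)) * norm (V i - u)"
        proof (rule field_differentiable_bound[where S="{u / 2<..}"])
          fix z assume "z \<in> {u / 2<..}"
          then show "norm (- x * exp (- z * x)) \<le> x * exp (- (u / 2) * x)"
            using elim by (auto simp: abs_mult intro!: mult_left_mono) (use mult_right_mono[of u "2 * z" x] in auto)
          show "((\<lambda>v. exp (- v * x)) has_field_derivative - x * exp (- z * x)) (at z within {u / 2<..})"
            by (auto intro!: derivative_eq_intros)
        qed (use V u in \<open>auto simp: less_eq_real_def\<close>)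
        then show ?case using V by (auto simp: field_simps)
      qed
    qed measurable
    ultimately show "(\<lambda>i. (laplace (V i) - laplace u) / (V i - u)) \<longlonglongrightarrow> - laplace_moment u"
      unfolding laplace_moment_def by (simp only: Bochner_Integration.integral_minus)
  qed
  then have "(laplace has_real_derivative - laplace_moment u) (at u within {u / 2<..})"
    by (simp add: has_field_derivative_iff)
  then show ?thesis using u by (simp add: at_within_open[of u "{u / 2<..}"])
qed

lemma nn_integral_laplace: "0 \<le> u \<Longrightarrow> (\<integral>\<^sup>+x. ennreal (exp (- u * x)) \<partial>L) = ennreal (laplace u)"
  unfolding laplace_def by (rule nn_integral_eq_integral[OF integrable_laplace]) auto

lemma nn_integral_laplace_moment:
  assumes "0 < u"
  shows "(\<integral>\<^sup>+x. ennreal x * ennreal (exp (- u * x)) \<partial>L) = ennreal (laplace_moment u)"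
proof -
  have "(\<integral>\<^sup>+x. ennreal x * ennreal (exp (- u * x)) \<partial>L) = (\<integral>\<^sup>+x. ennreal (x * exp (- u * x)) \<partial>L)"
    by (intro nn_integral_cong) (simp add: ennreal_mult'')
  also have "\<dots> = ennreal (laplace_moment u)"
    unfolding laplace_moment_def
    by (rule nn_integral_eq_integral[OF integrable_laplace_moment[OF assms]])
       (use AE_nonneg in \<open>auto elim!: eventually_mono\<close>)
  finally show ?thesis .
qed

text \<open>The tilted mean \<open>laplace_moment u / laplace u\<close> tends to the left end point of the support.\<close>

lemma tilted_mean_ge:
  assumes "emeasure L {..p} = 0" "0 < u"
  shows "p * laplace u \<le> laplace_moment u"
proof -
  have "AE x in L. p < x"
    by (rule AE_I[of _ _ "{..p}"]) (use assms(1) in auto)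
  then have "(\<integral>x. p * exp (- u * x) \<partial>L) \<le> laplace_moment u"
    unfolding laplace_moment_def using assms(2)
    by (intro integral_mono_AE integrable_mult_right integrable_laplace integrable_laplace_moment)
       (auto elim!: eventually_mono)
  then show ?thesis by (simp add: laplace_def)
qed

text \<open>After multiplication by \<open>exp (u * r)\<close> the difference is the mean of
  \<open>(x - r) * exp (- u * (x - r))\<close>. This is nowhere above 1 / u, while on
  \<open>{..q}\<close> it is at most \<open>- d * exp (u * d)\<close>; the latter, with mass
  \<open>c\<close>, wins as u grows.\<close>

lemma tilted_mean_eventually_less:
  assumes q: "0 < measure L {..q}" and r: "q < r"
  shows "\<forall>\<^sub>F u in at_top. laplace_moment u < r * laplace u"
proof -
  define d where "d = r - q"
  define c where "c = measure L {..q}"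
  have dc: "0 < d" "0 < c" using assms by (auto simp: d_def c_def)
  have ev: "\<forall>\<^sub>F u in at_top. 1 / u < d * c * exp (u * d)" using dc by real_asymp
  show ?thesis using ev eventually_gt_at_top[of 0]
  proof eventually_elim
    case (elim u)
    then have u: "0 < u" by simp
    have "(laplace_moment u - r * laplace u) * exp (u * r) =
        (\<integral>x. x * exp (- u * x) - r * exp (- u * x) \<partial>L) * exp (u * r)"
      unfolding laplace_moment_def laplace_def
      using integrable_laplace[of u] integrable_laplace_moment[OF u] u by simp
    also have "\<dots> = (\<integral>x. (x * exp (- u * x) - r * exp (- u * x)) * exp (u * r) \<partial>L)" by simp
    also have "\<dots> = (\<integral>x. (x - r) * exp (- u * (x - r)) \<partial>L)"
      by (intro Bochner_Integration.integral_cong refl)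
         (simp add: left_diff_distrib exp_add[symmetric] mult.assoc right_diff_distrib exp_diff exp_minus field_simps)
    also have "\<dots> \<le> (\<integral>x. 1 / u - d * exp (u * d) * indicator {..q} x \<partial>L)"
    proof (rule integral_mono)
      have "integrable L (\<lambda>x. (x * exp (- u * x) - r * exp (- u * x)) * exp (u * r))"
        using integrable_laplace[of u] integrable_laplace_moment[OF u] u
        by (intro integrable_mult_left Bochner_Integration.integrable_diff integrable_mult_right) auto
      also have "(\<lambda>x. (x * exp (- u * x) - r * exp (- u * x)) * exp (u * r)) =
          (\<lambda>x. (x - r) * exp (- u * (x - r)))"
        by (rule ext)
           (simp add: left_diff_distrib exp_add[symmetric] mult.assoc right_diff_distrib exp_diff exp_minus field_simps)
      finally show "integrable L (\<lambda>x. (x - r) * exp (- u * (x - r)))" .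
      show "integrable L (\<lambda>x. 1 / u - d * exp (u * d) * indicator {..q} x)"
        by (intro Bochner_Integration.integrable_diff integrable_mult_right) (auto simp: less_top[symmetric])
      fix x
      show "(x - r) * exp (- u * (x - r)) \<le> 1 / u - d * exp (u * d) * indicator {..q} x"
      proof (cases "x \<le> q")
        case True
        have "d * exp (u * d) \<le> (r - x) * exp (u * (r - x))"
          using True dc u by (intro mult_mono) (auto simp: d_def)
        moreover have "(x - r) * exp (- u * (x - r)) = - ((r - x) * exp (u * (r - x)))"
          by (simp add: algebra_simps)
        moreover have "0 \<le> 1 / u" using u by simp
        moreover have ind: "indicator {..q} x = (1::real)" using True by simp
        ultimately show ?thesis unfolding ind mult_1_right by linarith
      next
        case False
        then show ?thesis using mult_exp_le[OF u, of "x - r"] by simp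
      qed
    qed
    also have "\<dots> = 1 / u - d * c * exp (u * d)"
      by (subst Bochner_Integration.integral_diff) (auto simp: c_def less_top[symmetric] prob_space[unfolded space_eq_univ])
    also have "\<dots> < 0" using elim by simp
    finally show ?case by (simp add: mult_less_0_iff)
  qed
qed

lemma measure_support_iff:
  "x \<in> measure_support L \<longleftrightarrow> (\<forall>e>0. 0 < emeasure L {x - e<..<x + e})"
proof
  assume "x \<in> measure_support L"
  then show "\<forall>e>0. 0 < emeasure L {x - e<..<x + e}"
    unfolding measure_support_def by auto
next
  assume *: "\<forall>e>0. 0 < emeasure L {x - e<..<x + e}"
  show "x \<in> measure_support L"
    unfolding measure_support_def
  proof (clarify)
    fix U :: "real set" assume U: "open U" "x \<in> U"
    then obtain e where e: "0 < e" "{x - e<..<x + e} \<subseteq> U"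
      by (metis open_contains_ball ball_eq_greaterThanLessThan)
    have "0 < emeasure L {x - e<..<x + e}" using * e by blast
    also have "\<dots> \<le> emeasure L U" using U e by (intro emeasure_mono) auto
    finally show "0 < emeasure L U" .
  qed
qed

text \<open>\<open>a\<close> is the infimum of all y for which \<open>{y<..p}\<close> is null. The
  mass below \<open>p\<close> bounds that set from below, and minimality forces mass in every left
  neighbourhood of \<open>a\<close>, possibly as an atom at \<open>a\<close>.\<close>

lemma obtain_support_gap:
  assumes mass: "0 < emeasure L {..p}" and p: "p \<notin> measure_support L"
  obtains a where "0 \<le> a" "a < p" "emeasure L {a<..p} = 0" "\<And>d. 0 < d \<Longrightarrow> 0 < emeasure L {a - d<..a}"
proof -
  obtain e where e: "0 < e" "emeasure L {p - e<..<p + e} = 0"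
    using p by (auto simp: measure_support_iff zero_less_iff_neq_zero)
  define A where "A = {y. y \<le> p \<and> emeasure L {y<..p} = 0}"
  have mono: "emeasure L {x<..p} \<le> emeasure L {y<..p}" if "y \<le> x" for x y
    using that by (intro emeasure_mono) auto
  have "emeasure L {p - e<..p} \<le> emeasure L {p - e<..<p + e}"
    using e by (intro emeasure_mono) auto
  then have pA: "p - e \<in> A" using e by (simp add: A_def)
  have "\<exists>n::nat. emeasure L {p - real n<..p} \<noteq> 0"
  proof (rule ccontr)
    assume "\<not> (\<exists>n::nat. emeasure L {p - real n<..p} \<noteq> 0)"
    then have "emeasure L (\<Union>n::nat. {p - real n<..p}) = 0"
      by (intro emeasure_UN_eq_0) auto
    moreover have "(\<Union>n::nat. {p - real n<..p}) = {..p}"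
    proof -
      have "\<exists>n::nat. p - real n < y" for y
        using reals_Archimedean2[of "p - y"] by (auto simp: algebra_simps)
      then show ?thesis by auto
    qed
    ultimately show False using mass by simp
  qed
  then obtain n :: nat where n: "emeasure L {p - real n<..p} \<noteq> 0" by blast
  have bdd: "bdd_below A"
  proof
    fix y assume "y \<in> A"
    then show "p - real n \<le> y" using n mono[of y "p - real n"] by (force simp: A_def)
  qed
  define a where "a = Inf A"
  have a_le: "a \<le> p - e" unfolding a_def by (rule cInf_lower[OF pA bdd])
  have null: "emeasure L {a<..p} = 0"
  proof -
    have "emeasure L {a + 1 / real (Suc i)<..p} = 0" for i
    proof -
      have "Inf A < a + 1 / real (Suc i)" by (simp add: a_def)
      then obtain y where "y \<in> A" "y < a + 1 / real (Suc i)"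
        using cInf_lessD[of A] pA by blast
      then show ?thesis using mono[of y "a + 1 / real (Suc i)"] by (simp add: A_def)
    qed
    then have "emeasure L (\<Union>i. {a + 1 / real (Suc i)<..p}) = 0"
      by (intro emeasure_UN_eq_0) auto
    moreover have "{a<..p} = (\<Union>i. {a + 1 / real (Suc i)<..p})"
    proof (intro equalityI subsetI)
      fix y assume y: "y \<in> {a<..p}"
      then have "0 < y - a" by simp
      then obtain i where "1 / real (Suc i) < y - a" by (rule nat_approx_posE)
      then show "y \<in> (\<Union>i. {a + 1 / real (Suc i)<..p})"
        using y by (intro UN_I[of i]) (auto simp: algebra_simps)
    next
      fix y assume "y \<in> (\<Union>i. {a + 1 / real (Suc i)<..p})"
      then obtain i where i: "a + 1 / real (Suc i) < y" "y \<le> p" by auto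
      have "a < a + 1 / real (Suc i)" by simp
      then have "a < y" using i(1) by (rule less_trans)
      then show "y \<in> {a<..p}" using i by simp
    qed
    ultimately show ?thesis by simp
  qed
  have pos: "0 < emeasure L {a - d<..a}" if "0 < d" for d
  proof -
    have "a - d \<notin> A" using cInf_lower[OF _ bdd, of "a - d"] that by (auto simp: a_def)
    then have "0 < emeasure L {a - d<..p}"
      using a_le that e by (auto simp: A_def zero_less_iff_neq_zero)
    also have "{a - d<..p} = {a - d<..a} \<union> {a<..p}"
      using a_le that e by auto
    also have "emeasure L \<dots> \<le> emeasure L {a - d<..a} + emeasure L {a<..p}"
      by (rule emeasure_subadditive) auto
    finally show ?thesis using null by simp
  qed
  have "0 \<le> a"
  proof (rule ccontr)
    assume "\<not> 0 \<le> a"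
    then have "emeasure L {a - 1<..a} \<le> emeasure L {..<0}" by (intro emeasure_mono) auto
    with pos[of 1] negative_null show False by simp
  qed
  with a_le e null pos show thesis by (intro that[of a]) auto
qed

end

lemma limit_distribution_nonneg:
  "limit_distribution P X L \<Longrightarrow> nonneg_distribution L"
  unfolding limit_distribution_def nonneg_distribution_def nonneg_distribution_axioms_def
    real_distribution_def real_distribution_axioms_def by simp

section \<open>Stationarity of the limit\<close>

context CBI_process
begin

lemma laplace_limit:
  assumes L: "limit_distribution P X L" and s: "\<And>n. 0 \<le> s n" "filterlim s at_top sequentially"
    and u: "0 \<le> u"
  shows "(\<lambda>n. \<integral>\<omega>. exp (- u * X (s n) \<omega>) \<partial>P 0) \<longlonglongrightarrow> nonneg_distribution.laplace L u"
proof -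
  interpret L: nonneg_distribution L by (rule limit_distribution_nonneg[OF L])
  interpret P0: prob_space "P 0" by (rule prob_space_P) simp
  have Xm: "X (s n) \<in> borel_measurable (P 0)" for n
    using s(1) by (intro measurable_X_P) auto
  \<comment> \<open>Weak convergence tests functions on the whole line; \<open>max x 0\<close> makes
    the exponential bounded there without changing it on the half-line.\<close>
  define f where "f x = exp (- u * max x 0)" for x :: real
  have [measurable]: "f \<in> borel_measurable borel" unfolding f_def by measurable
  have "weak_conv_m (\<lambda>n. distr (P 0) borel (X (s n))) L"
    using L s unfolding limit_distribution_def by simp
  then have "(\<lambda>n. integral\<^sup>L (distr (P 0) borel (X (s n))) f) \<longlonglongrightarrow> integral\<^sup>L L f"
  proof (rule weak_conv_imp_integral_bdd_continuous_conv[rotated 2])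
    show "real_distribution (distr (P 0) borel (X (s n)))" for n
      using Xm by (intro P0.real_distribution_distr) simp
    show "real_distribution L" by unfold_locales
    show "isCont f x" for x unfolding f_def by (intro continuous_intros)
    show "norm (f x) \<le> 1" for x using u by (simp add: f_def)
  qed
  moreover have "integral\<^sup>L (distr (P 0) borel (X (s n))) f = (\<integral>\<omega>. exp (- u * X (s n) \<omega>) \<partial>P 0)" for n
  proof -
    have "integral\<^sup>L (distr (P 0) borel (X (s n))) f = (\<integral>\<omega>. f (X (s n) \<omega>) \<partial>P 0)"
      using Xm by (intro integral_distr) auto
    also have "\<dots> = (\<integral>\<omega>. exp (- u * X (s n) \<omega>) \<partial>P 0)"
      using nonneg_X[OF s(1)] by (intro Bochner_Integration.integral_cong) (auto simp: f_def max_absorb1)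
    finally show ?thesis .
  qed
  moreover have "integral\<^sup>L L f = L.laplace u"
    unfolding L.laplace_def
  proof (rule integral_cong_AE)
    show "AE x in L. f x = exp (- u * x)"
      using L.AE_nonneg by eventually_elim (simp add: f_def max_absorb1)
  qed measurable
  ultimately show ?thesis by simp
qed

text \<open>The laws at times n and n + t have the same limit, and \<open>integral_exp_X_add\<close>
  links their transforms.\<close>

lemma laplace_stationary:
  assumes L: "limit_distribution P X L" and t: "0 \<le> t" and u: "0 \<le> u"
  shows "nonneg_distribution.laplace L u = exp (- \<phi> t u) * nonneg_distribution.laplace L (\<psi> t u)"
proof (rule LIMSEQ_unique)
  have lim: "filterlim real at_top sequentially" by (rule filterlim_real_sequentially)
  show "(\<lambda>n. \<integral>\<omega>. exp (- u * X (real n + t) \<omega>) \<partial>P 0) \<longlonglongrightarrow> nonneg_distribution.laplace L u"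
  proof (rule laplace_limit[OF L _ _ u])
    show "filterlim (\<lambda>n. real n + t) at_top sequentially"
      using filterlim_tendsto_add_at_top[OF tendsto_const lim, of t] by (simp add: add.commute)
  qed (use t in auto)
  have "(\<lambda>n. exp (- \<phi> t u) * (\<integral>\<omega>. exp (- \<psi> t u * X (real n) \<omega>) \<partial>P 0)) \<longlonglongrightarrow>
      exp (- \<phi> t u) * nonneg_distribution.laplace L (\<psi> t u)"
    by (intro tendsto_intros laplace_limit[OF L _ lim] psi_nonneg t u) auto
  then show "(\<lambda>n. \<integral>\<omega>. exp (- u * X (real n + t) \<omega>) \<partial>P 0) \<longlonglongrightarrow>
      exp (- \<phi> t u) * nonneg_distribution.laplace L (\<psi> t u)"
    using integral_exp_X_add[OF _ t u] by simp
qed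

text \<open>Differentiating the stationarity of \<open>L\<close> at time \<open>0\<close> gives the generator equation directly,
  without solving the Riccati equations for \<open>\<phi>\<close> and \<open>\<psi>\<close>.\<close>

lemma stationary_equation:
  assumes L: "limit_distribution P X L" and u: "0 < u"
  shows "F u * nonneg_distribution.laplace L u = - R u * nonneg_distribution.laplace_moment L u"
proof -
  interpret L: nonneg_distribution L by (rule limit_distribution_nonneg[OF L])
  have d: "((\<lambda>t. exp (- \<phi> t u) * L.laplace (\<psi> t u)) has_real_derivative
      - F u * L.laplace u + - L.laplace_moment u * R u) (at 0 within {0..})"
  proof -
    have psi: "((\<lambda>t. L.laplace (\<psi> t u)) has_real_derivative - L.laplace_moment u * R u) (at 0 within {0..})"
      by (rule DERIV_chain2[where f=L.laplace])
         (use L.laplace_has_derivative[OF u] psi_deriv[of u] initial_exponents[of u] u in auto)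
    have phi: "((\<lambda>t. exp (- \<phi> t u)) has_real_derivative - F u) (at 0 within {0..})"
      using phi_deriv[of u] initial_exponents[of u] u by (auto intro!: derivative_eq_intros)
    show ?thesis
      using DERIV_mult[OF phi psi] initial_exponents[of u] u by simp
  qed
  have "((\<lambda>t. exp (- \<phi> t u) * L.laplace (\<psi> t u)) has_real_derivative 0) (at 0 within {0..})"
    by (rule has_field_derivative_transform_within[where d=1 and f="\<lambda>_. L.laplace u"])
       (use laplace_stationary[OF L] u in auto)
  from has_field_derivative_unique[OF d this]
  have "- F u * L.laplace u + - L.laplace_moment u * R u = 0"
    by (simp add: at_within_Ici_at_right)
  then show ?thesis by (simp add: mult.commute)
qed

end

section \<open>The support of the limit distribution\<close>

lemma nn_integral_strict_mono_on:
  fixes Q :: "real measure"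
  assumes [measurable_cong]: "sets Q = sets borel"
    and [measurable]: "f \<in> borel_measurable borel" "h \<in> borel_measurable borel"
    and fin: "(\<integral>\<^sup>+x. f x \<partial>Q) < \<infinity>" and le: "AE x in Q. f x \<le> h x"
    and less: "\<And>x. x \<in> A \<Longrightarrow> f x < h x" and A: "A \<in> sets borel" "0 < emeasure Q A"
  shows "(\<integral>\<^sup>+x. f x \<partial>Q) < (\<integral>\<^sup>+x. h x \<partial>Q)"
proof (rule nn_integral_less)
  show "\<not> (AE x in Q. h x \<le> f x)"
  proof
    assume "AE x in Q. h x \<le> f x"
    then have "AE x in Q. x \<notin> A" by eventually_elim (use less not_le in blast)
    then have "emeasure Q {x \<in> space Q. \<not> x \<notin> A} = 0"
      using A(1) by (intro AE_E2) (auto simp: assms(1) sets_eq_imp_space_eq[OF assms(1)])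
    moreover have "{x \<in> space Q. \<not> x \<notin> A} = A"
      using sets_eq_imp_space_eq[OF assms(1)] by auto
    ultimately show False using A(2) by simp
  qed
qed (use fin le in auto)

lemma AE_lborel_obtain:
  fixes p q :: real
  assumes "AE x in lborel. P x" "p < q"
  shows "\<exists>x. p < x \<and> x < q \<and> P x"
proof (rule ccontr)
  assume "\<not> (\<exists>x. p < x \<and> x < q \<and> P x)"
  then have "AE x in lborel. x \<notin> {p<..<q}"
    using assms(1) by (auto elim!: eventually_mono)
  moreover have "{x \<in> space lborel. \<not> x \<notin> {p<..<q}} = {p<..<q}" by auto
  ultimately have "emeasure lborel {p<..<q} = 0"
    using AE_iff_measurable[of "{p<..<q}" lborel "\<lambda>x. x \<notin> {p<..<q}"] by simp
  then show False using assms(2) by simp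
qed

text \<open>What remains of the process: its generator equation, and non-degeneracy in analytic
  form. \<open>immigration\<close> says that \<open>F\<close> is not zero (second kind),
  \<open>nonlinear\<close> that \<open>F\<close> and \<open>R\<close> are not both linear (first
  kind).\<close>

locale CBI_limit =
  imm: finite_variation_jump_measure m + br: subcritical_branching_mechanism \<mu> R \<alpha> \<beta> +
  L: nonneg_distribution L for m \<mu> R \<alpha> \<beta> L +
  fixes F :: "real \<Rightarrow> real" and b :: real
  assumes b_nonneg: "0 \<le> b"
    and F_eq: "0 \<le> u \<Longrightarrow> F u = b * u + imm.jump_exponent u"
    and stationary: "0 < u \<Longrightarrow> F u * L.laplace u = - R u * L.laplace_moment u"
    and immigration: "b \<noteq> 0 \<or> emeasure m {0<..} \<noteq> 0"
    and nonlinear: "\<alpha> \<noteq> 0 \<or> emeasure m {0<..} \<noteq> 0 \<or> emeasure \<mu> {0<..} \<noteq> 0"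
begin

text \<open>By Tonelli the inner integral is that of the tail of \<open>\<mu>\<close> over (z,
  \<infinity>); it may be unbounded near 0.\<close>

definition double_tail :: "real \<Rightarrow> ennreal" where
  "double_tail z = (ennreal br.mean_drift + (\<integral>\<^sup>+\<xi>. ennreal (\<xi> - z) \<partial>\<mu>)) * indicator {0<..} z"

text \<open>By Tonelli the inner integral is, for z > 0, that of the tail of \<open>m\<close> over
  (0, z).\<close>

definition integrated_tail :: "real \<Rightarrow> ennreal" where
  "integrated_tail z = (ennreal b + (\<integral>\<^sup>+\<xi>. ennreal (min \<xi> z) \<partial>m)) * indicator {0<..} z"

text \<open>This and \<open>immigration_density\<close> are the g and k of the overview; the factor
  \<open>ennreal y\<close> supplies the weight of x L(dx).\<close>

definition branching_density :: "real \<Rightarrow> ennreal" where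
  "branching_density x = (\<integral>\<^sup>+y. ennreal y * double_tail (x - y) \<partial>L)"

definition immigration_density :: "real \<Rightarrow> ennreal" where
  "immigration_density x = (\<integral>\<^sup>+y. integrated_tail (x - y) \<partial>L)"

lemma measurable_tails [measurable]:
  "double_tail \<in> borel_measurable borel" "integrated_tail \<in> borel_measurable borel"
  unfolding double_tail_def integrated_tail_def by measurable

lemma measurable_densities [measurable]:
  "branching_density \<in> borel_measurable borel" "immigration_density \<in> borel_measurable borel"
  unfolding branching_density_def immigration_density_def by measurable

lemma F_nonneg: "0 \<le> u \<Longrightarrow> 0 \<le> F u"
  using F_eq[of u] b_nonneg imm.jump_exponent_nonneg[of u] by simp

text \<open>Dividing the generator equation by \<open>u\<^sup>2\<close> turns both sides into Laplace transforms of
  positive measures.\<close>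

lemma invariance_identity:
  "add_measure (density L (\<lambda>y. ennreal \<alpha> * ennreal y)) (density lborel branching_density) =
    density lborel immigration_density" (is "?M = ?N")
proof (rule laplace_transform_unique)
  have lap: "(\<integral>\<^sup>+x. exp (- u * x) \<partial>?M) = ennreal (F u / u\<^sup>2 * L.laplace u)"
    "(\<integral>\<^sup>+x. exp (- u * x) \<partial>?N) = ennreal (F u / u\<^sup>2 * L.laplace u)" if u: "0 < u" for u
  proof -
    have R_nn: "0 \<le> - R u / u\<^sup>2" using br.R_neg[OF u] by (intro divide_nonneg_nonneg) auto
    have "(\<integral>\<^sup>+x. exp (- u * x) \<partial>?M) =
        (\<integral>\<^sup>+y. ennreal \<alpha> * (ennreal y * ennreal (exp (- u * y))) \<partial>L) +
        (\<integral>\<^sup>+x. branching_density x * ennreal (exp (- u * x)) \<partial>lborel)"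
      by (subst nn_integral_add_measure) (auto simp: nn_integral_density mult.assoc)
    also have "(\<integral>\<^sup>+y. ennreal \<alpha> * (ennreal y * ennreal (exp (- u * y))) \<partial>L) =
        ennreal \<alpha> * ennreal (L.laplace_moment u)"
      by (subst nn_integral_cmult) (auto simp: L.nn_integral_laplace_moment[OF u, simplified])
    also have "(\<integral>\<^sup>+x. branching_density x * ennreal (exp (- u * x)) \<partial>lborel) =
        ennreal (L.laplace_moment u) * (\<integral>\<^sup>+z. double_tail z * ennreal (exp (- u * z)) \<partial>lborel)"
      unfolding branching_density_def
      by (subst laplace_transform_convolution)
         (auto simp: L.nn_integral_laplace_moment[OF u, simplified] L.sigma_finite_measure_axioms)
    also have "ennreal \<alpha> * ennreal (L.laplace_moment u) + \<dots> =
        (ennreal \<alpha> + (\<integral>\<^sup>+z. double_tail z * ennreal (exp (- u * z)) \<partial>lborel)) * ennreal (L.laplace_moment u)"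
      by (simp add: distrib_right distrib_left mult.commute)
    also have "\<dots> = ennreal (- R u / u\<^sup>2) * ennreal (L.laplace_moment u)"
      unfolding double_tail_def br.laplace_transform_double_tail[OF u] ..
    also have "\<dots> = ennreal (- R u / u\<^sup>2 * L.laplace_moment u)"
      using R_nn L.laplace_moment_nonneg by (simp add: ennreal_mult[symmetric])
    also have "- R u / u\<^sup>2 * L.laplace_moment u = F u / u\<^sup>2 * L.laplace u"
      using stationary[OF u] by simp
    finally show "(\<integral>\<^sup>+x. exp (- u * x) \<partial>?M) = ennreal (F u / u\<^sup>2 * L.laplace u)" .
    have "(\<integral>\<^sup>+x. exp (- u * x) \<partial>?N) =
        (\<integral>\<^sup>+x. (\<integral>\<^sup>+y. 1 * integrated_tail (x - y) \<partial>L) * ennreal (exp (- u * x)) \<partial>lborel)"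
      by (subst nn_integral_density) (auto simp: immigration_density_def)
    also have "\<dots> = (\<integral>\<^sup>+y. 1 * ennreal (exp (- u * y)) \<partial>L) *
        (\<integral>\<^sup>+z. integrated_tail z * ennreal (exp (- u * z)) \<partial>lborel)"
      by (rule laplace_transform_convolution) (auto simp: L.sigma_finite_measure_axioms)
    also have "\<dots> = ennreal (L.laplace u) * ennreal (F u / u\<^sup>2)"
      using u L.nn_integral_laplace[of u] imm.laplace_transform_integrated_tail[OF u b_nonneg] F_eq[of u]
      unfolding integrated_tail_def by simp
    also have "\<dots> = ennreal (F u / u\<^sup>2 * L.laplace u)"
      using u F_nonneg[of u] L.laplace_pos[of u] by (simp add: ennreal_mult[symmetric] mult.commute)
    finally show "(\<integral>\<^sup>+x. exp (- u * x) \<partial>?N) = ennreal (F u / u\<^sup>2 * L.laplace u)" .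
  qed
  then show "(\<integral>\<^sup>+x. exp (- u * x) \<partial>?M) < \<infinity>"
    "(\<integral>\<^sup>+x. exp (- u * x) \<partial>?M) = (\<integral>\<^sup>+x. exp (- u * x) \<partial>?N)" if "0 < u" for u
    using that by simp_all
  \<comment> \<open>Uniqueness of transforms is available for measures on the half-line only, so
    both sides must vanish below 0.\<close>
  have null: "branching_density x = 0" "immigration_density x = 0" if "x < 0" for x
  proof -
    have "AE y in L. ennreal y * double_tail (x - y) = 0"
      using L.AE_nonneg by eventually_elim (use that in \<open>simp add: double_tail_def\<close>)
    then show "branching_density x = 0"
      unfolding branching_density_def by (subst nn_integral_0_iff_AE) measurable
    have "AE y in L. integrated_tail (x - y) = 0"
      using L.AE_nonneg by eventually_elim (use that in \<open>simp add: integrated_tail_def\<close>)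
    then show "immigration_density x = 0"
      unfolding immigration_density_def by (subst nn_integral_0_iff_AE) measurable
  qed
  have dens: "emeasure (density lborel branching_density) {..<0} = 0"
    "emeasure (density lborel immigration_density) {..<0} = 0"
    using null by (auto simp: emeasure_density nn_integral_0_iff_AE split: split_indicator)
  show "emeasure ?N {..<0} = 0" by (rule dens)
  have "AE y in L. ennreal \<alpha> * ennreal y * indicator {..<0} y = 0"
    using L.AE_nonneg by eventually_elim simp
  then have "emeasure (density L (\<lambda>y. ennreal \<alpha> * ennreal y)) {..<0} = 0"
    by (simp add: emeasure_density nn_integral_0_iff_AE)
  then show "emeasure ?M {..<0} = 0"
    using dens by (simp add: emeasure_add_measure)
qed simp_all

text \<open>On a gap \<alpha> x L(dx) has no mass, so the identity of measures becomes one of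
  densities, valid almost everywhere.\<close>

lemma densities_eq_on_gap:
  assumes "emeasure L {a<..<c} = 0"
  shows "AE x in lborel. x \<in> {a<..<c} \<longrightarrow> branching_density x = immigration_density x"
proof -
  have "density lborel (\<lambda>x. branching_density x * indicator {a<..<c} x) =
      density lborel (\<lambda>x. immigration_density x * indicator {a<..<c} x)"
  proof (rule measure_eqI)
    fix A assume "A \<in> sets (density lborel (\<lambda>x. branching_density x * indicator {a<..<c} x))"
    then have A[measurable]: "A \<in> sets borel" by simp
    have "AE y in L. y \<notin> {a<..<c}"
      by (rule AE_I[of _ _ "{a<..<c}"]) (use assms in auto)
    then have "AE y in L. ennreal \<alpha> * ennreal y * indicator (A \<inter> {a<..<c}) y = 0"
      by eventually_elim simp
    then have "emeasure (density L (\<lambda>y. ennreal \<alpha> * ennreal y)) (A \<inter> {a<..<c}) = 0"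
      by (subst emeasure_density) (auto simp: nn_integral_0_iff_AE)
    then have "emeasure (density lborel branching_density) (A \<inter> {a<..<c}) =
        emeasure (density lborel immigration_density) (A \<inter> {a<..<c})"
      by (subst invariance_identity[symmetric]) (simp add: emeasure_add_measure)
    then show "emeasure (density lborel (\<lambda>x. branching_density x * indicator {a<..<c} x)) A =
        emeasure (density lborel (\<lambda>x. immigration_density x * indicator {a<..<c} x)) A"
      by (simp add: emeasure_density indicator_inter_arith mult_ac)
  qed simp
  then have "AE x in lborel. branching_density x * indicator {a<..<c} x =
      immigration_density x * indicator {a<..<c} x"
    by (intro sigma_finite_measure.density_unique[OF lborel.sigma_finite_measure_axioms]) auto
  then show ?thesis by eventually_elim auto
qed

lemma integrated_tail_finite: "integrated_tail z < \<infinity>"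
proof -
  have "(\<integral>\<^sup>+\<xi>. ennreal (min \<xi> z) \<partial>m) \<le> (\<integral>\<^sup>+\<xi>. ennreal (max 1 z * min (\<xi> ^ 1) 1) \<partial>m)"
  proof (rule nn_integral_mono_AE)
    show "AE \<xi> in m. ennreal (min \<xi> z) \<le> ennreal (max 1 z * min (\<xi> ^ 1) 1)"
      using imm.AE_pos
    proof eventually_elim
      case (elim \<xi>)
      have "min \<xi> z \<le> max 1 z * min \<xi> 1"
      proof (cases "\<xi> \<le> 1")
        case True
        have "min \<xi> z \<le> 1 * \<xi>" by simp
        also have "\<dots> \<le> max 1 z * \<xi>" using elim by (intro mult_right_mono) auto
        finally show ?thesis using True by (simp add: min_absorb1)
      qed (auto simp: min_def max_def)
      then show ?case by (simp add: ennreal_leI)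
    qed
  qed
  also have "\<dots> < \<infinity>"
    using integrable_mult_right[OF imm.integrable_min, of "max 1 z"] imm.AE_pos
    by (subst nn_integral_eq_integral) (auto elim!: eventually_mono)
  finally show ?thesis by (auto simp: integrated_tail_def ennreal_mult_less_top split: split_indicator)
qed

text \<open>Only jumps above \<open>z\<close> count: those above 1 have a finite mean, and for the
  others \<xi> \<ge> z gives \<xi> \<le> \<open>\<xi>\<^sup>2 / z\<close>.\<close>

lemma double_tail_finite: "double_tail z < \<infinity>"
proof (cases "0 < z")
  case z: True
  have "(\<integral>\<^sup>+\<xi>. ennreal (\<xi> - z) \<partial>\<mu>) \<le> (\<integral>\<^sup>+\<xi>. ennreal (\<xi> * indicator {1<..} \<xi> + min (\<xi> ^ 2) 1 / z) \<partial>\<mu>)"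
  proof (rule nn_integral_mono_AE)
    show "AE \<xi> in \<mu>. ennreal (\<xi> - z) \<le> ennreal (\<xi> * indicator {1<..} \<xi> + min (\<xi> ^ 2) 1 / z)"
      using br.AE_pos
    proof eventually_elim
      case (elim \<xi>)
      have nn: "0 \<le> min (\<xi> ^ 2) 1 / z" using z by simp
      show ?case
      proof (cases "1 < \<xi> \<or> \<xi> \<le> z")
        case True
        then show ?thesis
        proof
          assume "1 < \<xi>"
          then have "\<xi> * indicator {1<..} \<xi> = \<xi>" by simp
          moreover have "\<xi> - z \<le> \<xi> + min (\<xi> ^ 2) 1 / z" using z nn by linarith
          ultimately show ?thesis by (metis ennreal_leI)
        next
          assume "\<xi> \<le> z"
          then show ?thesis by (simp add: ennreal_neg)
        qed
      next
        case False
        then have "\<xi>\<^sup>2 \<le> 1" using elim by (simp add: power_le_one)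
        moreover have "\<xi> * z \<le> \<xi>\<^sup>2" using False elim by (simp add: power2_eq_square)
        then have "\<xi> \<le> \<xi>\<^sup>2 / z" using z by (simp add: pos_le_divide_eq)
        ultimately show ?thesis using False z by (intro ennreal_leI) (simp add: min_absorb1)
      qed
    qed
  qed
  also have "\<dots> = ennreal (\<integral>\<xi>. \<xi> * indicator {1<..} \<xi> + min (\<xi> ^ 2) 1 / z \<partial>\<mu>)"
    using z br.AE_pos
    by (intro nn_integral_eq_integral Bochner_Integration.integrable_add integrable_divide_zero
        br.integrable_min br.large_jump_integral) (auto elim!: eventually_mono split: split_indicator)
  also have "\<dots> < \<infinity>" by simp
  finally show ?thesis by (auto simp: double_tail_def ennreal_mult_less_top split: split_indicator)
qed (simp add: double_tail_def)

lemma integrated_tail_mono: "x \<le> y \<Longrightarrow> integrated_tail x \<le> integrated_tail y"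
  unfolding integrated_tail_def
  by (intro mult_mono add_left_mono nn_integral_mono ennreal_leI) (auto split: split_indicator)

lemma double_tail_antimono: "0 < x \<Longrightarrow> x \<le> y \<Longrightarrow> double_tail y \<le> double_tail x"
  unfolding double_tail_def
  by (intro mult_mono add_left_mono nn_integral_mono ennreal_leI) (auto split: split_indicator)

text \<open>Every jump of size at least \<open>d\<close> contributes exactly x and y to the two
  integrals, and such jumps have positive mass.\<close>

lemma integrated_tail_strict_mono:
  assumes "0 < emeasure m {d..}" "0 < x" "x < y" "y \<le> d"
  shows "integrated_tail x < integrated_tail y"
proof -
  have fin: "(\<integral>\<^sup>+\<xi>. ennreal (min \<xi> x) \<partial>m) < \<infinity>"
    using integrated_tail_finite[of x] assms(2) by (simp add: integrated_tail_def)
  have "(\<integral>\<^sup>+\<xi>. ennreal (min \<xi> x) \<partial>m) < (\<integral>\<^sup>+\<xi>. ennreal (min \<xi> y) \<partial>m)"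
    by (rule nn_integral_strict_mono_on[OF imm.sets_nu _ _ fin, where A="{d..}"])
       (use assms in \<open>auto intro!: ennreal_leI simp: ennreal_less_iff\<close>)
  then show ?thesis using assms b_nonneg by (simp add: integrated_tail_def ennreal_add_left_cancel_less)
qed

lemma double_tail_strict_antimono:
  assumes "0 < emeasure \<mu> {d..}" "0 < x" "x < y" "y \<le> d"
  shows "double_tail y < double_tail x"
proof -
  have fin: "(\<integral>\<^sup>+\<xi>. ennreal (\<xi> - y) \<partial>\<mu>) < \<infinity>"
    using double_tail_finite[of y] assms(2,3) by (simp add: double_tail_def)
  have "(\<integral>\<^sup>+\<xi>. ennreal (\<xi> - y) \<partial>\<mu>) < (\<integral>\<^sup>+\<xi>. ennreal (\<xi> - x) \<partial>\<mu>)"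
    by (rule nn_integral_strict_mono_on[OF br.sets_nu _ _ fin, where A="{d..}"])
       (use assms in \<open>auto intro!: ennreal_leI simp: ennreal_less_iff\<close>)
  then show ?thesis using assms by (simp add: double_tail_def ennreal_add_left_cancel_less)
qed

lemma immigration_density_finite: "immigration_density x < \<infinity>"
proof -
  have "immigration_density x \<le> (\<integral>\<^sup>+y. integrated_tail x \<partial>L)"
    unfolding immigration_density_def
    by (rule nn_integral_mono_AE) (use L.AE_nonneg in \<open>auto intro!: integrated_tail_mono elim!: eventually_mono\<close>)
  then show ?thesis
    using integrated_tail_finite[of x] L.emeasure_space_1 by (simp add: le_less_trans)
qed

text \<open>\<open>double_tail\<close> decreases only right of 0 and jumps up when its argument
  becomes positive. No z outside the gap sees this jump: for z \<le> a both arguments are positive,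
  for z \<ge> c both are negative.\<close>

lemma branching_integrand_antimono:
  assumes gap: "emeasure L {a<..<c} = 0" and x: "a < x" "x \<le> y" "y < c"
  shows "AE z in L. ennreal z * double_tail (y - z) \<le> ennreal z * double_tail (x - z)"
proof -
  have "AE z in L. z \<notin> {a<..<c}"
    by (rule AE_I[of _ _ "{a<..<c}"]) (use gap in auto)
  then show ?thesis
  proof eventually_elim
    case (elim z)
    then consider "z \<le> a" | "c \<le> z" by force
    then show ?case
    proof cases
      case 1
      then show ?thesis using x by (intro mult_left_mono double_tail_antimono) auto
    next
      case 2
      then show ?thesis using x by (simp add: double_tail_def)
    qed
  qed
qed

lemma branching_density_antimono:
  "emeasure L {a<..<c} = 0 \<Longrightarrow> a < x \<Longrightarrow> x \<le> y \<Longrightarrow> y < c \<Longrightarrow>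
    branching_density y \<le> branching_density x"
  unfolding branching_density_def by (intro nn_integral_mono_AE branching_integrand_antimono)

lemma immigration_density_mono: "x \<le> y \<Longrightarrow> immigration_density x \<le> immigration_density y"
  unfolding immigration_density_def by (intro nn_integral_mono integrated_tail_mono) auto

text \<open>For purely quadratic \<open>R\<close> and linear \<open>F\<close> the limit is a Gamma distribution, and neither
  density is strictly monotone on a gap; here \<open>u / - R u\<close> is itself the transform of an
  exponential density.\<close>

definition gamma_kernel :: "real \<Rightarrow> ennreal" where
  "gamma_kernel z = ennreal (b / \<alpha> * exp (- (br.mean_drift / \<alpha>) * z)) * indicator {0<..} z"

lemma measurable_gamma_kernel [measurable]: "gamma_kernel \<in> borel_measurable borel"
  unfolding gamma_kernel_def by measurable

text \<open>Without jumps a factor u cancels in the generator equation, and b / (\<alpha> u +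
  \<open>br.mean_drift\<close>) is the transform of \<open>gamma_kernel\<close>. For b > 0 this
  kernel is positive right of 0, so x L(dx) has a density that is positive to the right of any mass
  of \<open>L\<close>.\<close>

lemma gamma_identity:
  assumes m: "emeasure m {0<..} = 0" and mu: "emeasure \<mu> {0<..} = 0" and alpha: "0 < \<alpha>"
  shows "density L ennreal = density lborel (\<lambda>x. \<integral>\<^sup>+y. gamma_kernel (x - y) \<partial>L)" (is "?M = ?N")
proof (rule laplace_transform_unique)
  have lap: "(\<integral>\<^sup>+x. exp (- u * x) \<partial>?M) = ennreal (L.laplace_moment u)"
    "(\<integral>\<^sup>+x. exp (- u * x) \<partial>?N) = ennreal (L.laplace_moment u)" if u: "0 < u" for u
  proof -
    have s_pos: "0 < u + br.mean_drift / \<alpha>" using u alpha br.mean_drift_nonneg by (simp add: add_pos_nonneg)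
    show "(\<integral>\<^sup>+x. exp (- u * x) \<partial>?M) = ennreal (L.laplace_moment u)"
      by (subst nn_integral_density) (auto simp: L.nn_integral_laplace_moment[OF u, simplified])
    have "(\<integral>\<^sup>+x. exp (- u * x) \<partial>?N) =
        (\<integral>\<^sup>+x. (\<integral>\<^sup>+y. 1 * gamma_kernel (x - y) \<partial>L) * ennreal (exp (- u * x)) \<partial>lborel)"
      by (subst nn_integral_density) auto
    also have "\<dots> = (\<integral>\<^sup>+y. 1 * ennreal (exp (- u * y)) \<partial>L) *
        (\<integral>\<^sup>+z. gamma_kernel z * ennreal (exp (- u * z)) \<partial>lborel)"
      by (rule laplace_transform_convolution) (auto simp: L.sigma_finite_measure_axioms)
    also have "(\<integral>\<^sup>+z. gamma_kernel z * ennreal (exp (- u * z)) \<partial>lborel) =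
        (\<integral>\<^sup>+z. ennreal (b / \<alpha>) * (indicator {0<..} z * ennreal (exp (- (u + br.mean_drift / \<alpha>) * z))) \<partial>lborel)"
    proof (rule nn_integral_cong)
      fix z
      have "b / \<alpha> * exp (- (br.mean_drift / \<alpha>) * z) * exp (- u * z) =
          b / \<alpha> * exp (- (u + br.mean_drift / \<alpha>) * z)"
        by (simp add: mult.assoc exp_add[symmetric] algebra_simps)
      then show "gamma_kernel z * ennreal (exp (- u * z)) =
          ennreal (b / \<alpha>) * (indicator {0<..} z * ennreal (exp (- (u + br.mean_drift / \<alpha>) * z)))"
        using b_nonneg alpha unfolding gamma_kernel_def
        by (auto simp: ennreal_mult[symmetric] split: split_indicator)
    qed
    also have "\<dots> = ennreal (b / \<alpha>) * ennreal (1 / (u + br.mean_drift / \<alpha>))"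
      by (subst nn_integral_cmult) (auto simp: laplace_transform_exponential[OF s_pos, simplified])
    also have "(\<integral>\<^sup>+y. 1 * ennreal (exp (- u * y)) \<partial>L) = ennreal (L.laplace u)"
      using L.nn_integral_laplace[of u] u by simp
    also have "ennreal (L.laplace u) * (ennreal (b / \<alpha>) * ennreal (1 / (u + br.mean_drift / \<alpha>))) =
        ennreal (L.laplace u * (b / \<alpha> * (1 / (u + br.mean_drift / \<alpha>))))"
      using L.laplace_pos[of u] u b_nonneg alpha s_pos by (simp add: ennreal_mult[symmetric])
    also have "L.laplace u * (b / \<alpha> * (1 / (u + br.mean_drift / \<alpha>))) = L.laplace_moment u"
    proof -
      have "F u = b * u" using F_eq[of u] imm.jump_exponent_null[OF m] u by simp
      moreover have "- R u = \<alpha> * u\<^sup>2 + br.mean_drift * u"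
        using br.minus_R_eq(2)[of u] mu u by (simp add: br.null_iff)
      ultimately have "u * (b * L.laplace u) = u * ((\<alpha> * u + br.mean_drift) * L.laplace_moment u)"
        using stationary[OF u] by (simp add: power2_eq_square algebra_simps)
      then have "b * L.laplace u = (\<alpha> * u + br.mean_drift) * L.laplace_moment u" using u by simp
      then show ?thesis using alpha s_pos by (simp add: field_simps)
    qed
    finally show "(\<integral>\<^sup>+x. exp (- u * x) \<partial>?N) = ennreal (L.laplace_moment u)" .
  qed
  then show "(\<integral>\<^sup>+x. exp (- u * x) \<partial>?M) < \<infinity>"
    "(\<integral>\<^sup>+x. exp (- u * x) \<partial>?M) = (\<integral>\<^sup>+x. exp (- u * x) \<partial>?N)" if "0 < u" for u
    using that by simp_all
  have "AE y in L. ennreal y * indicator {..<0} y = 0"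
    using L.AE_nonneg by eventually_elim simp
  then show "emeasure ?M {..<0} = 0"
    by (simp add: emeasure_density nn_integral_0_iff_AE)
  have "(\<integral>\<^sup>+y. gamma_kernel (x - y) \<partial>L) = 0" if "x < 0" for x
  proof -
    have "AE y in L. gamma_kernel (x - y) = 0"
      using L.AE_nonneg by eventually_elim (use that in \<open>simp add: gamma_kernel_def\<close>)
    then show ?thesis by (subst nn_integral_0_iff_AE) measurable
  qed
  then show "emeasure ?N {..<0} = 0"
    by (auto simp: emeasure_density nn_integral_0_iff_AE split: split_indicator)
qed simp_all

text \<open>Immigration jumps make k strictly increasing right of \<open>a\<close>; branching jumps
  make g strictly decreasing there, provided a > 0. Without immigration jumps b > 0, so at a = 0 the
  remaining mass at the origin makes k positive while g vanishes. Only the jump-free Gamma case is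
  then left.\<close>

lemma support_gap_impossible:
  assumes a: "0 \<le> a" "a < c" and gap: "emeasure L {a<..<c} = 0"
    and mass: "\<And>d. 0 < d \<Longrightarrow> 0 < emeasure L {a - d<..a}"
  shows False
proof -
  have "AE x in lborel. x \<in> {a<..<c} \<longrightarrow> branching_density x = immigration_density x"
    by (rule densities_eq_on_gap[OF gap])
  \<comment> \<open>The densities agree only almost everywhere, so points of agreement are sought in
    prescribed intervals; two adjacent ones yield x < y.\<close>
  then have pick: "\<exists>x. p < x \<and> x < q \<and> branching_density x = immigration_density x"
    if "a \<le> p" "p < q" "q \<le> c" for p q
    using AE_lborel_obtain[OF _ \<open>p < q\<close>] that by (smt (verit) greaterThanLessThan_iff)
  consider (immigration_jumps) "emeasure m {0<..} \<noteq> 0" | (origin) "a = 0" "b \<noteq> 0"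
    | (branching_jumps) "0 < a" "emeasure \<mu> {0<..} \<noteq> 0"
    | (gamma) "emeasure m {0<..} = 0" "emeasure \<mu> {0<..} = 0" "\<alpha> \<noteq> 0" "b \<noteq> 0"
    using immigration nonlinear a by force
  then show False
  proof cases
    case immigration_jumps
    then obtain d where d: "0 < d" "0 < emeasure m {d..}" by (rule imm.pos_tail_if_nonnull)
    \<comment> \<open>For z within \<open>e\<close> left of \<open>a\<close> and y within
      \<open>e\<close> right of it, y - z stays below 2 e \<le> d, the range of strict
      monotonicity.\<close>
    define e where "e = min (c - a) (d / 2)"
    have "e \<le> d / 2" unfolding e_def by (rule min.cobounded2)
    then have "2 * e \<le> d" by simp
    moreover have "0 < e" "e \<le> c - a" using d a by (simp_all add: e_def)
    ultimately have e: "0 < e" "e \<le> c - a" "2 * e \<le> d" by auto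
    obtain x where x: "a < x" "x < a + e / 2" "branching_density x = immigration_density x"
      using pick[of a "a + e / 2"] e by auto
    obtain y where y: "a + e / 2 < y" "y < a + e" "branching_density y = immigration_density y"
      using pick[of "a + e / 2" "a + e"] e by auto
    have "immigration_density x < immigration_density y"
      unfolding immigration_density_def
    proof (rule nn_integral_strict_mono_on[where A="{a - e<..a}"])
      show "(\<integral>\<^sup>+z. integrated_tail (x - z) \<partial>L) < \<infinity>"
        using immigration_density_finite by (simp add: immigration_density_def)
      show "integrated_tail (x - z) < integrated_tail (y - z)" if "z \<in> {a - e<..a}" for z
        by (rule integrated_tail_strict_mono[OF d(2)]) (use that x y e in auto)
      show "AE z in L. integrated_tail (x - z) \<le> integrated_tail (y - z)"
        using x y by (intro AE_I2 integrated_tail_mono) auto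
    qed (use mass[OF e(1)] in auto)
    moreover have "branching_density y \<le> branching_density x"
      using x y e by (intro branching_density_antimono[OF gap]) auto
    ultimately show False using x(3) y(3) by simp
  next
    case branching_jumps
    obtain d where d: "0 < d" "0 < emeasure \<mu> {d..}" using branching_jumps(2) by (rule br.pos_tail_if_nonnull)
    \<comment> \<open>The additional bound by \<open>a\<close> keeps z > a - e \<ge> 0, so that the
      weight \<open>ennreal z\<close> is positive.\<close>
    define e where "e = min (min (c - a) (d / 2)) a"
    have "e \<le> d / 2" unfolding e_def by (meson min.cobounded1 min.cobounded2 order_trans)
    then have "2 * e \<le> d" by simp
    moreover have "0 < e" "e \<le> c - a" "e \<le> a" using d a branching_jumps by (simp_all add: e_def)
    ultimately have e: "0 < e" "e \<le> c - a" "2 * e \<le> d" "e \<le> a" by auto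
    obtain x where x: "a < x" "x < a + e / 2" "branching_density x = immigration_density x"
      using pick[of a "a + e / 2"] e by auto
    obtain y where y: "a + e / 2 < y" "y < a + e" "branching_density y = immigration_density y"
      using pick[of "a + e / 2" "a + e"] e by auto
    have anti: "AE z in L. ennreal z * double_tail (y - z) \<le> ennreal z * double_tail (x - z)"
      using x y e by (intro branching_integrand_antimono[OF gap]) auto
    have "branching_density y < branching_density x"
      unfolding branching_density_def
    proof (rule nn_integral_strict_mono_on[OF _ _ _ _ anti, where A="{a - e<..a}"])
      \<comment> \<open>Finiteness of g at y is borrowed from k, with which it agrees there.\<close>
      show "(\<integral>\<^sup>+z. ennreal z * double_tail (y - z) \<partial>L) < \<infinity>"
        using immigration_density_finite[of y] y(3) by (simp add: branching_density_def)
      show "ennreal z * double_tail (y - z) < ennreal z * double_tail (x - z)" if "z \<in> {a - e<..a}" for z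
        by (intro ennreal_mult_strict_left_mono double_tail_strict_antimono[OF d(2)])
           (use that x y e in auto)
    qed (use mass[OF e(1)] in auto)
    moreover have "immigration_density x \<le> immigration_density y"
      using x y by (intro immigration_density_mono) auto
    ultimately show False using x(3) y(3) by simp
  next
    case origin
    obtain x where x: "a < x" "x < c" "branching_density x = immigration_density x"
      using pick[of a c] a by auto
    have "AE z in L. z \<notin> {a<..<c}"
      by (rule AE_I[of _ _ "{a<..<c}"]) (use gap in auto)
    then have "AE z in L. ennreal z * double_tail (x - z) = 0"
      using L.AE_nonneg
    proof eventually_elim
      case (elim z)
      then have "z = 0 \<or> c \<le> z" using origin by force
      then show ?case using x by (auto simp: double_tail_def)
    qed
    then have "branching_density x = 0"
      unfolding branching_density_def by (subst nn_integral_0_iff_AE) measurable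
    moreover have "(\<integral>\<^sup>+z. 0 \<partial>L) < immigration_density x"
      unfolding immigration_density_def
    proof (rule nn_integral_strict_mono_on[where A="{a - 1<..a}"])
      show "0 < integrated_tail (x - z)" if "z \<in> {a - 1<..a}" for z
        using that x origin b_nonneg by (auto simp: integrated_tail_def add_pos_nonneg)
    qed (use mass[of 1] in auto)
    ultimately show False using x(3) by simp
  next
    case gamma
    then have pos: "0 < \<alpha>" "0 < b" using br.alpha_nonneg b_nonneg by auto
    have "emeasure (density L ennreal) {a<..<c} = 0"
    proof -
      have "AE z in L. z \<notin> {a<..<c}"
        by (rule AE_I[of _ _ "{a<..<c}"]) (use gap in auto)
      then have "AE z in L. ennreal z * indicator {a<..<c} z = 0"
        by eventually_elim simp
      then show ?thesis by (subst emeasure_density) (auto simp: nn_integral_0_iff_AE)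
    qed
    then have "emeasure (density lborel (\<lambda>x. \<integral>\<^sup>+y. gamma_kernel (x - y) \<partial>L)) {a<..<c} = 0"
      using gamma_identity[OF gamma(1,2) pos(1)] by simp
    then have "AE x in lborel. (\<integral>\<^sup>+y. gamma_kernel (x - y) \<partial>L) * indicator {a<..<c} x = 0"
      by (subst (asm) emeasure_density) (auto simp: nn_integral_0_iff_AE)
    from AE_lborel_obtain[OF this a(2)]
    obtain x where x: "a < x" "x < c" "(\<integral>\<^sup>+y. gamma_kernel (x - y) \<partial>L) = 0" by auto
    have "(\<integral>\<^sup>+z. 0 \<partial>L) < (\<integral>\<^sup>+y. gamma_kernel (x - y) \<partial>L)"
    proof (rule nn_integral_strict_mono_on[where A="{a - 1<..a}"])
      show "0 < gamma_kernel (x - z)" if "z \<in> {a - 1<..a}" for z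
        using that x pos by (auto simp: gamma_kernel_def)
    qed (use mass[of 1] in auto)
    then show False using x(3) by simp
  qed
qed

lemma in_support_if_mass_below:
  assumes "0 < emeasure L {..p}"
  shows "p \<in> measure_support L"
proof (rule ccontr)
  assume "p \<notin> measure_support L"
  from L.obtain_support_gap[OF assms this] obtain a where
    a: "0 \<le> a" "a < p" "emeasure L {a<..p} = 0" "\<And>d. 0 < d \<Longrightarrow> 0 < emeasure L {a - d<..a}"
    by blast
  have "emeasure L {a<..<p} \<le> emeasure L {a<..p}" by (intro emeasure_mono) auto
  then show False using support_gap_impossible[OF a(1,2) _ a(4)] a(3) by simp
qed

section \<open>The left end point of the support\<close>

definition support_start :: real where
  "support_start = (if effective_drift \<alpha> \<beta> \<mu> = \<infinity> then 0 else b / real_of_ereal (effective_drift \<alpha> \<beta> \<mu>))"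

lemma F_over_minus_R_tendsto: "((\<lambda>u. F u / - R u) \<longlongrightarrow> support_start) at_top"
proof -
  have "((\<lambda>u. b + imm.jump_exponent u / u) \<longlongrightarrow> b + 0) at_top"
    by (intro tendsto_intros imm.jump_exponent_sublinear)
  moreover have "\<forall>\<^sub>F u in at_top. b + imm.jump_exponent u / u = F u / u"
    using eventually_gt_at_top[of 0]
    by eventually_elim (use F_eq in \<open>simp add: add_divide_distrib\<close>)
  ultimately have F_lim: "((\<lambda>u. F u / u) \<longlongrightarrow> b) at_top"
    by (simp add: Lim_transform_eventually)
  have "((\<lambda>u. (F u / u) / (- R u / u)) \<longlongrightarrow> support_start) at_top"
  proof (cases "effective_drift \<alpha> \<beta> \<mu> = \<infinity>")
    case True
    then have "filterlim (\<lambda>u. - R u / u) at_top at_top"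
      using br.minus_R_over_u_tendsto tendsto_PInfty_eq_at_top[of "\<lambda>u. - R u / u" at_top] by simp
    then have "filterlim (\<lambda>u. - R u / u) at_infinity at_top"
      by (rule filterlim_at_top_imp_at_infinity)
    from tendsto_divide_0[OF F_lim this] show ?thesis using True by (simp add: support_start_def)
  next
    case False
    then obtain l where l: "effective_drift \<alpha> \<beta> \<mu> = ereal l" "0 < l"
      using br.effective_drift_pos by (cases "effective_drift \<alpha> \<beta> \<mu>") auto
    then have "((\<lambda>u. - R u / u) \<longlongrightarrow> l) at_top"
      using br.minus_R_over_u_tendsto by simp
    from tendsto_divide[OF F_lim this] show ?thesis using l by (simp add: support_start_def)
  qed
  moreover have "\<forall>\<^sub>F u in at_top. (F u / u) / (- R u / u) = F u / - R u"
    using eventually_gt_at_top[of 0] by eventually_elim simp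
  ultimately show ?thesis by (rule Lim_transform_eventually)
qed

lemma tilted_mean: "0 < u \<Longrightarrow> L.laplace_moment u = F u / - R u * L.laplace u"
  using stationary[of u] br.R_neg[of u] by (simp add: field_simps)

text \<open>Mass below \<open>support_start\<close> would pull the tilted means below their limit;
  absence of mass up to some r above it would keep them at least r. Beyond the end point there are
  no gaps.\<close>

theorem measure_support_eq: "measure_support L = {support_start..}"
proof (intro equalityI subsetI)
  fix p assume p: "p \<in> measure_support L"
  show "p \<in> {support_start..}"
  proof (rule ccontr)
    assume "p \<notin> {support_start..}"
    then have less: "p < support_start" by simp
    \<comment> \<open>Two intermediate points: \<open>q\<close> leaves room for a neighbourhood of
      \<open>p\<close>, and \<open>r\<close> separates the tilted means from their limit.\<close>
    define q where "q = (2 * p + support_start) / 3"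
    define r where "r = (p + 2 * support_start) / 3"
    have pqr: "p < q" "q < r" "r < support_start" using less by (simp_all add: q_def r_def)
    have "0 < emeasure L {p - (q - p)<..<p + (q - p)}"
      using p[unfolded L.measure_support_iff, rule_format, of "q - p"] pqr by simp
    also have "\<dots> \<le> emeasure L {..q}" by (intro emeasure_mono) auto
    finally have "0 < measure L {..q}" by (simp add: L.emeasure_eq_measure)
    then have "\<forall>\<^sub>F u in at_top. L.laplace_moment u < r * L.laplace u \<and> r < F u / - R u \<and> 0 < u"
      by (intro eventually_conj L.tilted_mean_eventually_less[OF _ pqr(2)]
          order_tendstoD(1)[OF F_over_minus_R_tendsto pqr(3)] eventually_gt_at_top)
    then obtain u where u: "L.laplace_moment u < r * L.laplace u" "r < F u / - R u" "0 < u"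
      using eventually_happens'[OF trivial_limit_at_top_linorder] by blast
    have "r * L.laplace u < F u / - R u * L.laplace u"
      using u L.laplace_pos[of u] by (intro mult_strict_right_mono) auto
    with u(1) show False unfolding tilted_mean[OF u(3)] by linarith
  qed
next
  fix p assume "p \<in> {support_start..}"
  then have p: "support_start \<le> p" by simp
  have mass: "0 < emeasure L {..r}" if r: "support_start < r" for r
  proof (rule ccontr)
    assume "\<not> 0 < emeasure L {..r}"
    then have null: "emeasure L {..r} = 0" by simp
    have "\<forall>\<^sub>F u in at_top. F u / - R u < r \<and> 0 < u"
      by (intro eventually_conj order_tendstoD(2)[OF F_over_minus_R_tendsto r] eventually_gt_at_top)
    then obtain u where u: "F u / - R u < r" "0 < u"
      using eventually_happens'[OF trivial_limit_at_top_linorder] by blast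
    have "F u / - R u * L.laplace u < r * L.laplace u"
      using u L.laplace_pos[of u] by (intro mult_strict_right_mono) auto
    with L.tilted_mean_ge[OF null u(2)] show False unfolding tilted_mean[OF u(2)] by linarith
  qed
  show "p \<in> measure_support L"
    unfolding L.measure_support_iff
  proof (intro allI impI)
    fix e :: real assume e: "0 < e"
    \<comment> \<open>This point lies strictly right of \<open>support_start\<close> even if
      \<open>p\<close> does not, where \<open>{..p}\<close> may be a null set.\<close>
    have "p + e / 2 \<in> measure_support L"
      by (intro in_support_if_mass_below mass) (use p e in auto)
    then have "0 < emeasure L {p + e / 2 - e / 2<..<p + e / 2 + e / 2}"
      unfolding L.measure_support_iff using e by (elim allE[of _ "e / 2"]) simp
    also have "\<dots> \<le> emeasure L {p - e<..<p + e}"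
      using e by (intro emeasure_mono) auto
    finally show "0 < emeasure L {p - e<..<p + e}" .
  qed
qed

end

section \<open>Variation of Levy paths\<close>

text \<open>Almost sure statements survive only countably many pairs of times; right continuity
  passes from these to all times.\<close>

lemma right_continuous_mono_on_rationals:
  fixes h :: "real \<Rightarrow> real"
  assumes cont: "\<And>t. 0 \<le> t \<Longrightarrow> (h \<longlongrightarrow> h t) (at_right t)"
    and mono: "\<And>p q. p \<in> \<rat> \<Longrightarrow> q \<in> \<rat> \<Longrightarrow> 0 \<le> p \<Longrightarrow> p \<le> q \<Longrightarrow> h p \<le> h q"
    and st: "0 \<le> s" "s \<le> t"
  shows "h s \<le> h t"
proof (rule ccontr)
  assume "\<not> h s \<le> h t"
  then have less: "h t < h s" "s < t" using st by (auto simp: less_le)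
  define c where "c = (h s + h t) / 2"
  have c: "h t < c" "c < h s" using less by (simp_all add: c_def)
  obtain a where a: "s < a" "\<And>x. s < x \<Longrightarrow> x < a \<Longrightarrow> c < h x"
    using order_tendstoD(1)[OF cont[OF st(1)] c(2)] unfolding eventually_at_right_field by blast
  have "0 \<le> t" using st by simp
  from order_tendstoD(2)[OF cont[OF this] c(1)]
  obtain d where d: "t < d" "\<And>x. t < x \<Longrightarrow> x < d \<Longrightarrow> h x < c"
    unfolding eventually_at_right_field by blast
  obtain p where p: "p \<in> \<rat>" "s < p" "p < min a t"
    using Rats_dense_in_real[of s "min a t"] a(1) less(2) by auto
  obtain q where q: "q \<in> \<rat>" "t < q" "q < d"
    using Rats_dense_in_real[OF d(1)] by auto
  have "h p \<le> h q" using p q st by (intro mono) auto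
  with a(2)[of p] d(2)[of q] p q show False by simp
qed

lemma bounded_variation_on_mono_plus_linear:
  fixes f :: "real \<Rightarrow> real"
  assumes mono: "\<And>s t. 0 \<le> s \<Longrightarrow> s \<le> t \<Longrightarrow> f s + l * s \<le> f t + l * t"
  shows "bounded_variation_on 0 T f"
  unfolding bounded_variation_on_def
proof (intro exI allI impI)
  fix n :: nat and \<tau> :: "nat \<Rightarrow> real"
  assume \<tau>: "mono \<tau> \<and> range \<tau> \<subseteq> {0..T}"
  define h where "h t = f t + l * t" for t
  have r: "0 \<le> \<tau> i" "\<tau> i \<le> T" for i using \<tau> unfolding image_subset_iff by auto
  have step: "\<tau> i \<le> \<tau> (Suc i)" for i using \<tau> by (simp add: incseq_SucD)
  have "(\<Sum>i<n. \<bar>f (\<tau> (Suc i)) - f (\<tau> i)\<bar>) \<le>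
      (\<Sum>i<n. (h (\<tau> (Suc i)) - h (\<tau> i)) + \<bar>l\<bar> * (\<tau> (Suc i) - \<tau> i))"
  proof (rule sum_mono)
    fix i
    have hm: "h (\<tau> i) \<le> h (\<tau> (Suc i))" unfolding h_def by (rule mono[OF r(1) step])
    have "f (\<tau> (Suc i)) - f (\<tau> i) = (h (\<tau> (Suc i)) - h (\<tau> i)) - l * (\<tau> (Suc i) - \<tau> i)"
      by (simp add: h_def algebra_simps)
    also have "\<bar>\<dots>\<bar> \<le> \<bar>h (\<tau> (Suc i)) - h (\<tau> i)\<bar> + \<bar>l * (\<tau> (Suc i) - \<tau> i)\<bar>"
      by (rule abs_triangle_ineq4)
    also have "\<dots> = (h (\<tau> (Suc i)) - h (\<tau> i)) + \<bar>l\<bar> * (\<tau> (Suc i) - \<tau> i)"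
      using hm step by (simp add: abs_mult)
    finally show "\<bar>f (\<tau> (Suc i)) - f (\<tau> i)\<bar> \<le> (h (\<tau> (Suc i)) - h (\<tau> i)) + \<bar>l\<bar> * (\<tau> (Suc i) - \<tau> i)" .
  qed
  also have "\<dots> = (h (\<tau> n) - h (\<tau> 0)) + \<bar>l\<bar> * (\<tau> n - \<tau> 0)"
    by (simp add: sum.distrib sum_distrib_left[symmetric] sum_lessThan_telescope[where f="\<lambda>i. h (\<tau> i)"]
        sum_lessThan_telescope[where f=\<tau>])
  also have "\<dots> \<le> (h T - h 0) + \<bar>l\<bar> * (T - 0)"
  proof (intro add_mono mult_left_mono diff_mono)
    show "h (\<tau> n) \<le> h T" "h 0 \<le> h (\<tau> 0)" unfolding h_def by (intro mono r order_refl)+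
  qed (use r in auto)
  finally show "(\<Sum>i<n. \<bar>f (\<tau> (Suc i)) - f (\<tau> i)\<bar>) \<le> (h T - h 0) + \<bar>l\<bar> * (T - 0)" .
qed

lemma bounded_variation_on_subset:
  "bounded_variation_on a c f \<Longrightarrow> c' \<le> c \<Longrightarrow> bounded_variation_on a c' f"
  unfolding bounded_variation_on_def
  by (meson atLeastatMost_subset_iff order_refl order_trans)

section \<open>Finite and infinite variation from the law of the increments\<close>

context levy_process
begin

text \<open>Chernoff's bound: the probability of \<open>Z \<le> - e\<close> is at most
  \<open>exp (- u * e)\<close> for every u \<ge> 0, hence 0.\<close>

lemma AE_nonneg_of_laplace_bounded:
  fixes Z :: "'v \<Rightarrow> real"
  assumes [measurable]: "Z \<in> borel_measurable N"
    and int: "\<And>u. 0 \<le> u \<Longrightarrow> integrable N (\<lambda>\<omega>. exp (- u * Z \<omega>))"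
    and le: "\<And>u. 0 \<le> u \<Longrightarrow> (\<integral>\<omega>. exp (- u * Z \<omega>) \<partial>N) \<le> 1"
  shows "AE \<omega> in N. 0 \<le> Z \<omega>"
proof -
  have "AE \<omega> in N. - (1 / real (Suc n)) < Z \<omega>" for n
  proof -
    define e where "e = 1 / real (Suc n)"
    define A where "A = {\<omega> \<in> space N. Z \<omega> \<le> - e}"
    have e: "0 < e" by (simp add: e_def)
    have A[measurable]: "A \<in> sets N" unfolding A_def by measurable
    have bound: "prob A \<le> exp (- u * e)" if u: "0 \<le> u" for u
    proof -
      have "(\<integral>\<omega>. exp (u * e) * indicator A \<omega> \<partial>N) \<le> (\<integral>\<omega>. exp (- u * Z \<omega>) \<partial>N)"
      proof (rule integral_mono)
        fix \<omega>
        have "u * e \<le> - u * Z \<omega>" if "\<omega> \<in> A"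
          using that u mult_left_mono[of e "- Z \<omega>" u] by (simp add: A_def)
        then show "exp (u * e) * indicator A \<omega> \<le> exp (- u * Z \<omega>)"
          by (auto split: split_indicator)
      qed (use int[OF u] in \<open>auto simp: less_top[symmetric]\<close>)
      then have "exp (u * e) * prob A \<le> 1" using le[OF u] by simp
      then show ?thesis by (simp add: exp_minus field_simps)
    qed
    have "((\<lambda>u. exp (- u * e)) \<longlongrightarrow> 0) at_top" using e by real_asymp
    moreover have "\<forall>\<^sub>F u in at_top. prob A \<le> exp (- u * e)"
      using eventually_ge_at_top[of 0] by eventually_elim (rule bound)
    ultimately have "prob A \<le> 0" by (rule tendsto_lowerbound) simp
    then have "prob A = 0" by (simp add: measure_le_0_iff)
    then have "emeasure N A = 0" by (simp add: emeasure_eq_measure)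
    then show ?thesis
      by (intro AE_I[of _ _ A]) (auto simp: A_def e_def)
  qed
  then have "AE \<omega> in N. \<forall>n. - (1 / real (Suc n)) < Z \<omega>" by (simp add: AE_all_countable)
  then show ?thesis
  proof eventually_elim
    case (elim \<omega>)
    show ?case
    proof (rule ccontr)
      assume "\<not> 0 \<le> Z \<omega>"
      then have "0 < - Z \<omega>" by simp
      then obtain n where "1 / real (Suc n) < - Z \<omega>" by (rule nat_approx_posE)
      with elim[rule_format, of n] show False by linarith
    qed
  qed
qed

text \<open>The bound on \<open>R\<close> makes the transform of \<open>Y t + l * t\<close> at most
  1, so this variable is nonnegative. Stationary increments turn this into monotonicity of
  \<open>Y t + l * t\<close> along rational times, and right continuity into monotonicity of the
  path.\<close>

lemma AE_bounded_variation:
  assumes lap: "\<And>t u. 0 \<le> t \<Longrightarrow> 0 \<le> u \<Longrightarrow> has_bochner_integral N (\<lambda>\<omega>. exp (- u * Y t \<omega>)) (exp (- t * R u))"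
    and R: "\<And>u. 0 \<le> u \<Longrightarrow> - l * u \<le> R u"
  shows "AE \<omega> in N. bounded_variation_on 0 T (\<lambda>t. Y t \<omega>)"
proof -
  have Y0: "AE \<omega> in N. 0 \<le> Y t \<omega> + l * t" if t: "0 \<le> t" for t
  proof (rule AE_nonneg_of_laplace_bounded)
    show "(\<lambda>\<omega>. Y t \<omega> + l * t) \<in> borel_measurable N" using measurable_Y[OF t] by measurable
    fix u :: real assume u: "0 \<le> u"
    have eq: "exp (- u * (Y t \<omega> + l * t)) = exp (- u * (l * t)) * exp (- u * Y t \<omega>)" for \<omega>
      by (simp add: exp_add[symmetric] algebra_simps)
    note lap' = has_bochner_integral_mult_right[OF lap[OF t u], of "exp (- u * (l * t))"]
    show "integrable N (\<lambda>\<omega>. exp (- u * (Y t \<omega> + l * t)))"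
      unfolding eq using lap' by (rule integrable.intros)
    have "(\<integral>\<omega>. exp (- u * (Y t \<omega> + l * t)) \<partial>N) = exp (- u * (l * t)) * exp (- t * R u)"
      unfolding eq using lap' by (rule has_bochner_integral_integral_eq)
    also have "\<dots> = exp (- t * (l * u + R u))" by (simp add: exp_add[symmetric] algebra_simps)
    also have "\<dots> \<le> 1" using t R[OF u] by (simp add: mult_nonneg_nonneg)
    finally show "(\<integral>\<omega>. exp (- u * (Y t \<omega> + l * t)) \<partial>N) \<le> 1" .
  qed
  have incr: "AE \<omega> in N. Y s \<omega> + l * s \<le> Y (s + t) \<omega> + l * (s + t)" if st: "0 \<le> s" "0 \<le> t" for s t
  proof -
    have [measurable]: "Y s \<in> borel_measurable N" "Y t \<in> borel_measurable N" "Y (s + t) \<in> borel_measurable N"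
      using st by (auto intro: measurable_Y)
    have "AE y in distr N borel (Y t). 0 \<le> y + l * t"
      by (subst AE_distr_iff) (use Y0[OF st(2)] in auto)
    then have "AE y in distr N borel (\<lambda>\<omega>. Y (s + t) \<omega> - Y s \<omega>). 0 \<le> y + l * t"
      by (subst stationary_increments[OF st])
    then have "AE \<omega> in N. 0 \<le> Y (s + t) \<omega> - Y s \<omega> + l * t"
      by (subst (asm) AE_distr_iff) auto
    then show ?thesis by eventually_elim (simp add: algebra_simps)
  qed
  define Q :: "(real \<times> real) set" where "Q = {p \<in> \<rat> \<times> \<rat>. 0 \<le> fst p \<and> 0 \<le> snd p}"
  have "countable Q"
    unfolding Q_def by (rule countable_subset[of _ "\<rat> \<times> \<rat>"]) (auto intro!: countable_SIGMA countable_rat)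
  then have "AE \<omega> in N. \<forall>p\<in>Q. Y (fst p) \<omega> + l * fst p \<le> Y (fst p + snd p) \<omega> + l * (fst p + snd p)"
    using incr by (subst AE_ball_countable) (auto simp: Q_def)
  then show ?thesis using cadlag
  proof eventually_elim
    case (elim \<omega>)
    show ?case
    proof (rule bounded_variation_on_mono_plus_linear)
      fix s t :: real assume "0 \<le> s" "s \<le> t"
      then show "Y s \<omega> + l * s \<le> Y t \<omega> + l * t"
      proof (rule right_continuous_mono_on_rationals[where h="\<lambda>t. Y t \<omega> + l * t", rotated 2])
        fix r :: real assume "0 \<le> r"
        then have "((\<lambda>s. Y s \<omega>) \<longlongrightarrow> Y r \<omega>) (at_right r)"
          using elim(2) by (auto simp: continuous_within)
        then show "((\<lambda>t. Y t \<omega> + l * t) \<longlongrightarrow> Y r \<omega> + l * r) (at_right r)"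
          by (intro tendsto_intros)
      next
        fix p q :: real assume "p \<in> \<rat>" "q \<in> \<rat>" "0 \<le> p" "p \<le> q"
        then have "(p, q - p) \<in> Q" by (auto simp: Q_def)
        with elim(1) show "Y p \<omega> + l * p \<le> Y q \<omega> + l * q" by fastforce
      qed
    qed
  qed
qed

text \<open>On the event that the variation along equidistant partitions stays below \<open>K\<close>, independence of
  the increments bounds \<open>exp (- K)\<close> times its probability by a power of \<open>E exp (- \<bar>Y (T / n)\<bar>)\<close>.\<close>

lemma AE_not_bounded_variationI:
  assumes T: "0 < T"
    and no_bound: "\<And>C. \<exists>n\<ge>1. C / real n < (\<integral>\<omega>. 1 - exp (- \<bar>Y (T / real n) \<omega>\<bar>) \<partial>N)"
  shows "AE \<omega> in N. \<not> bounded_variation_on 0 T (\<lambda>t. Y t \<omega>)"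
proof -
  \<comment> \<open>\<open>min i n\<close> freezes the partition at \<open>T\<close> after n steps:
    partitions are monotone sequences on all naturals that must stay in [0, T].\<close>
  define \<tau> where "\<tau> n i = T * real (min i n) / real n" for n i :: nat
  define V where "V n \<omega> = (\<Sum>i<n. \<bar>Y (\<tau> n (Suc i)) \<omega> - Y (\<tau> n i) \<omega>\<bar>)" for n \<omega>
  have tau_mono: "mono (\<tau> n)" for n
    unfolding \<tau>_def using T by (intro monoI divide_right_mono mult_left_mono) auto
  have tau_range: "0 \<le> \<tau> n i" "1 \<le> n \<Longrightarrow> \<tau> n i \<le> T" for n i
  proof -
    show "0 \<le> \<tau> n i" using T by (simp add: \<tau>_def)
    show "\<tau> n i \<le> T" if "1 \<le> n"
    proof -
      have "T * real (min i n) \<le> T * real n" using T by (intro mult_left_mono) auto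
      then show ?thesis using that by (simp add: \<tau>_def pos_divide_le_eq)
    qed
  qed
  have [measurable]: "Y (\<tau> n i) \<in> borel_measurable N" for n i
    using tau_range(1) by (rule measurable_Y)
  have V_meas[measurable]: "V n \<in> borel_measurable N" for n
    unfolding V_def by measurable
  have V_exp: "(\<integral>\<omega>. exp (- V n \<omega>) \<partial>N) = (\<integral>\<omega>. exp (- \<bar>Y (T / real n) \<omega>\<bar>) \<partial>N) ^ n" if n: "1 \<le> n" for n
  proof -
    have [measurable]: "Y (T / real n) \<in> borel_measurable N" using T by (intro measurable_Y) simp
    have ind: "indep_vars (\<lambda>_. borel) (\<lambda>i \<omega>. Y (\<tau> n (Suc i)) \<omega> - Y (\<tau> n i) \<omega>) {..<n}"
      by (rule independent_increments[OF tau_mono tau_range(1)])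
    have ind': "indep_vars (\<lambda>_. borel) (\<lambda>i \<omega>. exp (- \<bar>Y (\<tau> n (Suc i)) \<omega> - Y (\<tau> n i) \<omega>\<bar>)) {..<n}"
      by (rule indep_vars_compose2[OF ind, where Y="\<lambda>_ x. exp (- \<bar>x\<bar>)"]) simp
    have "(\<integral>\<omega>. exp (- V n \<omega>) \<partial>N) = (\<integral>\<omega>. (\<Prod>i<n. exp (- \<bar>Y (\<tau> n (Suc i)) \<omega> - Y (\<tau> n i) \<omega>\<bar>)) \<partial>N)"
      by (simp add: V_def exp_sum[symmetric] sum_negf[symmetric])
    also have "\<dots> = (\<Prod>i<n. \<integral>\<omega>. exp (- \<bar>Y (\<tau> n (Suc i)) \<omega> - Y (\<tau> n i) \<omega>\<bar>) \<partial>N)"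
    proof (rule indep_vars_lebesgue_integral[OF _ ind'])
      show "integrable N (\<lambda>\<omega>. exp (- \<bar>Y (\<tau> n (Suc i)) \<omega> - Y (\<tau> n i) \<omega>\<bar>))" for i
        by (rule integrable_const_bound[where B=1]) auto
    qed simp
    also have "\<dots> = (\<Prod>i<n. \<integral>\<omega>. exp (- \<bar>Y (T / real n) \<omega>\<bar>) \<partial>N)"
    proof (rule prod.cong[OF refl])
      fix i assume "i \<in> {..<n}"
      then have \<tau>_Suc: "\<tau> n (Suc i) = \<tau> n i + T / real n"
        by (simp add: \<tau>_def min_def field_simps)
      have "distr N borel (\<lambda>\<omega>. Y (\<tau> n i + T / real n) \<omega> - Y (\<tau> n i) \<omega>) = distr N borel (Y (T / real n))"
        using T tau_range(1) by (intro stationary_increments) auto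
      then have "(\<integral>x. exp (- \<bar>x\<bar>) \<partial>distr N borel (\<lambda>\<omega>. Y (\<tau> n (Suc i)) \<omega> - Y (\<tau> n i) \<omega>)) =
          (\<integral>x. exp (- \<bar>x\<bar>) \<partial>distr N borel (Y (T / real n)))"
        by (simp add: \<tau>_Suc)
      then show "(\<integral>\<omega>. exp (- \<bar>Y (\<tau> n (Suc i)) \<omega> - Y (\<tau> n i) \<omega>\<bar>) \<partial>N) = (\<integral>\<omega>. exp (- \<bar>Y (T / real n) \<omega>\<bar>) \<partial>N)"
        by (subst (asm) (1 2) integral_distr) auto
    qed
    finally show ?thesis by simp
  qed
  define B where "B K = {\<omega> \<in> space N. \<forall>n\<ge>1. V n \<omega> \<le> real K}" for K :: nat
  have B_meas[measurable]: "B K \<in> sets N" for K unfolding B_def by measurable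
  have "prob (B K) = 0" for K
  proof (rule ccontr)
    assume "prob (B K) \<noteq> 0"
    then have pos: "0 < prob (B K)" by (simp add: zero_less_measure_iff)
    define p where "p = exp (- real K) * prob (B K)"
    have p: "0 < p" using pos by (simp add: p_def)
    \<comment> \<open>With C = - ln p, since p \<le> q^n will give 1 - q \<le> - ln p / n.\<close>
    obtain n where n: "1 \<le> n" "- ln p / real n < (\<integral>\<omega>. 1 - exp (- \<bar>Y (T / real n) \<omega>\<bar>) \<partial>N)"
      using no_bound by blast
    define q where "q = (\<integral>\<omega>. exp (- \<bar>Y (T / real n) \<omega>\<bar>) \<partial>N)"
    have "p = (\<integral>\<omega>. exp (- real K) * indicator (B K) \<omega> \<partial>N)" by (simp add: p_def)
    also have "\<dots> \<le> (\<integral>\<omega>. exp (- V n \<omega>) \<partial>N)"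
    proof (rule integral_mono)
      show "integrable N (\<lambda>\<omega>. exp (- V n \<omega>))"
        by (rule integrable_const_bound[where B=1]) (auto simp: V_def sum_nonneg)
      show "exp (- real K) * indicator (B K) \<omega> \<le> exp (- V n \<omega>)" for \<omega>
        using n(1) by (auto simp: B_def split: split_indicator)
    qed (auto simp: less_top[symmetric])
    finally have pq: "p \<le> q ^ n" using V_exp[OF n(1)] by (simp add: q_def)
    have "0 \<le> q" by (simp add: q_def)
    moreover have "q \<noteq> 0" using pq p n(1) by (auto simp: power_0_left)
    ultimately have q: "0 < q" by simp
    have "ln p \<le> ln (q ^ n)" using pq p q by (subst ln_le_cancel_iff) auto
    also have "\<dots> = real n * ln q" using q by (simp add: ln_realpow)
    also have "\<dots> \<le> real n * (q - 1)" using ln_le_minus_one[OF q] by (intro mult_left_mono) auto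
    finally have "1 - q \<le> - ln p / real n" using n(1) by (simp add: field_simps)
    moreover have "(\<integral>\<omega>. 1 - exp (- \<bar>Y (T / real n) \<omega>\<bar>) \<partial>N) = 1 - q"
    proof -
      have [measurable]: "Y (T / real n) \<in> borel_measurable N" using T by (intro measurable_Y) simp
      have "integrable N (\<lambda>\<omega>. exp (- \<bar>Y (T / real n) \<omega>\<bar>))"
        by (rule integrable_const_bound[where B=1]) auto
      then show ?thesis by (simp add: q_def prob_space)
    qed
    ultimately show False using n(2) by simp
  qed
  then have "AE \<omega> in N. \<forall>K. \<omega> \<notin> B K"
    by (subst AE_all_countable) (auto intro!: AE_not_in null_setsI simp: emeasure_eq_measure)
  then show ?thesis using AE_space
  proof eventually_elim
    case (elim \<omega>)
    show ?case
    proof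
      assume "bounded_variation_on 0 T (\<lambda>t. Y t \<omega>)"
      then obtain K where K: "\<And>n \<tau>. mono \<tau> \<Longrightarrow> range \<tau> \<subseteq> {0..T} \<Longrightarrow>
          (\<Sum>i<n. \<bar>Y (\<tau> (Suc i)) \<omega> - Y (\<tau> i) \<omega>\<bar>) \<le> K"
        unfolding bounded_variation_on_def by blast
      obtain k :: nat where "K \<le> real k" using real_arch_simple by blast
      then have "V n \<omega> \<le> real k" if "1 \<le> n" for n
        using K[OF tau_mono, of n n] tau_range that unfolding V_def by force
      then have "\<omega> \<in> B k" using elim(2) by (simp add: B_def)
      with elim(1) show False by blast
    qed
  qed
qed

end

text \<open>For y \<ge> 0 the left side is nonpositive. For - 1 / u \<le> y < 0 it is comparable to
  1 - exp(- \<bar>y\<bar>); the 4 is a factor 2 from exp w - 1 \<le> 2 w and one from s \<le> 2 (1 -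
  exp(- s)), both on [0, 1]. For y < - 1 / u the larger exponent \<open>v\<close> dominates, with a
  prefactor that vanishes as v grows.\<close>

lemma exp_splitting_bound:
  fixes u v y :: real
  assumes u: "1 \<le> u" and v: "u \<le> v"
  shows "exp (- u * y) - 1 \<le> 4 * u * (1 - exp (- \<bar>y\<bar>)) + exp (1 - v / u) * exp (- v * y)"
proof -
  have nn1: "0 \<le> 4 * u * (1 - exp (- \<bar>y\<bar>))" using u by (intro mult_nonneg_nonneg) auto
  have nn2: "0 \<le> exp (1 - v / u) * exp (- v * y)" by simp
  consider "0 \<le> y" | "- 1 / u \<le> y" "y < 0" | "y < - 1 / u" by linarith
  then show ?thesis
  proof cases
    case 1
    then have "exp (- u * y) \<le> 1" using u by simp
    then show ?thesis using nn1 nn2 by linarith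
  next
    case 2
    define s where "s = - y"
    have us: "0 < s" "u * s \<le> 1" using 2 u by (simp_all add: s_def field_simps)
    have "1 * s \<le> u * s" using u us by (intro mult_right_mono) auto
    with us have s: "s \<le> 1" by linarith
    have "exp (u * s) \<le> 1 + u * s + (u * s)\<^sup>2"
      using exp_bound[of "u * s"] us u by simp
    also have "(u * s)\<^sup>2 \<le> u * s" using us u by (simp add: power2_eq_square mult_left_le)
    finally have "exp (- u * y) - 1 \<le> 2 * (u * s)" by (simp add: s_def)
    also have "\<dots> \<le> 2 * (u * (2 * (1 - exp (- s))))"
    proof (intro mult_left_mono)
      have "exp (- s) - 1 + s \<le> s\<^sup>2 / 2" using exp_minus_taylor2(2)[of s] us by simp
      moreover have "s\<^sup>2 \<le> s" using us s by (simp add: power2_eq_square mult_left_le)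
      ultimately show "s \<le> 2 * (1 - exp (- s))" by simp
    qed (use u in auto)
    also have "\<dots> = 4 * u * (1 - exp (- \<bar>y\<bar>))" using 2 by (simp add: s_def)
    finally show ?thesis using nn2 by linarith
  next
    case 3
    have "(v - u) * (1 / u) \<le> (v - u) * (- y)" using 3 v u by (intro mult_left_mono) auto
    then have "- u * y \<le> (1 - v / u) + - v * y" using u by (simp add: algebra_simps diff_divide_distrib)
    then have "exp (- u * y) \<le> exp ((1 - v / u) + - v * y)" by (simp only: exp_le_cancel_iff)
    also have "\<dots> = exp (1 - v / u) * exp (- v * y)" by (rule exp_add)
    finally show ?thesis using nn1 by linarith
  qed
qed

text \<open>Here R u is at least minus the drift times u, since the jump exponent is nonnegative.
  Bounded variation on [0, 1] already contradicts infinite variation on every interval.\<close>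

lemma (in branching_mechanism) not_infinite_variation_if_finite_drift:
  assumes Y: "levy_process_of R N Y" and drift: "effective_drift \<alpha> \<beta> \<mu> \<noteq> \<infinity>"
  shows "\<not> infinite_variation_paths N Y"
proof
  assume inf: "infinite_variation_paths N Y"
  interpret Y: levy_process N Y using Y by (simp add: levy_process_of_def)
  have fin: "\<alpha> = 0" "(\<integral>\<^sup>+\<xi>\<in>{0<..1}. ennreal \<xi> \<partial>\<mu>) < \<infinity>"
    using drift by (auto simp: effective_drift_def split: if_splits)
  interpret fv: finite_variation_jump_measure \<mu> by (rule finite_variationI[OF fin(2)])
  have "AE \<omega> in N. bounded_variation_on 0 1 (\<lambda>t. Y t \<omega>)"
  proof (rule Y.AE_bounded_variation)
    show "has_bochner_integral N (\<lambda>\<omega>. exp (- u * Y t \<omega>)) (exp (- t * R u))" if "0 \<le> t" "0 \<le> u" for t u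
      using Y that by (simp add: levy_process_of_def)
    show "- ((LINT \<xi>:{0<..1}|\<mu>. \<xi>) - \<beta>) * u \<le> R u" if "0 \<le> u" for u
      using R_finite_variation[OF fin(2) that] fv.jump_exponent_nonneg[OF that] fin(1) by (simp add: algebra_simps)
  qed
  moreover have "AE \<omega> in N. \<not> bounded_variation_on 0 1 (\<lambda>t. Y t \<omega>)"
    using inf unfolding infinite_variation_paths_def by eventually_elim auto
  ultimately have "AE \<omega> in N. False" by eventually_elim simp
  then show False by simp
qed

text \<open>If the mean of 1 - exp(- \<bar>Y t\<bar>) at t = T / n were at most C / n for all n, the
  splitting bound, divided by t, would give \<open>- R u \<le> 4 * u * C / T\<close> in the limit,
  against the divergence of \<open>- R u / u\<close>.\<close>

lemma (in subcritical_branching_mechanism) infinite_variation_if_infinite_drift: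
  assumes Y: "levy_process_of R N Y" and drift: "effective_drift \<alpha> \<beta> \<mu> = \<infinity>"
  shows "infinite_variation_paths N Y"
proof -
  interpret Y: levy_process N Y using Y by (simp add: levy_process_of_def)
  have lap: "has_bochner_integral N (\<lambda>\<omega>. exp (- u * Y t \<omega>)) (exp (- t * R u))" if "0 \<le> t" "0 \<le> u" for t u
    using Y that by (simp add: levy_process_of_def)
  have unbounded: "AE \<omega> in N. \<not> bounded_variation_on 0 T (\<lambda>t. Y t \<omega>)" if T: "0 < T" for T
  proof (rule Y.AE_not_bounded_variationI[OF T])
    fix C
    show "\<exists>n\<ge>1. C / real n < (\<integral>\<omega>. 1 - exp (- \<bar>Y (T / real n) \<omega>\<bar>) \<partial>N)"
    proof (rule ccontr)
      assume "\<not> (\<exists>n\<ge>1. C / real n < (\<integral>\<omega>. 1 - exp (- \<bar>Y (T / real n) \<omega>\<bar>) \<partial>N))"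
      then have C: "(\<integral>\<omega>. 1 - exp (- \<bar>Y (T / real n) \<omega>\<bar>) \<partial>N) \<le> C / real n" if "1 \<le> n" for n
        using that by (meson not_le)
      define c where "c = \<alpha> + \<bar>\<beta>\<bar> + (\<integral>\<xi>. min (\<xi>\<^sup>2) 1 \<partial>\<mu>)"
      have le: "- R u \<le> 4 * u * C / T" if u: "1 \<le> u" for u
      proof -
        \<comment> \<open>The exponent v = \<open>1 / sqrt t\<close> for t = T / n. As
          \<open>t * v\<^sup>2 = 1\<close>, quadratic growth of \<open>- R\<close> keeps E exp(- v Y
          t) below exp c, while the error divided by t is of order
          \<open>v\<^sup>2 * exp (- v / u)\<close>.\<close>
        define V where "V n = sqrt (real n / T)" for n :: nat
        have V_top: "filterlim V at_top sequentially"
        proof -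
          have "filterlim (\<lambda>x::real. sqrt (x / T)) at_top at_top" using T by real_asymp
          from filterlim_compose[OF this filterlim_real_sequentially] show ?thesis
            unfolding V_def .
        qed
        have "((\<lambda>v. 4 * u * C / T + exp (1 + c) * (v\<^sup>2 * exp (- v / u))) \<longlongrightarrow> 4 * u * C / T) at_top"
          using u by real_asymp
        from filterlim_compose[OF this V_top]
        have lim: "(\<lambda>n. 4 * u * C / T + exp (1 + c) * ((V n)\<^sup>2 * exp (- V n / u))) \<longlonglongrightarrow> 4 * u * C / T" .
        have ev: "\<forall>\<^sub>F n in sequentially. - R u \<le> 4 * u * C / T + exp (1 + c) * ((V n)\<^sup>2 * exp (- V n / u))"
          using eventually_ge_at_top[of 1] V_top[unfolded filterlim_at_top, rule_format, of u]
        proof eventually_elim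
          case (elim n)
          define t where "t = T / real n"
          define v where "v = V n"
          have t: "0 < t" using T elim by (simp add: t_def)
          have "u \<le> v" using elim by (simp add: v_def)
          moreover have "t * v\<^sup>2 = 1" using elim T by (simp add: v_def V_def t_def)
          ultimately have v: "u \<le> v" "1 \<le> v" "t * v\<^sup>2 = 1" using u by auto
          have [measurable]: "Y t \<in> borel_measurable N" using t by (intro Y.measurable_Y) simp
          have iu: "integrable N (\<lambda>\<omega>. exp (- u * Y t \<omega>))" "(\<integral>\<omega>. exp (- u * Y t \<omega>) \<partial>N) = exp (- t * R u)"
            and iv: "integrable N (\<lambda>\<omega>. exp (- v * Y t \<omega>))" "(\<integral>\<omega>. exp (- v * Y t \<omega>) \<partial>N) = exp (- t * R v)"
            using lap[of t u] lap[of t v] t u v by (auto simp: has_bochner_integral_iff)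
          have ie: "integrable N (\<lambda>\<omega>. exp (- \<bar>Y t \<omega>\<bar>))"
            by (rule Y.integrable_const_bound[where B=1]) auto
          then have ia: "integrable N (\<lambda>\<omega>. 1 - exp (- \<bar>Y t \<omega>\<bar>))" by simp
          have "t * (- R u) \<le> exp (- t * R u) - 1"
            using exp_ge_add_one_self[of "- t * R u"] by simp
          also have "\<dots> = (\<integral>\<omega>. exp (- u * Y t \<omega>) - 1 \<partial>N)"
            using iu by (simp add: Y.prob_space)
          also have "\<dots> \<le> (\<integral>\<omega>. 4 * u * (1 - exp (- \<bar>Y t \<omega>\<bar>)) + exp (1 - v / u) * exp (- v * Y t \<omega>) \<partial>N)"
            using iu(1) iv(1) ie u v
            by (intro integral_mono Bochner_Integration.integrable_add Bochner_Integration.integrable_diff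
                integrable_mult_right exp_splitting_bound) auto
          also have "\<dots> = 4 * u * (\<integral>\<omega>. 1 - exp (- \<bar>Y t \<omega>\<bar>) \<partial>N) + exp (1 - v / u) * exp (- t * R v)"
            using iv ia by (subst Bochner_Integration.integral_add) (auto simp del: right_diff_distrib_numeral)
          also have "\<dots> \<le> 4 * u * (C / real n) + exp (1 - v / u) * exp c"
          proof (intro add_mono mult_left_mono)
            show "(\<integral>\<omega>. 1 - exp (- \<bar>Y t \<omega>\<bar>) \<partial>N) \<le> C / real n"
              unfolding t_def using elim by (intro C) simp
            have "t * - R v \<le> t * (c * v\<^sup>2)"
              using R_quadratic_bound[OF v(2)] t unfolding c_def by (intro mult_left_mono) auto
            also have "\<dots> = c" using v(3) by (simp add: mult.left_commute)
            finally show "exp (- t * R v) \<le> exp c" by simp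
          qed (use u in auto)
          also have "\<dots> = t * (4 * u * C / T + exp (1 + c) * (v\<^sup>2 * exp (- v / u)))"
          proof -
            have "exp (1 - v / u) * exp c = exp (1 + c) * exp (- v / u)"
              by (simp add: exp_add[symmetric])
            also have "\<dots> = t * v\<^sup>2 * (exp (1 + c) * exp (- v / u))" using v(3) by simp
            finally show ?thesis using T elim by (simp add: t_def field_simps)
          qed
          finally show ?case using t unfolding v_def by (simp only: mult_le_cancel_left_pos)
        qed
        show ?thesis by (rule tendsto_lowerbound[OF lim ev]) simp
      qed
      have "((\<lambda>u. ereal (- R u / u)) \<longlongrightarrow> \<infinity>) at_top"
        using minus_R_over_u_tendsto drift by simp
      then have "\<forall>\<^sub>F u in at_top. ereal (4 * C / T) < ereal (- R u / u)"
        by (rule order_tendstoD) simp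
      then have "\<forall>\<^sub>F u in at_top. 4 * C / T < - R u / u \<and> 1 \<le> u"
        using eventually_ge_at_top[of 1] by eventually_elim simp
      then obtain u where u: "4 * C / T < - R u / u" "1 \<le> u"
        using eventually_happens'[OF trivial_limit_at_top_linorder] by blast
      have "4 * C / T * u < - R u / u * u" using u by (intro mult_strict_right_mono) auto
      also have "- R u / u * u = - R u" using u by simp
      finally have "4 * C / T * u < - R u" .
      with le[OF u(2)] show False by (simp add: mult.commute mult.left_commute)
    qed
  qed
  have "AE \<omega> in N. \<forall>j. \<not> bounded_variation_on 0 (1 / real (Suc j)) (\<lambda>t. Y t \<omega>)"
    by (subst AE_all_countable) (intro allI unbounded, simp)
  then show ?thesis
    unfolding infinite_variation_paths_def
  proof eventually_elim
    case (elim \<omega>)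
    show ?case
    proof (intro allI impI notI)
      fix T :: real assume T: "0 < T" and bv: "bounded_variation_on 0 T (\<lambda>t. Y t \<omega>)"
      obtain j where "1 / real (Suc j) < T" using T by (rule nat_approx_posE)
      then have "bounded_variation_on 0 (1 / real (Suc j)) (\<lambda>t. Y t \<omega>)"
        by (intro bounded_variation_on_subset[OF bv]) simp
      with elim show False by blast
    qed
  qed
qed

theorem proposition4p4:
  fixes P :: "real \<Rightarrow> 'w measure" and X :: "real \<Rightarrow> 'w \<Rightarrow> real"
    and F R :: "real \<Rightarrow> real"
    and b \<alpha> \<beta> :: real and m \<mu> L :: "real measure"
  assumes "conservative_CBI P X"
    and "functional_characteristics P X F R"
    and "immigration_parameters F b m"
    and "branching_parameters R \<alpha> \<beta> \<mu>"
    and "\<not> degenerate_first_kind P X"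
    and "\<not> degenerate_second_kind P X"
    and "limit_distribution P X L"
  shows "0 < effective_drift \<alpha> \<beta> \<mu> \<and>
    measure_support L = {y. ereal b / effective_drift \<alpha> \<beta> \<mu> \<le> ereal y} \<and>
    (\<forall>(N :: 'v measure) Y. levy_process_of R N Y \<longrightarrow>
      (measure_support L = {0..} \<longleftrightarrow> b = 0 \<or> infinite_variation_paths N Y))"
proof -
  obtain \<phi> \<psi> where exponents: "affine_exponents P X \<phi> \<psi>"
    "\<And>u. 0 \<le> u \<Longrightarrow> ((\<lambda>t. \<phi> t u) has_real_derivative F u) (at 0 within {0..})"
    "\<And>u. 0 \<le> u \<Longrightarrow> ((\<lambda>t. \<psi> t u) has_real_derivative R u) (at 0 within {0..})"
    using assms(2) unfolding functional_characteristics_def by blast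
  interpret CBI_process P X \<phi> \<psi> F R
    using assms(1) exponents
    unfolding conservative_CBI_def CBI_process_def CBI_process_axioms_def by blast
  interpret imm: finite_variation_jump_measure m by (rule immigration_parametersD(1)[OF assms(3)])
  interpret branch: branching_mechanism \<mu> R \<alpha> \<beta> by (rule branching_parametersD[OF assms(4)])
  interpret L: nonneg_distribution L by (rule limit_distribution_nonneg[OF assms(7)])
  have b: "0 \<le> b" by (rule immigration_parametersD(2)[OF assms(3)])
  have F_eq: "F u = b * u + imm.jump_exponent u" if "0 \<le> u" for u
    by (rule immigration_parametersD(3)[OF assms(3) that])
  have immigration: "b \<noteq> 0 \<or> emeasure m {0<..} \<noteq> 0"
  proof (rule ccontr)
    assume "\<not> (b \<noteq> 0 \<or> emeasure m {0<..} \<noteq> 0)"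
    then have "F u = 0" if "0 \<le> u" for u
      using F_eq[OF that] by (simp add: imm.jump_exponent_null)
    then have "degenerate_second_kind P X" by (rule degenerate_second_kind_if_F_zero)
    with assms(6) show False by simp
  qed
  have nonlinear: "\<alpha> \<noteq> 0 \<or> emeasure m {0<..} \<noteq> 0 \<or> emeasure \<mu> {0<..} \<noteq> 0"
  proof (rule ccontr)
    assume *: "\<not> (\<alpha> \<noteq> 0 \<or> emeasure m {0<..} \<noteq> 0 \<or> emeasure \<mu> {0<..} \<noteq> 0)"
    have "degenerate_first_kind P X"
    proof (rule degenerate_first_kind_if_linear)
      show "F u = b * u" if "0 \<le> u" for u
        using F_eq[OF that] * by (simp add: imm.jump_exponent_null)
      show "R u = \<beta> * u" if "0 \<le> u" for u
        using branch.R_eq[OF that] * by (simp add: branch.null_iff)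
    qed
    with assms(5) show False by simp
  qed
  note stationary = stationary_equation[OF assms(7)]
  \<comment> \<open>The order matters: negativity comes from the generator equation alone and only
    then permits the compensation of all jumps.\<close>
  have R_neg: "R u < 0" if u: "0 < u" for u
  proof (rule ccontr)
    assume R: "\<not> R u < 0"
    have "0 < F u"
    proof (cases "emeasure m {0<..} = 0")
      case True
      then have "0 < b" using immigration b by simp
      then show ?thesis
        using F_eq[of u] imm.jump_exponent_nonneg[of u] u by (simp add: add_pos_nonneg)
    next
      case False
      then show ?thesis
        using F_eq[of u] imm.jump_exponent_pos[OF u] b u by (simp add: add_nonneg_pos)
    qed
    then have "0 < F u * L.laplace u" using L.laplace_pos[of u] u by simp
    also have "\<dots> = - R u * L.laplace_moment u" by (rule stationary[OF u])
    also have "\<dots> \<le> 0" using R L.laplace_moment_nonneg by (simp add: mult_nonneg_nonneg)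
    finally show False by simp
  qed
  interpret sub: subcritical_branching_mechanism \<mu> R \<alpha> \<beta>
    using R_neg by unfold_locales
  interpret lim: CBI_limit m \<mu> R \<alpha> \<beta> L F b
    using b F_eq stationary immigration nonlinear by unfold_locales
  have pos: "0 < effective_drift \<alpha> \<beta> \<mu>" by (rule sub.effective_drift_pos)
  have start: "ereal b / effective_drift \<alpha> \<beta> \<mu> = ereal lim.support_start"
    using pos by (cases "effective_drift \<alpha> \<beta> \<mu>") (auto simp: lim.support_start_def)
  have supp: "measure_support L = {y. ereal b / effective_drift \<alpha> \<beta> \<mu> \<le> ereal y}"
    unfolding start lim.measure_support_eq by auto
  \<comment> \<open>Since the drift is positive, its quotient with \<open>b\<close> vanishes only
    for b = 0 or infinite drift; the latter is then translated into path variation.\<close>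
  have "measure_support L = {0..} \<longleftrightarrow> b = 0 \<or> effective_drift \<alpha> \<beta> \<mu> = \<infinity>"
    unfolding lim.measure_support_eq
    using pos by (cases "effective_drift \<alpha> \<beta> \<mu>") (auto simp: lim.support_start_def)
  then have "measure_support L = {0..} \<longleftrightarrow> b = 0 \<or> infinite_variation_paths N Y"
    if "levy_process_of R N Y" for N :: "'v measure" and Y
    using sub.infinite_variation_if_infinite_drift[OF that]
      branch.not_infinite_variation_if_finite_drift[OF that] by blast
  with pos supp show ?thesis by blast
qed

end
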